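(* Let $\pi$ be an abelian group and let $(H=\{H_\alpha\}_{\alpha\in\pi},\cdot,B)$ be a Rota-Baxter Hopf $\pi$-algebra with antipode $S$. Define, for all $g\in H_\alpha$, $h\in H_\beta$, $\alpha,\beta\in\pi$, $$g\circ_B h:=g_{(1,\alpha)}B_\alpha(g_{(2,\alpha)})\,h\,S_{\bar\alpha}(B_\alpha(g_{(3,\alpha)})),\qquad T_\alpha(g):=S_{\bar\alpha}(B_\alpha(g_{(1,\alpha)}))S_\alpha(g_{(2,\alpha)})B_\alpha(g_{(3,\alpha)}).$$ Then $(H,\cdot,\circ_B)$, where $T=\{T_\alpha\}_{\alpha\in\pi}$ is the antipode for $\circ_B$, is a cocommutative Hopf $\pi$-brace.
   Context: All spaces and tensor products are over a base field $\Bbbk$. Let $\pi$ be an abelian group with unit $e$; write $\bar\alpha=\alpha^{-1}$. A Hopf $\pi$-algebra is a family $H=\{H_\alpha\}_{\alpha\in\pi}$ of coalgebras $(H_\alpha,\Delta_\alpha,\varepsilon_\alpha)$ with linear maps $m_{\alpha,\beta}:H_\alpha\otimes H_\beta\to H_{\alpha\beta}$ (the multiplication) and $\eta:\Bbbk\to H_e$ (the unit, $1=1_e=\eta(1)\in H_e$) that are coalgebra maps, associative and unital in the graded sense, and with an antipode, a family of linear maps $S_\alpha:H_\alpha\to H_{\bar\alpha}$ with $S_\alpha(h_{(1,\alpha)})h_{(2,\alpha)}=\varepsilon_\alpha(h)1=h_{(1,\alpha)}S_\alpha(h_{(2,\alpha)})$. Here $\Delta_\alpha(h)=h_{(1,\alpha)}\otimes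 h_{(2,\alpha)}$ is Sweedler notation. $H$ is cocommutative if every $H_\alpha$ is cocommutative. A Rota-Baxter Hopf $\pi$-algebra $(H,B)$ is a cocommutative Hopf $\pi$-algebra $H$ with a Rota-Baxter operator $B$, i.e. a family of coalgebra homomorphisms $B=\{B_\alpha:H_\alpha\to H_{\bar\alpha}\}_{\alpha\in\pi}$ with $B_\alpha(a)B_\beta(b)=B_{\beta\alpha}\big(a_{(1,\alpha)}B_\alpha(a_{(2,\alpha)})\,b\,S_{\bar\alpha}(B_\alpha(a_{(3,\alpha)}))\big)$ for all $a\in H_\alpha,b\in H_\beta$. A Hopf $\pi$-brace $(H,\cdot,\circ)$ over a family of coalgebras $H=\{H_\alpha\}$ consists of two Hopf $\pi$-algebra structures $(H,\cdot,1,S)$ and $(H,\circ,1_\circ,T)$ on these coalgebras such that, writing $\cdot$ as juxtaposition, $g\circ(h\ell)=(g_{(1,\alpha)}\circ h)S_\alpha(g_{(2,\alpha)})(g_{(3,\alpha)}\circ\ell)$ for all $g\in H_\alpha,h\in H_\beta,\ell\in H_\gamma$ (then $1_\circ=1$). It is cocommutative if each $H_\alpha$ is cocommutative. *)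

theory Defs
  imports Complex_Main "HOL-Library.Function_Algebras"
begin

section \<open>Vector spaces and tensor products\<close>

text \<open>
  A vector space over a field is a subspace (\<open>carr\<close>) of an ambient vector space structure
  (\<open>scal\<close>) on a type.  A family of vector spaces \<open>H \<alpha>\<close> is thus a family of subspaces inside one
  type; no relation between the different members is assumed, so that every family of spaces
  occurs up to isomorphism (inside its direct sum).  Linear maps are total functions of which
  only the values on the carrier matter.
\<close>

record ('k, 'v) vspace =
  scal :: "'k \<Rightarrow> 'v \<Rightarrow> 'v"
  carr :: "'v set"

definition vspace :: "('k::field, 'v::ab_group_add, 'z) vspace_scheme \<Rightarrow> bool" where
  "vspace V \<longleftrightarrow> vector_space (scal V) \<and> module.subspace (scal V) (carr V)"

definition linear_map ::
  "('k::field, 'v::ab_group_add, 'y) vspace_scheme \<Rightarrow>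
   ('k, 'w::ab_group_add, 'z) vspace_scheme \<Rightarrow> ('v \<Rightarrow> 'w) \<Rightarrow> bool" where
  "linear_map V W f \<longleftrightarrow>
     (\<forall>x\<in>carr V. f x \<in> carr W) \<and>
     (\<forall>x\<in>carr V. \<forall>y\<in>carr V. f (x + y) = f x + f y) \<and>
     (\<forall>c. \<forall>x\<in>carr V. f (scal V c x) = scal W c (f x))"

definition bilinear_map ::
  "('k::field, 'u::ab_group_add, 'x) vspace_scheme \<Rightarrow>
   ('k, 'v::ab_group_add, 'y) vspace_scheme \<Rightarrow>
   ('k, 'w::ab_group_add, 'z) vspace_scheme \<Rightarrow> ('u \<Rightarrow> 'v \<Rightarrow> 'w) \<Rightarrow> bool" where
  "bilinear_map U V W f \<longleftrightarrow>
     (\<forall>x\<in>carr U. linear_map V W (f x)) \<and> (\<forall>y\<in>carr V. linear_map U W (\<lambda>x. f x y))"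

text \<open>
  The pure tensor of \<open>x\<close> and \<open>y\<close> is the functional \<open>b \<mapsto> b x y\<close> on the space of all bilinear
  forms on the two ambient spaces (extended by 0 to functions that are not bilinear forms), and
  the tensor product of two spaces is the span of the pure tensors of their elements.  Over a
  field this is a model of the tensor product; its universal property is lemma \<open>lift_sum_list\<close>
  below.
\<close>

definition bilinear_form ::
  "('k::field, 'v::ab_group_add, 'y) vspace_scheme \<Rightarrow>
   ('k, 'w::ab_group_add, 'z) vspace_scheme \<Rightarrow> ('v \<Rightarrow> 'w \<Rightarrow> 'k) \<Rightarrow> bool" where
  "bilinear_form V W b \<longleftrightarrow>
     (\<forall>x. Vector_Spaces.linear (scal W) (*) (b x)) \<and>
     (\<forall>y. Vector_Spaces.linear (scal V) (*) (\<lambda>x. b x y))"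

type_synonym ('k, 'v, 'w) tensor = "('v \<Rightarrow> 'w \<Rightarrow> 'k) \<Rightarrow> 'k"

definition pure_tensor ::
  "('k::field, 'v::ab_group_add, 'y) vspace_scheme \<Rightarrow>
   ('k, 'w::ab_group_add, 'z) vspace_scheme \<Rightarrow> 'v \<Rightarrow> 'w \<Rightarrow> ('k, 'v, 'w) tensor" where
  "pure_tensor V W x y = (\<lambda>b. if bilinear_form V W b then b x y else 0)"

definition tensor_scale :: "'k::field \<Rightarrow> ('k, 'v, 'w) tensor \<Rightarrow> ('k, 'v, 'w) tensor" where
  "tensor_scale c t = (\<lambda>b. c * t b)"

definition tensor_space ::
  "('k::field, 'v::ab_group_add, 'y) vspace_scheme \<Rightarrow>
   ('k, 'w::ab_group_add, 'z) vspace_scheme \<Rightarrow> ('k, ('k, 'v, 'w) tensor) vspace" where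
  "tensor_space V W =
     \<lparr>scal = tensor_scale,
      carr = module.span tensor_scale {pure_tensor V W x y | x y. x \<in> carr V \<and> y \<in> carr W}\<rparr>"

text \<open>
  \<open>lift V W f\<close> is the linear map on the tensor product of \<open>V\<close> and \<open>W\<close> induced by a bilinear map
  \<open>f\<close>: the tensor is written in some way as a sum of pure tensors, and \<open>f\<close> is summed over this
  representation.  For bilinear \<open>f\<close> the choice does not matter (lemma \<open>lift_sum_list\<close>).
\<close>

definition lift ::
  "('k::field, 'v::ab_group_add, 'y) vspace_scheme \<Rightarrow>
   ('k, 'w::ab_group_add, 'z) vspace_scheme \<Rightarrow>
   ('v \<Rightarrow> 'w \<Rightarrow> 'u::ab_group_add) \<Rightarrow> ('k, 'v, 'w) tensor \<Rightarrow> 'u" where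
  "lift V W f t =
     (let xs = (SOME xs. set xs \<subseteq> carr V \<times> carr W \<and> t = (\<Sum>(x, y)\<leftarrow>xs. pure_tensor V W x y))
      in \<Sum>(x, y)\<leftarrow>xs. f x y)"

lemma vector_space_tensor_scale: "vector_space (tensor_scale :: 'k::field \<Rightarrow> ('k, 'v, 'w) tensor \<Rightarrow> _)"
  by unfold_locales (auto simp: tensor_scale_def fun_eq_iff algebra_simps)

lemma vspace_tensor_space:
  fixes V :: "('k::field, 'v::ab_group_add, 'x) vspace_scheme"
    and W :: "('k, 'w::ab_group_add, 'y) vspace_scheme"
  shows "vspace (tensor_space V W)"
proof -
  interpret vector_space "tensor_scale :: 'k \<Rightarrow> ('k, 'v, 'w) tensor \<Rightarrow> _"
    by (rule vector_space_tensor_scale)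
  show ?thesis
    unfolding vspace_def tensor_space_def vspace.simps
    by (intro conjI vector_space_tensor_scale subspace_span)
qed

lemma sum_list_fun_apply: "(\<Sum>p\<leftarrow>xs. g p) b = (\<Sum>p\<leftarrow>xs. g p b)"
  by (induction xs) auto

lemma bilinear_map_sum_zero:
  fixes V :: "('k::field, 'v::ab_group_add, 'x) vspace_scheme"
    and W :: "('k, 'w::ab_group_add, 'y) vspace_scheme"
    and U :: "('k, 'u::ab_group_add, 'z) vspace_scheme"
  assumes V: "vspace V" and W: "vspace W" and U: "vspace U" and f: "bilinear_map V W U f"
    and xs: "set xs \<subseteq> carr V \<times> carr W"
    and zero: "(\<Sum>(x, y)\<leftarrow>xs. pure_tensor V W x y) = 0"
  shows "(\<Sum>(x, y)\<leftarrow>xs. f x y) = 0"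
proof (rule ccontr)
  let ?u = "\<Sum>(x, y)\<leftarrow>xs. f x y"
  assume u: "?u \<noteq> 0"
  interpret V: vector_space "scal V" using V by (simp add: vspace_def)
  interpret W: vector_space "scal W" using W by (simp add: vspace_def)
  interpret U: vector_space "scal U" using U by (simp add: vspace_def)
  interpret K: vector_space "(*) :: 'k \<Rightarrow> 'k \<Rightarrow> 'k" by unfold_locales (auto simp: algebra_simps)
  interpret VV: vector_space_pair "scal V" "scal V" ..
  interpret WW: vector_space_pair "scal W" "scal W" ..
  interpret UK: vector_space_pair "scal U" "(*) :: 'k \<Rightarrow> 'k \<Rightarrow> 'k" ..
  have sV: "V.subspace (carr V)" and sW: "W.subspace (carr W)" using V W by (auto simp: vspace_def)
  obtain P where P: "range P \<subseteq> carr V" "Vector_Spaces.linear (scal V) (scal V) P"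
      "\<And>v. v \<in> carr V \<Longrightarrow> P v = v"
    using VV.linear_exists_left_inverse_on[OF V.linear_id sV] by (auto simp: inj_on_def)
  obtain Q where Q: "range Q \<subseteq> carr W" "Vector_Spaces.linear (scal W) (scal W) Q"
      "\<And>v. v \<in> carr W \<Longrightarrow> Q v = v"
    using WW.linear_exists_left_inverse_on[OF W.linear_id sW] by (auto simp: inj_on_def)
  have "U.independent {?u}" using u by simp
  then obtain \<phi> where \<phi>: "Vector_Spaces.linear (scal U) (*) \<phi>" "\<phi> ?u = 1"
    using UK.linear_independent_extend[of "{?u}" "\<lambda>_. 1"] by auto
  have PV: "P x \<in> carr V" for x using P by auto
  have QW: "Q x \<in> carr W" for x using Q by auto
  interpret P: Vector_Spaces.linear "scal V" "scal V" P by (rule P)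
  interpret Q: Vector_Spaces.linear "scal W" "scal W" Q by (rule Q)
  interpret \<phi>: Vector_Spaces.linear "scal U" "(*)" \<phi> by (rule \<phi>)
  define b where "b = (\<lambda>x y. \<phi> (f (P x) (Q y)))"
  have add: "f (x + x') y = f x y + f x' y" "f x (y + y') = f x y + f x y'"
    if "x \<in> carr V" "x' \<in> carr V" "y \<in> carr W" "y' \<in> carr W" for x x' y y'
    using that f by (auto simp: bilinear_map_def linear_map_def)
  have scale: "f (scal V c x) y = scal U c (f x y)" "f x (scal W c y) = scal U c (f x y)"
    if "x \<in> carr V" "y \<in> carr W" for x y c
    using that f by (auto simp: bilinear_map_def linear_map_def)
  have b: "bilinear_form V W b"
    unfolding bilinear_form_def
  proof (intro conjI allI)
    show "Vector_Spaces.linear (scal W) (*) (b x)" for x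
      by unfold_locales (simp_all add: b_def P.add P.scale Q.add Q.scale \<phi>.add \<phi>.scale add(2)[OF PV PV QW QW] scale(2) PV QW)
    show "Vector_Spaces.linear (scal V) (*) (\<lambda>x. b x y)" for y
      by unfold_locales (simp_all add: b_def P.add P.scale Q.add Q.scale \<phi>.add \<phi>.scale add(1)[OF PV PV QW QW] scale(1) PV QW)
  qed
  have "0 = (\<Sum>(x, y)\<leftarrow>xs. pure_tensor V W x y) b" by (simp add: zero)
  also have "\<dots> = (\<Sum>(x, y)\<leftarrow>xs. b x y)"
    by (simp add: sum_list_fun_apply pure_tensor_def b case_prod_unfold)
  also have "\<dots> = \<phi> ?u"
    using xs by (induction xs) (auto simp: \<phi>.zero \<phi>.add b_def P(3) Q(3))
  finally show False using \<phi>(2) by simp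
qed

lemma lift_sum_list:
  fixes V :: "('k::field, 'v::ab_group_add, 'x) vspace_scheme"
    and W :: "('k, 'w::ab_group_add, 'y) vspace_scheme"
    and U :: "('k, 'u::ab_group_add, 'z) vspace_scheme"
  assumes V: "vspace V" and W: "vspace W" and U: "vspace U" and f: "bilinear_map V W U f"
    and xs: "set xs \<subseteq> carr V \<times> carr W"
  shows "lift V W f (\<Sum>(x, y)\<leftarrow>xs. pure_tensor V W x y) = (\<Sum>(x, y)\<leftarrow>xs. f x y)"
proof -
  let ?t = "\<Sum>(x, y)\<leftarrow>xs. pure_tensor V W x y"
  define ys where "ys = (SOME ys. set ys \<subseteq> carr V \<times> carr W \<and> ?t = (\<Sum>(x, y)\<leftarrow>ys. pure_tensor V W x y))"
  have "set ys \<subseteq> carr V \<times> carr W \<and> ?t = (\<Sum>(x, y)\<leftarrow>ys. pure_tensor V W x y)"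
    unfolding ys_def by (rule someI[of _ xs]) (use xs in simp)
  then have ys: "set ys \<subseteq> carr V \<times> carr W" "?t = (\<Sum>(x, y)\<leftarrow>ys. pure_tensor V W x y)" by auto
  interpret V: vector_space "scal V" using V by (simp add: vspace_def)
  interpret W: vector_space "scal W" using W by (simp add: vspace_def)
  interpret U: vector_space "scal U" using U by (simp add: vspace_def)
  define zs where "zs = map (\<lambda>(x, y). (scal V (- 1) x, y)) ys"
  have neg: "scal V (- 1) x \<in> carr V" if "x \<in> carr V" for x
    using that V V.subspace_scale[of "carr V" x "- 1"] by (simp add: vspace_def)
  have zs: "set zs \<subseteq> carr V \<times> carr W" using ys(1) neg by (fastforce simp: zs_def)
  have "pure_tensor V W (scal V (- 1) x) y = - pure_tensor V W x y" for x y
  proof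
    fix b
    show "pure_tensor V W (scal V (- 1) x) y b = (- pure_tensor V W x y) b"
    proof (cases "bilinear_form V W b")
      case True
      then interpret b: Vector_Spaces.linear "scal V" "(*)" "\<lambda>x. b x y" by (simp add: bilinear_form_def)
      show ?thesis using b.scale[of "-1" x] by (simp add: pure_tensor_def)
    qed (simp add: pure_tensor_def)
  qed
  then have 1: "(\<Sum>(x, y)\<leftarrow>zs. pure_tensor V W x y) = - (\<Sum>(x, y)\<leftarrow>ys. pure_tensor V W x y)"
    unfolding zs_def by (induction ys) auto
  have "f (scal V (- 1) x) y = scal U (- 1) (f x y)" if "x \<in> carr V" "y \<in> carr W" for x y
    using that f by (auto simp only: bilinear_map_def linear_map_def)
  then have 2: "(\<Sum>(x, y)\<leftarrow>zs. f x y) = - (\<Sum>(x, y)\<leftarrow>ys. f x y)"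
    using ys(1) unfolding zs_def by (induction ys) auto
  have "(\<Sum>(x, y)\<leftarrow>xs @ zs. pure_tensor V W x y) = 0" using 1 ys(2) by simp
  from bilinear_map_sum_zero[OF V W U f _ this] xs zs
  have "(\<Sum>(x, y)\<leftarrow>xs @ zs. f x y) = 0" by simp
  then have "(\<Sum>(x, y)\<leftarrow>xs. f x y) = (\<Sum>(x, y)\<leftarrow>ys. f x y)" using 2 by simp
  then show ?thesis unfolding lift_def ys_def Let_def by simp
qed

lemma tensor_representation:
  fixes V :: "('k::field, 'v::ab_group_add, 'x) vspace_scheme"
    and W :: "('k, 'w::ab_group_add, 'y) vspace_scheme"
  assumes V: "vspace V" and t: "t \<in> carr (tensor_space V W)"
  obtains xs where "set xs \<subseteq> carr V \<times> carr W" "t = (\<Sum>(x, y)\<leftarrow>xs. pure_tensor V W x y)"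
proof -
  interpret V: vector_space "scal V" using V by (simp add: vspace_def)
  interpret T: vector_space "tensor_scale :: 'k \<Rightarrow> ('k, 'v, 'w) tensor \<Rightarrow> _"
    by (rule vector_space_tensor_scale)
  have "t \<in> T.span {pure_tensor V W x y | x y. x \<in> carr V \<and> y \<in> carr W}"
    using t by (simp add: tensor_space_def)
  then have "\<exists>xs. set xs \<subseteq> carr V \<times> carr W \<and> t = (\<Sum>(x, y)\<leftarrow>xs. pure_tensor V W x y)"
  proof (induction rule: T.span_induct_alt)
    case base
    show ?case by (rule exI[of _ "[]"]) simp
  next
    case (step c a t)
    then obtain x y xs where *: "a = pure_tensor V W x y" "x \<in> carr V" "y \<in> carr W"
        "set xs \<subseteq> carr V \<times> carr W" "t = (\<Sum>(x, y)\<leftarrow>xs. pure_tensor V W x y)" by auto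
    have "tensor_scale c (pure_tensor V W x y) = pure_tensor V W (scal V c x) y"
    proof
      fix b
      show "tensor_scale c (pure_tensor V W x y) b = pure_tensor V W (scal V c x) y b"
      proof (cases "bilinear_form V W b")
        case True
        then interpret b: Vector_Spaces.linear "scal V" "(*)" "\<lambda>x. b x y" by (simp add: bilinear_form_def)
        show ?thesis using b.scale[of c x] by (simp add: pure_tensor_def tensor_scale_def)
      qed (simp add: pure_tensor_def tensor_scale_def)
    qed
    moreover have "scal V c x \<in> carr V" using V * by (auto simp: vspace_def V.subspace_def)
    ultimately show ?case using * by (intro exI[of _ "(scal V c x, y) # xs"]) auto
  qed
  then show ?thesis using that by blast
qed


section \<open>Coalgebras\<close>

record ('k, 'v) coalgebra = "('k, 'v) vspace" +
  comult :: "'v \<Rightarrow> ('k, 'v, 'v) tensor"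
  counit :: "'v \<Rightarrow> 'k"

text \<open>
  Sweedler notation: \<open>sweedler2 C f h\<close> stands for the expression in \<open>h\<^sub>(\<^sub>1\<^sub>)\<close>, \<open>h\<^sub>(\<^sub>2\<^sub>)\<close> given by \<open>f\<close>,
  and \<open>sweedler3\<close> likewise uses the iterated comultiplication \<open>(\<Delta> \<otimes> id) \<Delta>\<close>.
\<close>

definition sweedler2 ::
  "('k::field, 'v::ab_group_add, 'z) coalgebra_scheme \<Rightarrow>
   ('v \<Rightarrow> 'v \<Rightarrow> 'u::ab_group_add) \<Rightarrow> 'v \<Rightarrow> 'u" where
  "sweedler2 C f h = lift C C f (comult C h)"

definition sweedler3 ::
  "('k::field, 'v::ab_group_add, 'z) coalgebra_scheme \<Rightarrow>
   ('v \<Rightarrow> 'v \<Rightarrow> 'v \<Rightarrow> 'u::ab_group_add) \<Rightarrow> 'v \<Rightarrow> 'u" where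
  "sweedler3 C f h = sweedler2 C (\<lambda>x z. sweedler2 C (\<lambda>x1 x2. f x1 x2 z) x) h"

definition ground :: "('k::field, 'k) vspace" where
  "ground = \<lparr>scal = (*), carr = UNIV\<rparr>"

text \<open>Both sides of coassociativity are taken in \<open>(C \<otimes> C) \<otimes> C\<close>.\<close>

locale coalgebra =
  fixes C :: "('k::field, 'v::ab_group_add) coalgebra"
  assumes vspace: "vspace C"
    and linear_comult: "linear_map C (tensor_space C C) (comult C)"
    and linear_counit: "linear_map C ground (counit C)"
    and coassoc: "h \<in> carr C \<Longrightarrow>
      sweedler2 C (\<lambda>x y. pure_tensor (tensor_space C C) C (comult C x) y) h =
      sweedler2 C (\<lambda>x y.
        sweedler2 C (\<lambda>y1 y2. pure_tensor (tensor_space C C) C (pure_tensor C C x y1) y2) y) h"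
    and counit_left: "h \<in> carr C \<Longrightarrow> sweedler2 C (\<lambda>x y. scal C (counit C x) y) h = h"
    and counit_right: "h \<in> carr C \<Longrightarrow> sweedler2 C (\<lambda>x y. scal C (counit C y) x) h = h"

definition cocommutative :: "('k::field, 'v::ab_group_add) coalgebra \<Rightarrow> bool" where
  "cocommutative C \<longleftrightarrow> (\<forall>h\<in>carr C. sweedler2 C (\<lambda>x y. pure_tensor C C y x) h = comult C h)"

definition coalgebra_hom ::
  "('k::field, 'v::ab_group_add) coalgebra \<Rightarrow> ('k, 'w::ab_group_add) coalgebra \<Rightarrow>
   ('v \<Rightarrow> 'w) \<Rightarrow> bool" where
  "coalgebra_hom C D f \<longleftrightarrow>
     linear_map C D f \<and>
     (\<forall>h\<in>carr C. comult D (f h) = sweedler2 C (\<lambda>x y. pure_tensor D D (f x) (f y)) h) \<and>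
     (\<forall>h\<in>carr C. counit D (f h) = counit C h)"

definition ground_coalgebra :: "('k::field, 'k) coalgebra" where
  "ground_coalgebra =
     \<lparr>scal = (*), carr = UNIV, comult = (\<lambda>c. pure_tensor ground ground c 1), counit = (\<lambda>c. c)\<rparr>"

definition tensor_coalgebra ::
  "('k::field, 'v::ab_group_add) coalgebra \<Rightarrow> ('k, 'w::ab_group_add) coalgebra \<Rightarrow>
   ('k, ('k, 'v, 'w) tensor) coalgebra" where
  "tensor_coalgebra C D =
     \<lparr>scal = scal (tensor_space C D), carr = carr (tensor_space C D),
      comult = lift C D (\<lambda>g h.
        sweedler2 C (\<lambda>g1 g2. sweedler2 D (\<lambda>h1 h2.
          pure_tensor (tensor_space C D) (tensor_space C D)
            (pure_tensor C D g1 h1) (pure_tensor C D g2 h2)) h) g),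
      counit = lift C D (\<lambda>g h. counit C g * counit D h)\<rparr>"


section \<open>Hopf $\pi$-algebras and Hopf $\pi$-braces\<close>

text \<open>
  The abelian group \<open>\<pi>\<close> is the type \<open>'p\<close>, written additively.  The multiplication
  \<open>H \<alpha> \<otimes> H \<beta> \<rightarrow> H (\<alpha> + \<beta>)\<close> is given as the bilinear map \<open>m \<alpha> \<beta>\<close>; the associated linear map
  on the tensor product is its \<open>lift\<close>.  The unit map is \<open>c \<mapsto> c 1\<close> for an element \<open>one\<close> of \<open>H 0\<close>.
\<close>

locale hopf_pi_algebra =
  fixes H :: "'p::ab_group_add \<Rightarrow> ('k::field, 'v::ab_group_add) coalgebra"
    and m :: "'p \<Rightarrow> 'p \<Rightarrow> 'v \<Rightarrow> 'v \<Rightarrow> 'v"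
    and one :: 'v
    and S :: "'p \<Rightarrow> 'v \<Rightarrow> 'v"
  assumes coalgebra: "coalgebra (H \<alpha>)"
    and bilinear_mult: "bilinear_map (H \<alpha>) (H \<beta>) (H (\<alpha> + \<beta>)) (m \<alpha> \<beta>)"
    and coalgebra_hom_mult:
      "coalgebra_hom (tensor_coalgebra (H \<alpha>) (H \<beta>)) (H (\<alpha> + \<beta>)) (lift (H \<alpha>) (H \<beta>) (m \<alpha> \<beta>))"
    and one_closed: "one \<in> carr (H 0)"
    and coalgebra_hom_unit: "coalgebra_hom ground_coalgebra (H 0) (\<lambda>c. scal (H 0) c one)"
    and assoc: "\<lbrakk>a \<in> carr (H \<alpha>); b \<in> carr (H \<beta>); c \<in> carr (H \<gamma>)\<rbrakk> \<Longrightarrow>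
      m (\<alpha> + \<beta>) \<gamma> (m \<alpha> \<beta> a b) c = m \<alpha> (\<beta> + \<gamma>) a (m \<beta> \<gamma> b c)"
    and unit_left: "a \<in> carr (H \<alpha>) \<Longrightarrow> m 0 \<alpha> one a = a"
    and unit_right: "a \<in> carr (H \<alpha>) \<Longrightarrow> m \<alpha> 0 a one = a"
    and linear_antipode: "linear_map (H \<alpha>) (H (- \<alpha>)) (S \<alpha>)"
    and antipode_left: "h \<in> carr (H \<alpha>) \<Longrightarrow>
      sweedler2 (H \<alpha>) (\<lambda>x y. m (- \<alpha>) \<alpha> (S \<alpha> x) y) h = scal (H 0) (counit (H \<alpha>) h) one"
    and antipode_right: "h \<in> carr (H \<alpha>) \<Longrightarrow>
      sweedler2 (H \<alpha>) (\<lambda>x y. m \<alpha> (- \<alpha>) x (S \<alpha> y)) h = scal (H 0) (counit (H \<alpha>) h) one"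

locale cocommutative_hopf_pi_algebra = hopf_pi_algebra H m one S
  for H :: "'p::ab_group_add \<Rightarrow> ('k::field, 'v::ab_group_add) coalgebra" and m one S +
  assumes cocommutative: "cocommutative (H \<alpha>)"

text \<open>
  \<open>g \<circ>\<^sub>B h = g\<^sub>(\<^sub>1\<^sub>) B(g\<^sub>(\<^sub>2\<^sub>)) h S(B(g\<^sub>(\<^sub>3\<^sub>)))\<close> for \<open>g\<close> of degree \<open>\<alpha>\<close> and \<open>h\<close> of degree \<open>\<beta>\<close>; the
  degrees of the partial products are \<open>\<alpha> + - \<alpha> = 0\<close>, then \<open>\<beta>\<close>, then \<open>\<beta> + \<alpha>\<close>.
\<close>

definition rb_circ ::
  "('p::ab_group_add \<Rightarrow> ('k::field, 'v::ab_group_add) coalgebra) \<Rightarrow>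
   ('p \<Rightarrow> 'p \<Rightarrow> 'v \<Rightarrow> 'v \<Rightarrow> 'v) \<Rightarrow> ('p \<Rightarrow> 'v \<Rightarrow> 'v) \<Rightarrow> ('p \<Rightarrow> 'v \<Rightarrow> 'v) \<Rightarrow>
   'p \<Rightarrow> 'p \<Rightarrow> 'v \<Rightarrow> 'v \<Rightarrow> 'v" where
  "rb_circ H m S B \<alpha> \<beta> g h =
     sweedler3 (H \<alpha>) (\<lambda>x y z.
       m \<beta> \<alpha> (m 0 \<beta> (m \<alpha> (- \<alpha>) x (B \<alpha> y)) h) (S (- \<alpha>) (B \<alpha> z))) g"

definition rb_antipode ::
  "('p::ab_group_add \<Rightarrow> ('k::field, 'v::ab_group_add) coalgebra) \<Rightarrow>
   ('p \<Rightarrow> 'p \<Rightarrow> 'v \<Rightarrow> 'v \<Rightarrow> 'v) \<Rightarrow> ('p \<Rightarrow> 'v \<Rightarrow> 'v) \<Rightarrow> ('p \<Rightarrow> 'v \<Rightarrow> 'v) \<Rightarrow>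
   'p \<Rightarrow> 'v \<Rightarrow> 'v" where
  "rb_antipode H m S B \<alpha> g =
     sweedler3 (H \<alpha>) (\<lambda>x y z.
       m 0 (- \<alpha>) (m \<alpha> (- \<alpha>) (S (- \<alpha>) (B \<alpha> x)) (S \<alpha> y)) (B \<alpha> z)) g"

locale rota_baxter_hopf_pi_algebra = cocommutative_hopf_pi_algebra H m one S
  for H :: "'p::ab_group_add \<Rightarrow> ('k::field, 'v::ab_group_add) coalgebra" and m one S +
  fixes B :: "'p \<Rightarrow> 'v \<Rightarrow> 'v"
  assumes coalgebra_hom_rb: "coalgebra_hom (H \<alpha>) (H (- \<alpha>)) (B \<alpha>)"
    and rota_baxter: "\<lbrakk>a \<in> carr (H \<alpha>); b \<in> carr (H \<beta>)\<rbrakk> \<Longrightarrow>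
      m (- \<alpha>) (- \<beta>) (B \<alpha> a) (B \<beta> b) = B (\<beta> + \<alpha>) (rb_circ H m S B \<alpha> \<beta> a b)"

locale hopf_pi_brace =
  dot: hopf_pi_algebra H m one S + circ: hopf_pi_algebra H circ one_circ T
  for H :: "'p::ab_group_add \<Rightarrow> ('k::field, 'v::ab_group_add) coalgebra"
    and m one S circ one_circ T +
  assumes brace: "\<lbrakk>g \<in> carr (H \<alpha>); h \<in> carr (H \<beta>); l \<in> carr (H \<gamma>)\<rbrakk> \<Longrightarrow>
      circ \<alpha> (\<beta> + \<gamma>) g (m \<beta> \<gamma> h l) =
      sweedler3 (H \<alpha>) (\<lambda>x y z.
        m \<beta> (\<alpha> + \<gamma>) (m (\<alpha> + \<beta>) (- \<alpha>) (circ \<alpha> \<beta> x h) (S \<alpha> y)) (circ \<alpha> \<gamma> z l)) g"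

locale cocommutative_hopf_pi_brace = hopf_pi_brace H m one S circ one_circ T
  for H :: "'p::ab_group_add \<Rightarrow> ('k::field, 'v::ab_group_add) coalgebra"
    and m one S circ one_circ T +
  assumes cocommutative: "cocommutative (H \<alpha>)"

end

theory Submission
  imports Defs "HOL-Algebra.Group"
begin

text \<open>
  For a cocommutative coalgebra \<open>X\<close>, the coalgebra maps from \<open>X\<close> to the members of \<open>H\<close> form
  a group under convolution, on which \<open>f \<mapsto> B f\<close> is a Rota-Baxter operator. In a Rota-Baxter
  group, \<open>f \<circ> g = f B(f) g B(f)\<^sup>-\<^sup>1\<close> is a second group operation, with inverse
  \<open>B(f)\<^sup>-\<^sup>1 f\<^sup>-\<^sup>1 B(f)\<close>. Taking for \<open>X\<close> tensor products of members of \<open>H\<close>, and for \<open>f\<close>, \<open>g\<close>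
  the projections to the factors, turns these group identities into the axioms of \<open>(H, \<circ>\<^sub>B)\<close>.
  The brace identity is obtained in the convolution monoid of linear maps on a single \<open>H\<^sub>\<alpha>\<close>.
\<close>

section \<open>Linear and multilinear maps\<close>

text \<open>The restriction to coalgebra maps is what makes group identities available: for such
  \<open>f\<close> the legs of \<open>f x\<close> are the images of the legs of \<open>x\<close>, so
  an expression in several legs of \<open>f x\<close> becomes a convolution product in which
  \<open>f\<close> occurs several times. The projections of a tensor product act as generic
  elements: a multilinear expression convolved along them takes at
  \<open>a \<otimes> b \<otimes> c\<close> the value that it has at \<open>a\<close>,
  \<open>b\<close>, \<open>c\<close>. Cocommutativity enters in three places: the antipode, which is
  not assumed to be a coalgebra map, preserves coproducts instead of reversing them; convolution
  products of coalgebra maps are again coalgebra maps; and the legs of an element can be reordered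
  to bring a convolution product into the form of \<open>g \<circ> h\<close>. In the brace identity
  \<open>h\<close> and \<open>l\<close> are represented by maps such as
  \<open>x \<mapsto> \<epsilon>(x) h\<close>, which in general are not coalgebra maps. Linear maps
  form only a monoid, but that is enough: just the identity and \<open>B\<close> have to be
  inverted, by \<open>S\<close> and \<open>S B\<close>.\<close>

lemma vspaceD:
  assumes "vspace V"
  shows "0 \<in> carr V" "x \<in> carr V \<Longrightarrow> y \<in> carr V \<Longrightarrow> x + y \<in> carr V"
    "x \<in> carr V \<Longrightarrow> scal V c x \<in> carr V"
    "scal V (a * b) x = scal V a (scal V b x)" "scal V 1 x = x"
    "scal V (a + b) x = scal V a x + scal V b x" "scal V c (x + y) = scal V c x + scal V c y"
proof -
  interpret vector_space "scal V" using assms by (simp add: vspace_def)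
  have *: "subspace (carr V)" using assms by (simp add: vspace_def)
  show "0 \<in> carr V" "x \<in> carr V \<Longrightarrow> y \<in> carr V \<Longrightarrow> x + y \<in> carr V"
    "x \<in> carr V \<Longrightarrow> scal V c x \<in> carr V"
    using * by (auto simp: subspace_def)
qed (use assms in \<open>auto simp: vspace_def vector_space_def\<close>)

lemma vspace_scale_commute: "vspace V \<Longrightarrow> scal V a (scal V b x) = scal V b (scal V a x)"
  by (simp add: mult.commute flip: vspaceD(4))

lemma linear_mapD:
  assumes "linear_map V W f" "x \<in> carr V"
  shows "f x \<in> carr W" "y \<in> carr V \<Longrightarrow> f (x + y) = f x + f y" "f (scal V c x) = scal W c (f x)"
  using assms by (auto simp: linear_map_def)

lemma linear_mapI:
  assumes "\<And>x. x \<in> carr V \<Longrightarrow> f x \<in> carr W"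
    and "\<And>x y. x \<in> carr V \<Longrightarrow> y \<in> carr V \<Longrightarrow> f (x + y) = f x + f y"
    and "\<And>c x. x \<in> carr V \<Longrightarrow> f (scal V c x) = scal W c (f x)"
  shows "linear_map V W f"
  using assms by (auto simp: linear_map_def)

lemma linear_map_cong:
  assumes V: "vspace V" and f: "linear_map V W f" and eq: "\<And>x. x \<in> carr V \<Longrightarrow> g x = f x"
  shows "linear_map V W g"
  by (rule linear_mapI) (auto simp: eq linear_mapD[OF f] vspaceD[OF V])

lemma linear_map_comp:
  "linear_map V W f \<Longrightarrow> linear_map U V g \<Longrightarrow> linear_map U W (\<lambda>x. f (g x))"
  by (auto simp: linear_map_def)

lemma linear_map_id: "linear_map V V (\<lambda>x. x)"
  by (auto simp: linear_map_def)

lemma linear_map_scale: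
  assumes "vspace W" "linear_map V W f"
  shows "linear_map V W (\<lambda>x. scal W c (f x))"
  by (rule linear_mapI) (auto simp: linear_mapD[OF assms(2)] vspaceD[OF assms(1)] mult.commute
      simp flip: vspaceD(4)[OF assms(1)])

lemma linear_map_scale_left:
  assumes "vspace W" "linear_map V ground f" "w \<in> carr W"
  shows "linear_map V W (\<lambda>x. scal W (f x) w)"
  by (rule linear_mapI)
    (use assms in \<open>auto simp: linear_mapD[OF assms(2)] vspaceD[OF assms(1)] ground_def\<close>)

lemma linear_map_zero:
  assumes "linear_map V W f" "vspace V"
  shows "f 0 = 0"
  using linear_mapD(2)[OF assms(1) vspaceD(1)[OF assms(2)] vspaceD(1)[OF assms(2)]] by simp

lemma vspace_sum_list:
  assumes "vspace V" "\<And>x. x \<in> set xs \<Longrightarrow> f x \<in> carr V"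
  shows "sum_list (map f xs) \<in> carr V"
  using assms(2) by (induction xs) (auto simp: vspaceD[OF assms(1)])

lemma linear_map_sum_list:
  assumes "linear_map V W f" "vspace V" "\<And>x. x \<in> set xs \<Longrightarrow> g x \<in> carr V"
  shows "f (sum_list (map g xs)) = (\<Sum>x\<leftarrow>xs. f (g x))"
  using assms(3)
  by (induction xs)
    (auto simp: linear_map_zero[OF assms(1,2)] linear_mapD[OF assms(1)] vspace_sum_list[OF assms(2)])

lemma linear_map_sum_list_pairs:
  assumes "linear_map V W f" "vspace V" "set xs \<subseteq> A \<times> A'"
    "\<And>x y. x \<in> A \<Longrightarrow> y \<in> A' \<Longrightarrow> g x y \<in> carr V"
  shows "f (\<Sum>(x, y)\<leftarrow>xs. g x y) = (\<Sum>(x, y)\<leftarrow>xs. f (g x y))"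
  unfolding case_prod_unfold
  by (rule linear_map_sum_list[OF assms(1,2)]) (use assms(3,4) in auto)

lemma linear_map_sum_list_param:
  assumes "vspace V" "vspace W" "\<And>y. y \<in> set ys \<Longrightarrow> linear_map V W (\<lambda>x. F x y)"
  shows "linear_map V W (\<lambda>x. \<Sum>y\<leftarrow>ys. F x y)"
  using assms(3)
proof (induction ys)
  case Nil
  interpret vector_space "scal W" using assms(2) by (simp add: vspace_def)
  show ?case by (rule linear_mapI) (auto simp: vspaceD[OF assms(2)])
next
  case (Cons y ys)
  have 1: "linear_map V W (\<lambda>x. F x y)" and 2: "linear_map V W (\<lambda>x. \<Sum>y\<leftarrow>ys. F x y)"
    using Cons by auto
  show ?case
    by (rule linear_mapI)
      (auto simp: linear_mapD[OF 1] linear_mapD[OF 2] vspaceD[OF assms(2)] algebra_simps)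
qed

lemma bilinear_mapI:
  assumes "\<And>x. x \<in> carr U \<Longrightarrow> linear_map V W (f x)"
    and "\<And>y. y \<in> carr V \<Longrightarrow> linear_map U W (\<lambda>x. f x y)"
  shows "bilinear_map U V W f"
  using assms by (auto simp: bilinear_map_def)

lemma bilinear_mapD:
  assumes "bilinear_map U V W f"
  shows "x \<in> carr U \<Longrightarrow> linear_map V W (f x)" "y \<in> carr V \<Longrightarrow> linear_map U W (\<lambda>x. f x y)"
    "x \<in> carr U \<Longrightarrow> y \<in> carr V \<Longrightarrow> f x y \<in> carr W"
  using assms by (auto simp: bilinear_map_def linear_map_def)

lemma bilinear_map_comp:
  assumes "bilinear_map U V W f" "linear_map U' U g" "linear_map V' V h"
  shows "bilinear_map U' V' W (\<lambda>x y. f (g x) (h y))"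
  using assms by (auto simp: bilinear_map_def linear_map_def)

lemma bilinear_map_flip: "bilinear_map U V W f \<Longrightarrow> bilinear_map V U W (\<lambda>x y. f y x)"
  by (auto simp: bilinear_map_def)

definition trilinear_map where
  "trilinear_map U V W Y f \<longleftrightarrow> (\<forall>x\<in>carr U. bilinear_map V W Y (f x)) \<and>
     (\<forall>y\<in>carr V. \<forall>z\<in>carr W. linear_map U Y (\<lambda>x. f x y z))"

lemma trilinear_mapI:
  assumes "\<And>y z. y \<in> carr V \<Longrightarrow> z \<in> carr W \<Longrightarrow> linear_map U Y (\<lambda>x. f x y z)"
    and "\<And>x z. x \<in> carr U \<Longrightarrow> z \<in> carr W \<Longrightarrow> linear_map V Y (\<lambda>y. f x y z)"
    and "\<And>x y. x \<in> carr U \<Longrightarrow> y \<in> carr V \<Longrightarrow> linear_map W Y (\<lambda>z. f x y z)"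
  shows "trilinear_map U V W Y f"
  using assms by (auto simp: trilinear_map_def bilinear_map_def)

lemma trilinear_mapD:
  assumes "trilinear_map U V W Y f"
  shows "y \<in> carr V \<Longrightarrow> z \<in> carr W \<Longrightarrow> linear_map U Y (\<lambda>x. f x y z)"
    "x \<in> carr U \<Longrightarrow> z \<in> carr W \<Longrightarrow> linear_map V Y (\<lambda>y. f x y z)"
    "x \<in> carr U \<Longrightarrow> y \<in> carr V \<Longrightarrow> linear_map W Y (\<lambda>z. f x y z)"
    "x \<in> carr U \<Longrightarrow> bilinear_map V W Y (\<lambda>y z. f x y z)"
    "y \<in> carr V \<Longrightarrow> bilinear_map U W Y (\<lambda>x z. f x y z)"
    "z \<in> carr W \<Longrightarrow> bilinear_map U V Y (\<lambda>x y. f x y z)"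
  using assms by (auto simp: trilinear_map_def bilinear_map_def)

section \<open>Tensor products\<close>

text \<open>Bilinear forms live on the whole ambient types, so a pure tensor depends on the spaces
  only through their scalar multiplications. This identifies pure tensors over
  \<open>tensor_coalgebra C D\<close> with those over \<open>tensor_space C D\<close>, which are
  different records.\<close>

lemma pure_tensor_cong: "scal V = scal V' \<Longrightarrow> scal W = scal W' \<Longrightarrow> pure_tensor V W = pure_tensor V' W'"
  by (intro ext) (simp add: pure_tensor_def bilinear_form_def)

lemma scal_tensor_space: "scal (tensor_space V W) = tensor_scale"
  by (simp add: tensor_space_def)

lemma bilinear_map_pure_tensor:
  fixes V :: "('k::field, 'v::ab_group_add, 'x) vspace_scheme"
    and W :: "('k, 'w::ab_group_add, 'y) vspace_scheme"
  assumes "vspace V" "vspace W"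
  shows "bilinear_map V W (tensor_space V W) (pure_tensor V W)"
proof -
  interpret T: vector_space "tensor_scale :: 'k \<Rightarrow> ('k, 'v, 'w) tensor \<Rightarrow> _"
    by (rule vector_space_tensor_scale)
  have cl: "pure_tensor V W x y \<in> carr (tensor_space V W)" if "x \<in> carr V" "y \<in> carr W" for x y
    using that by (auto simp: tensor_space_def intro!: T.span_base)
  have lin: "b x (y + y') = b x y + b x y'" "b x (scal W c y) = c * b x y"
      "b (x + x') y = b x y + b x' y" "b (scal V c x) y = c * b x y"
    if "bilinear_form V W b" for b x x' y y' c
  proof -
    interpret r: Vector_Spaces.linear "scal W" "(*)" "b x" using that by (simp add: bilinear_form_def)
    interpret l: Vector_Spaces.linear "scal V" "(*)" "\<lambda>x. b x y" using that by (simp add: bilinear_form_def)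
    show "b x (y + y') = b x y + b x y'" "b x (scal W c y) = c * b x y"
      "b (x + x') y = b x y + b x' y" "b (scal V c x) y = c * b x y"
      by (simp_all add: r.add r.scale l.add l.scale)
  qed
  show ?thesis
    by (intro bilinear_mapI linear_mapI cl)
      (auto simp: pure_tensor_def fun_eq_iff scal_tensor_space tensor_scale_def lin)
qed

lemma lift_pure_tensor:
  assumes "vspace V" "vspace W" "vspace U" "bilinear_map V W U f" "x \<in> carr V" "y \<in> carr W"
  shows "lift V W f (pure_tensor V W x y) = f x y"
  using lift_sum_list[OF assms(1-4), of "[(x, y)]"] assms(5,6) by simp

text \<open>The list behind \<open>lift\<close> is an arbitrary choice, so linearity is not visible
  from the definition. By \<open>lift_sum_list\<close> any list may be used: concatenation
  represents a sum, and scaling all left entries represents a multiple.\<close>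

lemma linear_map_lift:
  assumes V: "vspace V" and W: "vspace W" and U: "vspace U" and f: "bilinear_map V W U f"
  shows "linear_map (tensor_space V W) U (lift V W f)"
proof (rule linear_mapI)
  fix t assume "t \<in> carr (tensor_space V W)"
  then obtain xs where xs: "set xs \<subseteq> carr V \<times> carr W" "t = (\<Sum>(x, y)\<leftarrow>xs. pure_tensor V W x y)"
    by (rule tensor_representation[OF V])
  have lift: "lift V W f t = (\<Sum>(x, y)\<leftarrow>xs. f x y)"
    by (simp add: xs lift_sum_list[OF V W U f xs(1)])
  show "lift V W f t \<in> carr U"
    unfolding lift by (rule vspace_sum_list[OF U]) (use xs bilinear_mapD(3)[OF f] in auto)
  {
    fix s assume "s \<in> carr (tensor_space V W)"
    then obtain ys where ys: "set ys \<subseteq> carr V \<times> carr W" "s = (\<Sum>(x, y)\<leftarrow>ys. pure_tensor V W x y)"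
      by (rule tensor_representation[OF V])
    have "t + s = (\<Sum>(x, y)\<leftarrow>xs @ ys. pure_tensor V W x y)" by (simp add: xs ys)
    then show "lift V W f (t + s) = lift V W f t + lift V W f s"
      using lift_sum_list[OF V W U f, of "xs @ ys"] lift_sum_list[OF V W U f ys(1)] xs(1) ys lift by simp
  }
  fix c
  let ?ys = "map (\<lambda>(x, y). (scal V c x, y)) xs"
  have ys: "set ?ys \<subseteq> carr V \<times> carr W" using xs(1) vspaceD(3)[OF V] by fastforce
  have "tensor_scale c t = (\<Sum>(x, y)\<leftarrow>xs. tensor_scale c (pure_tensor V W x y))"
    by (simp add: xs fun_eq_iff tensor_scale_def sum_list_fun_apply sum_list_const_mult case_prod_unfold)
  also have "\<dots> = (\<Sum>(x, y)\<leftarrow>?ys. pure_tensor V W x y)"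
    using xs(1) linear_mapD(3)[OF bilinear_mapD(2)[OF bilinear_map_pure_tensor[OF V W]], unfolded scal_tensor_space]
    by (induction xs) auto
  finally have "lift V W f (tensor_scale c t) = (\<Sum>(x, y)\<leftarrow>?ys. f x y)"
    using lift_sum_list[OF V W U f ys] by simp
  also have "\<dots> = (\<Sum>(x, y)\<leftarrow>xs. scal U c (f x y))"
    using xs(1) linear_mapD(3)[OF bilinear_mapD(2)[OF f]] by (induction xs) auto
  also have "\<dots> = scal U c (lift V W f t)"
    unfolding lift
    by (rule linear_map_sum_list_pairs[OF linear_map_scale[OF U linear_map_id] U xs(1), symmetric])
      (rule bilinear_mapD(3)[OF f])
  finally show "lift V W f (scal (tensor_space V W) c t) = scal U c (lift V W f t)"
    by (simp add: scal_tensor_space)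
qed

text \<open>Linearity in \<open>z\<close> holds because the list that represents \<open>t\<close>
  does not depend on \<open>z\<close>: evaluation on it leaves a finite sum of linear maps.\<close>

lemma bilinear_map_lift:
  assumes U: "vspace U" and V: "vspace V" and W: "vspace W" and Y: "vspace Y"
    and F: "trilinear_map U V W Y F"
  shows "bilinear_map (tensor_space U V) W Y (\<lambda>t z. lift U V (\<lambda>x y. F x y z) t)"
proof (rule bilinear_mapI)
  fix t assume t: "t \<in> carr (tensor_space U V)"
  then obtain xs where xs: "set xs \<subseteq> carr U \<times> carr V" "t = (\<Sum>(x, y)\<leftarrow>xs. pure_tensor U V x y)"
    by (rule tensor_representation[OF U])
  have "linear_map W Y (\<lambda>z. \<Sum>p\<leftarrow>xs. F (fst p) (snd p) z)"
    using xs(1) trilinear_mapD(3)[OF F] by (intro linear_map_sum_list_param[OF W Y]) auto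
  then show "linear_map W Y (\<lambda>z. lift U V (\<lambda>x y. F x y z) t)"
    by (rule linear_map_cong[OF W])
      (simp only: xs(2) lift_sum_list[OF U V Y trilinear_mapD(6)[OF F] xs(1)], simp only: case_prod_unfold)
qed (rule linear_map_lift[OF U V Y trilinear_mapD(6)[OF F]])

lemma tensor_ext:
  assumes V: "vspace V" and W: "vspace W"
    and f: "linear_map (tensor_space V W) U f" and g: "linear_map (tensor_space V W) U g"
    and eq: "\<And>x y. x \<in> carr V \<Longrightarrow> y \<in> carr W \<Longrightarrow> f (pure_tensor V W x y) = g (pure_tensor V W x y)"
    and t: "t \<in> carr (tensor_space V W)"
  shows "f t = g t"
proof -
  obtain xs where xs: "set xs \<subseteq> carr V \<times> carr W" "t = (\<Sum>(x, y)\<leftarrow>xs. pure_tensor V W x y)"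
    by (rule tensor_representation[OF V t])
  note p = bilinear_mapD(3)[OF bilinear_map_pure_tensor[OF V W]]
  have "f t = (\<Sum>(x, y)\<leftarrow>xs. f (pure_tensor V W x y))"
    unfolding xs(2) by (rule linear_map_sum_list_pairs[OF f vspace_tensor_space xs(1) p])
  also have "\<dots> = (\<Sum>(x, y)\<leftarrow>xs. g (pure_tensor V W x y))"
    using xs(1) eq by (intro arg_cong[of _ _ sum_list] map_cong) auto
  also have "\<dots> = g t"
    unfolding xs(2) by (rule linear_map_sum_list_pairs[OF g vspace_tensor_space xs(1) p, symmetric])
  finally show ?thesis .
qed

section \<open>Sweedler calculus\<close>

text \<open>The list that \<open>lift\<close> chooses. It depends on the tensor alone and not on the
  lifted map, so \<open>sweedler2 C F h\<close> is a finite sum over a list fixed by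
  \<open>h\<close>. Congruence and interchange of sums thereby require no multilinearity of
  \<open>F\<close>; that enters where the tensor itself changes.\<close>

definition tensor_terms where
  "tensor_terms V W t =
     (SOME xs. set xs \<subseteq> carr V \<times> carr W \<and> t = (\<Sum>(x, y)\<leftarrow>xs. pure_tensor V W x y))"

lemma tensor_terms:
  assumes "vspace V" "t \<in> carr (tensor_space V W)"
  shows "set (tensor_terms V W t) \<subseteq> carr V \<times> carr W"
    and "t = (\<Sum>(x, y)\<leftarrow>tensor_terms V W t. pure_tensor V W x y)"
proof -
  obtain xs where "set xs \<subseteq> carr V \<times> carr W" "t = (\<Sum>(x, y)\<leftarrow>xs. pure_tensor V W x y)"
    by (rule tensor_representation[OF assms])
  then have "set (tensor_terms V W t) \<subseteq> carr V \<times> carr W \<and> t = (\<Sum>(x, y)\<leftarrow>tensor_terms V W t. pure_tensor V W x y)"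
    unfolding tensor_terms_def by (intro someI) auto
  then show "set (tensor_terms V W t) \<subseteq> carr V \<times> carr W"
    "t = (\<Sum>(x, y)\<leftarrow>tensor_terms V W t. pure_tensor V W x y)" by simp_all
qed

lemma sweedler2_eq: "sweedler2 C F h = (\<Sum>(x, y)\<leftarrow>tensor_terms C C (comult C h). F x y)"
  by (simp add: sweedler2_def lift_def tensor_terms_def)

lemma sum_list_swap:
  fixes f :: "'a \<Rightarrow> 'b \<Rightarrow> 'c::comm_monoid_add"
  shows "(\<Sum>x\<leftarrow>xs. \<Sum>y\<leftarrow>ys. f x y) = (\<Sum>y\<leftarrow>ys. \<Sum>x\<leftarrow>xs. f x y)"
  by (induction xs) (auto simp: sum_list_addf)

lemma sweedler2_swap:
  "sweedler2 C (\<lambda>x y. sweedler2 D (F x y) k) h = sweedler2 D (\<lambda>z w. sweedler2 C (\<lambda>x y. F x y z w) h) k"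
  unfolding sweedler2_eq case_prod_unfold by (rule sum_list_swap)

text \<open>Weaker than a coalgebra, because the Sweedler calculus must already be available on a
  tensor product of coalgebras while its coassociativity and counit laws are being proved.\<close>

locale comultiplication =
  fixes C :: "('k::field, 'v::ab_group_add) coalgebra"
  assumes vspace: "vspace C" and linear_comult: "linear_map C (tensor_space C C) (comult C)"
begin

lemma terms_closed:
  assumes "h \<in> carr C" "(x, y) \<in> set (tensor_terms C C (comult C h))"
  shows "x \<in> carr C" "y \<in> carr C"
  using tensor_terms[OF vspace linear_mapD(1)[OF linear_comult assms(1)]] assms(2) by auto

lemma sweedler2_cong:
  assumes "h \<in> carr C" "\<And>x y. x \<in> carr C \<Longrightarrow> y \<in> carr C \<Longrightarrow> F x y = G x y"
  shows "sweedler2 C F h = sweedler2 C G h"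
  unfolding sweedler2_eq
  by (intro arg_cong[of _ _ sum_list] map_cong) (auto simp: assms(2) terms_closed[OF assms(1)])

lemma sweedler2_closed:
  assumes "h \<in> carr C" "vspace W" "\<And>x y. x \<in> carr C \<Longrightarrow> y \<in> carr C \<Longrightarrow> F x y \<in> carr W"
  shows "sweedler2 C F h \<in> carr W"
  unfolding sweedler2_eq
  by (rule vspace_sum_list[OF assms(2)]) (auto simp: assms(3) terms_closed[OF assms(1)])

lemma linear_map_of_sweedler2:
  assumes "linear_map V W f" "vspace V" "h \<in> carr C" "\<And>x y. x \<in> carr C \<Longrightarrow> y \<in> carr C \<Longrightarrow> F x y \<in> carr V"
  shows "f (sweedler2 C F h) = sweedler2 C (\<lambda>x y. f (F x y)) h"
  unfolding sweedler2_eq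
  by (subst linear_map_sum_list[OF assms(1,2)])
    (auto simp: assms(4) terms_closed[OF assms(3)] case_prod_unfold)

lemma linear_map_sweedler2_param:
  assumes "vspace V" "vspace W" "h \<in> carr C"
    "\<And>x y. x \<in> carr C \<Longrightarrow> y \<in> carr C \<Longrightarrow> linear_map V W (\<lambda>v. F v x y)"
  shows "linear_map V W (\<lambda>v. sweedler2 C (F v) h)"
  unfolding sweedler2_eq case_prod_unfold
  by (rule linear_map_sum_list_param[OF assms(1,2)]) (auto simp: assms(4) terms_closed[OF assms(3)])

lemma linear_map_sweedler2:
  assumes "vspace W" "bilinear_map C C W F"
  shows "linear_map C W (sweedler2 C F)"
  unfolding sweedler2_def
  by (rule linear_map_comp[OF linear_map_lift[OF vspace vspace assms] linear_comult])

text \<open>Naturality of the coproduct. It is the bridge between expressions in the legs of an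
  element and convolution products of maps.\<close>

lemma sweedler2_hom:
  assumes "vspace D" "vspace W" "coalgebra_hom C D f" "bilinear_map D D W F" "h \<in> carr C"
  shows "sweedler2 D F (f h) = sweedler2 C (\<lambda>x y. F (f x) (f y)) h"
proof -
  have f: "linear_map C D f" using assms(3) by (simp add: coalgebra_hom_def)
  have "sweedler2 D F (f h) = lift D D F (sweedler2 C (\<lambda>x y. pure_tensor D D (f x) (f y)) h)"
    using assms(3,5) by (simp add: coalgebra_hom_def sweedler2_def)
  also have "\<dots> = sweedler2 C (\<lambda>x y. lift D D F (pure_tensor D D (f x) (f y))) h"
    by (rule linear_map_of_sweedler2[OF linear_map_lift[OF assms(1,1,2,4)] vspace_tensor_space assms(5)])
      (intro bilinear_mapD(3)[OF bilinear_map_pure_tensor[OF assms(1,1)]] linear_mapD(1)[OF f])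
  also have "\<dots> = sweedler2 C (\<lambda>x y. F (f x) (f y)) h"
    by (intro sweedler2_cong[OF assms(5)] lift_pure_tensor[OF assms(1,1,2,4)] linear_mapD(1)[OF f])
  finally show ?thesis .
qed

lemma sweedler2_commute:
  assumes "cocommutative C" "vspace W" "bilinear_map C C W F" "h \<in> carr C"
  shows "sweedler2 C F h = sweedler2 C (\<lambda>x y. F y x) h"
proof -
  have "sweedler2 C F h = lift C C F (sweedler2 C (\<lambda>x y. pure_tensor C C y x) h)"
    using assms(1,4) by (simp add: cocommutative_def sweedler2_def)
  also have "\<dots> = sweedler2 C (\<lambda>x y. lift C C F (pure_tensor C C y x)) h"
    by (rule linear_map_of_sweedler2[OF linear_map_lift[OF vspace vspace assms(2,3)] vspace_tensor_space assms(4)])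
      (intro bilinear_mapD(3)[OF bilinear_map_pure_tensor[OF vspace vspace]])
  also have "\<dots> = sweedler2 C (\<lambda>x y. F y x) h"
    by (intro sweedler2_cong[OF assms(4)] lift_pure_tensor[OF vspace vspace assms(2,3)])
  finally show ?thesis .
qed

lemma comult_eq_sweedler2:
  assumes "h \<in> carr C"
  shows "comult C h = sweedler2 C (pure_tensor C C) h"
  unfolding sweedler2_eq by (rule tensor_terms(2)[OF vspace linear_mapD(1)[OF linear_comult assms]])

end

sublocale coalgebra \<subseteq> comultiplication
  by unfold_locales (rule vspace linear_comult)+

context coalgebra
begin

text \<open>The axiom \<open>coassoc\<close> equates two elements of the triple tensor product. A
  trilinear \<open>F\<close> factors through a linear map \<open>?L\<close> on that space, and
  applying \<open>?L\<close> to both sides gives the law for \<open>F\<close>.\<close>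

lemma sweedler2_coassoc:
  assumes W: "vspace W" and F: "trilinear_map C C C W F" and h: "h \<in> carr C"
  shows "sweedler2 C (\<lambda>x z. sweedler2 C (\<lambda>x y. F x y z) x) h =
    sweedler2 C (\<lambda>x y. sweedler2 C (\<lambda>y z. F x y z) y) h"
proof -
  let ?T = "tensor_space C C"
  let ?G = "\<lambda>t z. lift C C (\<lambda>x y. F x y z) t"
  let ?L = "lift ?T C ?G"
  note T = vspace_tensor_space[of C C]
  note pT = bilinear_map_pure_tensor[OF T vspace] and p = bilinear_map_pure_tensor[OF vspace vspace]
  note lp = lift_pure_tensor[OF vspace vspace W trilinear_mapD(6)[OF F]]
  note G = bilinear_map_lift[OF vspace vspace vspace W F]
  note lG = linear_map_lift[OF T vspace W G]
  have ct: "comult C x \<in> carr ?T" if "x \<in> carr C" for x by (rule linear_mapD(1)[OF linear_comult that])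
  have "?L (sweedler2 C (\<lambda>x y. pure_tensor ?T C (comult C x) y) h) =
      sweedler2 C (\<lambda>x y. ?L (pure_tensor ?T C (comult C x) y)) h"
    by (rule linear_map_of_sweedler2[OF lG vspace_tensor_space h]) (intro bilinear_mapD(3)[OF pT] ct)
  also have "\<dots> = sweedler2 C (\<lambda>x z. sweedler2 C (\<lambda>x y. F x y z) x) h"
    by (rule sweedler2_cong[OF h]) (simp add: lift_pure_tensor[OF T vspace W G ct] sweedler2_def)
  finally have 1: "?L (sweedler2 C (\<lambda>x y. pure_tensor ?T C (comult C x) y) h) = \<dots>" .
  have "?L (sweedler2 C (\<lambda>x y. sweedler2 C (\<lambda>y1 y2. pure_tensor ?T C (pure_tensor C C x y1) y2) y) h) =
      sweedler2 C (\<lambda>x y. ?L (sweedler2 C (\<lambda>y1 y2. pure_tensor ?T C (pure_tensor C C x y1) y2) y)) h"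
    by (rule linear_map_of_sweedler2[OF lG vspace_tensor_space h])
      (intro sweedler2_closed vspace_tensor_space bilinear_mapD(3)[OF pT] bilinear_mapD(3)[OF p])
  also have "\<dots> = sweedler2 C (\<lambda>x y. sweedler2 C (\<lambda>y z. F x y z) y) h"
  proof (rule sweedler2_cong[OF h])
    fix x y assume x: "x \<in> carr C" and y: "y \<in> carr C"
    have "?L (sweedler2 C (\<lambda>y1 y2. pure_tensor ?T C (pure_tensor C C x y1) y2) y) =
       sweedler2 C (\<lambda>y1 y2. ?L (pure_tensor ?T C (pure_tensor C C x y1) y2)) y"
      by (rule linear_map_of_sweedler2[OF lG vspace_tensor_space y])
        (intro bilinear_mapD(3)[OF pT] bilinear_mapD(3)[OF p] x)
    also have "\<dots> = sweedler2 C (\<lambda>y z. F x y z) y"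
      by (rule sweedler2_cong[OF y])
        (simp add: lift_pure_tensor[OF T vspace W G] bilinear_mapD(3)[OF p] x lp)
    finally show "?L (sweedler2 C (\<lambda>y1 y2. pure_tensor ?T C (pure_tensor C C x y1) y2) y) = \<dots>" .
  qed
  finally show ?thesis using 1 coassoc[OF h] by simp
qed

end

section \<open>Coalgebra homomorphisms\<close>

lemma coalgebra_homD:
  assumes "coalgebra_hom C D f"
  shows "linear_map C D f" "h \<in> carr C \<Longrightarrow> f h \<in> carr D"
    "h \<in> carr C \<Longrightarrow> counit D (f h) = counit C h"
    "h \<in> carr C \<Longrightarrow> comult D (f h) = sweedler2 C (\<lambda>x y. pure_tensor D D (f x) (f y)) h"
  using assms by (auto simp: coalgebra_hom_def linear_map_def)

lemma coalgebra_hom_cong: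
  assumes "coalgebra C" "coalgebra_hom C D f" "\<And>x. x \<in> carr C \<Longrightarrow> g x = f x"
  shows "coalgebra_hom C D g"
proof -
  interpret coalgebra C by fact
  show ?thesis
    unfolding coalgebra_hom_def
  proof (intro conjI ballI)
    show "linear_map C D g"
      by (rule linear_map_cong[OF vspace coalgebra_homD(1)[OF assms(2)] assms(3)])
    fix h assume h: "h \<in> carr C"
    show "comult D (g h) = sweedler2 C (\<lambda>x y. pure_tensor D D (g x) (g y)) h"
      using coalgebra_homD(4)[OF assms(2) h] assms(3)
      by (simp add: h cong: sweedler2_cong[OF h])
    show "counit D (g h) = counit C h"
      using coalgebra_homD(3)[OF assms(2) h] by (simp add: assms(3) h)
  qed
qed

lemma coalgebra_hom_comp:
  assumes C: "coalgebra C" and D: "vspace D" and E: "vspace E"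
    and f: "coalgebra_hom C D f" and g: "coalgebra_hom D E g"
  shows "coalgebra_hom C E (\<lambda>x. g (f x))"
  unfolding coalgebra_hom_def
proof (intro conjI ballI)
  interpret coalgebra C by fact
  show "linear_map C E (\<lambda>x. g (f x))"
    by (rule linear_map_comp) (rule coalgebra_homD[OF f] coalgebra_homD[OF g])+
  fix h assume h: "h \<in> carr C"
  have "bilinear_map D D (tensor_space E E) (\<lambda>x y. pure_tensor E E (g x) (g y))"
    by (rule bilinear_map_comp[OF bilinear_map_pure_tensor[OF E E]]) (rule coalgebra_homD[OF g])+
  from sweedler2_hom[OF D vspace_tensor_space f this h]
  show "comult E (g (f h)) = sweedler2 C (\<lambda>x y. pure_tensor E E (g (f x)) (g (f y))) h"
    by (simp add: coalgebra_homD(4)[OF g] coalgebra_homD(2)[OF f h])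
  show "counit E (g (f h)) = counit C h"
    by (simp add: coalgebra_homD[OF g] coalgebra_homD[OF f] h)
qed

lemma bilinear_map_sweedler2_pair:
  assumes C: "comultiplication C" and D: "comultiplication D" and W: "vspace W"
    and 1: "\<And>z w. z \<in> carr D \<Longrightarrow> w \<in> carr D \<Longrightarrow> bilinear_map C C W (\<lambda>x y. F x y z w)"
    and 2: "\<And>x y. x \<in> carr C \<Longrightarrow> y \<in> carr C \<Longrightarrow> bilinear_map D D W (\<lambda>z w. F x y z w)"
  shows "bilinear_map C D W (\<lambda>c d. sweedler2 C (\<lambda>x y. sweedler2 D (\<lambda>z w. F x y z w) d) c)"
proof -
  interpret C: comultiplication C by fact
  interpret D: comultiplication D by fact
  show ?thesis
    by (intro bilinear_mapI C.linear_map_sweedler2 C.linear_map_sweedler2_param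
        D.linear_map_sweedler2_param D.linear_map_sweedler2 C.vspace D.vspace W 2
        bilinear_mapD(1)[OF 1] bilinear_mapD(2)[OF 1]) assumption
qed

section \<open>Reordering the legs of iterated coproducts\<close>

context coalgebra
begin

text \<open>Two bracketings of the fourfold coproduct:
  \<open>(\<Delta> \<otimes> \<Delta>) \<Delta>\<close> on the left, and on the right the one whose
  middle legs are the coproduct of a single factor. Coassociativity is applied at the top level and
  then inside, with the first leg fixed.\<close>

lemma sweedler2_middle:
  assumes W: "vspace W"
    and F: "\<And>y z w. y \<in> carr C \<Longrightarrow> z \<in> carr C \<Longrightarrow> w \<in> carr C \<Longrightarrow> linear_map C W (\<lambda>x. F x y z w)"
      "\<And>x z w. x \<in> carr C \<Longrightarrow> z \<in> carr C \<Longrightarrow> w \<in> carr C \<Longrightarrow> linear_map C W (\<lambda>y. F x y z w)"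
      "\<And>x y w. x \<in> carr C \<Longrightarrow> y \<in> carr C \<Longrightarrow> w \<in> carr C \<Longrightarrow> linear_map C W (\<lambda>z. F x y z w)"
      "\<And>x y z. x \<in> carr C \<Longrightarrow> y \<in> carr C \<Longrightarrow> z \<in> carr C \<Longrightarrow> linear_map C W (\<lambda>w. F x y z w)"
    and h: "h \<in> carr C"
  shows "sweedler2 C (\<lambda>a b. sweedler2 C (\<lambda>x y. sweedler2 C (\<lambda>z w. F x y z w) b) a) h =
    sweedler2 C (\<lambda>x r. sweedler2 C (\<lambda>s w. sweedler2 C (\<lambda>y z. F x y z w) s) r) h"
proof -
  have 1: "trilinear_map C C C W (\<lambda>x y. sweedler2 C (\<lambda>z w. F x y z w))"
    by (intro trilinear_mapI linear_map_sweedler2_param linear_map_sweedler2 bilinear_mapI vspace W F)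
  have 2: "trilinear_map C C C W (F x)" if "x \<in> carr C" for x
    by (intro trilinear_mapI F that)
  show ?thesis
    by (simp add: sweedler2_coassoc[OF W 1 h] sweedler2_coassoc[OF W 2] cong: sweedler2_cong[OF h])
qed

text \<open>Both sides regroup \<open>h\<^sub>(\<^sub>2\<^sub>) \<otimes> h\<^sub>(\<^sub>3\<^sub>)\<close> as the coproduct of one factor, where cocommutativity applies.\<close>

lemma sweedler2_middle_swap:
  assumes cc: "cocommutative C" and W: "vspace W"
    and F: "\<And>y z w. y \<in> carr C \<Longrightarrow> z \<in> carr C \<Longrightarrow> w \<in> carr C \<Longrightarrow> linear_map C W (\<lambda>x. F x y z w)"
      "\<And>x z w. x \<in> carr C \<Longrightarrow> z \<in> carr C \<Longrightarrow> w \<in> carr C \<Longrightarrow> linear_map C W (\<lambda>y. F x y z w)"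
      "\<And>x y w. x \<in> carr C \<Longrightarrow> y \<in> carr C \<Longrightarrow> w \<in> carr C \<Longrightarrow> linear_map C W (\<lambda>z. F x y z w)"
      "\<And>x y z. x \<in> carr C \<Longrightarrow> y \<in> carr C \<Longrightarrow> z \<in> carr C \<Longrightarrow> linear_map C W (\<lambda>w. F x y z w)"
    and h: "h \<in> carr C"
  shows "sweedler2 C (\<lambda>a b. sweedler2 C (\<lambda>x y. sweedler2 C (\<lambda>z w. F x y z w) b) a) h =
    sweedler2 C (\<lambda>a b. sweedler2 C (\<lambda>x y. sweedler2 C (\<lambda>z w. F x z y w) b) a) h"
proof -
  have eq: "sweedler2 C (\<lambda>y z. F x y z w) s = sweedler2 C (\<lambda>y z. F x z y w) s"
    if "x \<in> carr C" "w \<in> carr C" "s \<in> carr C" for x w s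
    by (rule sweedler2_commute[OF cc W _ that(3)]) (intro bilinear_mapI F that)
  show ?thesis
    by (rule trans[OF sweedler2_middle[OF W F h] trans[OF _
          sweedler2_middle[where F="\<lambda>x y z w. F x z y w", OF W F(1,3,2,4) h, symmetric]]],
        assumption+, rule sweedler2_cong[OF h], rule sweedler2_cong, assumption, rule eq)
qed

text \<open>By coassociativity the second and third legs are the coproduct of one factor, so
  cocommutativity exchanges them; coassociativity then restores the bracketing.\<close>

lemma sweedler2_cyclic:
  assumes cc: "cocommutative C" and W: "vspace W" and F: "trilinear_map C C C W F" and h: "h \<in> carr C"
  shows "sweedler2 C (\<lambda>x z. sweedler2 C (\<lambda>x y. F x y z) x) h =
    sweedler2 C (\<lambda>x z. sweedler2 C (\<lambda>x y. F x z y) x) h"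
proof -
  have F': "trilinear_map C C C W (\<lambda>x y z. F x z y)"
    by (intro trilinear_mapI trilinear_mapD[OF F])
  have "sweedler2 C (F x) y = sweedler2 C (\<lambda>z w. F x w z) y" if "x \<in> carr C" "y \<in> carr C" for x y
    by (rule sweedler2_commute[OF cc W trilinear_mapD(4)[OF F that(1)] that(2)])
  then show ?thesis
    unfolding sweedler2_coassoc[OF W F h] sweedler2_coassoc[OF W F' h]
    by (intro sweedler2_cong[OF h])
qed

end

text \<open>The coassociativity axiom is the case where \<open>F\<close> forms triple pure tensors.
  An assumption cannot quantify over types, so the type of \<open>W\<close> is fixed to the one of
  this case.\<close>

lemma coalgebraI:
  fixes C :: "('k::field, 'v::ab_group_add) coalgebra"
  assumes "comultiplication C" and "linear_map C ground (counit C)"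
    and coassoc: "\<And>h F W. \<lbrakk>vspace (W :: ('k, ('k, ('k, 'v, 'v) tensor, 'v) tensor) vspace);
        trilinear_map C C C W F; h \<in> carr C\<rbrakk> \<Longrightarrow>
      sweedler2 C (\<lambda>x z. sweedler2 C (\<lambda>x y. F x y z) x) h =
      sweedler2 C (\<lambda>x y. sweedler2 C (\<lambda>y z. F x y z) y) h"
    and "\<And>h. h \<in> carr C \<Longrightarrow> sweedler2 C (\<lambda>x y. scal C (counit C x) y) h = h"
    and "\<And>h. h \<in> carr C \<Longrightarrow> sweedler2 C (\<lambda>x y. scal C (counit C y) x) h = h"
  shows "coalgebra C"
proof
  interpret comultiplication C by fact
  show "Defs.vspace C" "linear_map C (tensor_space C C) (comult C)" by (fact vspace linear_comult)+
  fix h assume h: "h \<in> carr C"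
  note p = bilinear_map_pure_tensor[OF vspace vspace]
    and q = bilinear_map_pure_tensor[OF vspace_tensor_space vspace]
  have F: "trilinear_map C C C (tensor_space (tensor_space C C) C)
      (\<lambda>x y z. pure_tensor (tensor_space C C) C (pure_tensor C C x y) z)"
    by (intro trilinear_mapI bilinear_mapD(1)[OF q] linear_map_comp[OF bilinear_mapD(2)[OF q]]
        bilinear_mapD[OF p])
  have "pure_tensor (tensor_space C C) C (comult C x) y =
      sweedler2 C (\<lambda>x1 x2. pure_tensor (tensor_space C C) C (pure_tensor C C x1 x2) y) x"
    if x: "x \<in> carr C" and y: "y \<in> carr C" for x y
    unfolding comult_eq_sweedler2[OF x]
    by (rule linear_map_of_sweedler2[OF bilinear_mapD(2)[OF q y] vspace_tensor_space x bilinear_mapD(3)[OF p]])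
  then show "sweedler2 C (\<lambda>x y. pure_tensor (tensor_space C C) C (comult C x) y) h =
      sweedler2 C (\<lambda>x y.
        sweedler2 C (\<lambda>y1 y2. pure_tensor (tensor_space C C) C (pure_tensor C C x y1) y2) y) h"
    using coassoc[OF vspace_tensor_space F h] by (simp add: h cong: sweedler2_cong)
qed fact+

section \<open>The tensor product of coalgebras\<close>

lemma tensor_coalgebra_simps:
  "scal (tensor_coalgebra C D) = scal (tensor_space C D)"
  "carr (tensor_coalgebra C D) = carr (tensor_space C D)"
  by (simp_all add: tensor_coalgebra_def)

lemma vspace_tensor_coalgebra: "vspace (tensor_coalgebra C D)"
  using vspace_tensor_space[of C D] by (simp add: vspace_def tensor_coalgebra_simps)

lemma vspace_ground: "vspace (ground :: ('k::field, 'k) vspace)"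
proof -
  interpret vector_space "(*) :: 'k \<Rightarrow> 'k \<Rightarrow> 'k" by unfold_locales (auto simp: algebra_simps)
  show ?thesis by (simp add: vspace_def ground_def vector_space_axioms)
qed

locale coalgebra_pair = C: coalgebra C + D: coalgebra D
  for C :: "('k::field, 'v::ab_group_add) coalgebra" and D :: "('k, 'w::ab_group_add) coalgebra"
begin

abbreviation "T \<equiv> tensor_coalgebra C D"

lemma bilinear_pure: "bilinear_map C D T (pure_tensor C D)"
  using bilinear_map_pure_tensor[OF C.vspace D.vspace]
  unfolding bilinear_map_def linear_map_def tensor_coalgebra_simps .

lemmas pure_closed = bilinear_mapD(3)[OF bilinear_pure]

lemma linear_lift:
  assumes "vspace W" "bilinear_map C D W f"
  shows "linear_map T W (lift C D f)"
  using linear_map_lift[OF C.vspace D.vspace assms]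
  unfolding linear_map_def tensor_coalgebra_simps .

lemmas lift_pure = lift_pure_tensor[OF C.vspace D.vspace]

lemma ext:
  assumes "linear_map T U f" "linear_map T U g"
    "\<And>x y. x \<in> carr C \<Longrightarrow> y \<in> carr D \<Longrightarrow> f (pure_tensor C D x y) = g (pure_tensor C D x y)"
    "t \<in> carr T"
  shows "f t = g t"
  by (rule tensor_ext[OF C.vspace D.vspace assms(1,2)[unfolded linear_map_def tensor_coalgebra_simps, folded linear_map_def] assms(3)
      assms(4)[unfolded tensor_coalgebra_simps]])

lemma bilinear_comult:
  assumes W: "vspace W" and F: "bilinear_map T T W F"
  shows "bilinear_map C D W (\<lambda>g h. sweedler2 C (\<lambda>g1 g2. sweedler2 D (\<lambda>h1 h2.
      F (pure_tensor C D g1 h1) (pure_tensor C D g2 h2)) h) g)"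
  by (intro bilinear_map_sweedler2_pair C.comultiplication_axioms D.comultiplication_axioms W
      bilinear_map_comp[OF F] bilinear_mapD[OF bilinear_pure])

lemma comult_T: "comult T = lift C D (\<lambda>g h. sweedler2 C (\<lambda>g1 g2. sweedler2 D (\<lambda>h1 h2.
    pure_tensor T T (pure_tensor C D g1 h1) (pure_tensor C D g2 h2)) h) g)"
proof -
  have "pure_tensor T T = pure_tensor (tensor_space C D) (tensor_space C D)"
    by (intro pure_tensor_cong tensor_coalgebra_simps)
  then show ?thesis by (simp only:) (simp add: tensor_coalgebra_def)
qed

lemma bilinear_pure_T: "bilinear_map T T (tensor_space T T) (pure_tensor T T)"
  by (intro bilinear_map_pure_tensor vspace_tensor_coalgebra)

sublocale T: comultiplication T
  unfolding comultiplication_def comult_T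
  by (intro conjI vspace_tensor_coalgebra linear_lift vspace_tensor_space bilinear_comult bilinear_pure_T)

text \<open>Together with \<open>ext\<close>, which reduces identities of linear maps on
  \<open>T\<close> to pure tensors, this turns Sweedler computations in \<open>T\<close> into
  computations in \<open>C\<close> and \<open>D\<close>.\<close>

lemma sweedler2_pure:
  assumes W: "vspace W" and F: "bilinear_map T T W F" and c: "c \<in> carr C" and d: "d \<in> carr D"
  shows "sweedler2 T F (pure_tensor C D c d) = sweedler2 C (\<lambda>x y. sweedler2 D (\<lambda>z w.
      F (pure_tensor C D x z) (pure_tensor C D y w)) d) c"
proof -
  note L = linear_map_lift[OF T.vspace T.vspace W F]
  have "sweedler2 T F (pure_tensor C D c d) = lift T T F (sweedler2 C (\<lambda>g1 g2. sweedler2 D (\<lambda>h1 h2.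
    pure_tensor T T (pure_tensor C D g1 h1) (pure_tensor C D g2 h2)) d) c)"
    unfolding sweedler2_def[of T] comult_T
    by (subst lift_pure[OF vspace_tensor_space bilinear_comult[OF vspace_tensor_space bilinear_pure_T] c d]) (rule refl)
  also have "\<dots> = sweedler2 C (\<lambda>g1 g2. lift T T F (sweedler2 D (\<lambda>h1 h2.
    pure_tensor T T (pure_tensor C D g1 h1) (pure_tensor C D g2 h2)) d)) c"
    by (rule C.linear_map_of_sweedler2[OF L vspace_tensor_space c])
      (intro D.sweedler2_closed vspace_tensor_space d bilinear_mapD(3)[OF bilinear_pure_T] pure_closed)
  also have "\<dots> = sweedler2 C (\<lambda>x y. sweedler2 D (\<lambda>z w.
      F (pure_tensor C D x z) (pure_tensor C D y w)) d) c"
  proof (rule C.sweedler2_cong[OF c])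
    fix x y assume x: "x \<in> carr C" and y: "y \<in> carr C"
    have "lift T T F (sweedler2 D (\<lambda>h1 h2. pure_tensor T T (pure_tensor C D x h1) (pure_tensor C D y h2)) d) =
      sweedler2 D (\<lambda>h1 h2. lift T T F (pure_tensor T T (pure_tensor C D x h1) (pure_tensor C D y h2))) d"
      by (rule D.linear_map_of_sweedler2[OF L vspace_tensor_space d])
        (intro bilinear_mapD(3)[OF bilinear_pure_T] pure_closed x y)
    also have "\<dots> = sweedler2 D (\<lambda>z w. F (pure_tensor C D x z) (pure_tensor C D y w)) d"
      by (intro D.sweedler2_cong[OF d] lift_pure_tensor[OF T.vspace T.vspace W F] pure_closed x y)
    finally show "lift T T F (sweedler2 D (\<lambda>h1 h2. pure_tensor T T (pure_tensor C D x h1) (pure_tensor C D y h2)) d) = \<dots>" .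
  qed
  finally show ?thesis .
qed

lemma bilinear_counit: "bilinear_map C D ground (\<lambda>g h. counit C g * counit D h)"
  using C.linear_counit D.linear_counit
  by (auto simp: bilinear_map_def linear_map_def ground_def algebra_simps)

lemma counit_T: "counit T = lift C D (\<lambda>g h. counit C g * counit D h)"
  by (simp add: tensor_coalgebra_def)

lemma linear_counit_T: "linear_map T ground (counit T)"
  unfolding counit_T by (rule linear_lift[OF vspace_ground bilinear_counit])

lemma counit_pure:
  "c \<in> carr C \<Longrightarrow> d \<in> carr D \<Longrightarrow> counit T (pure_tensor C D c d) = counit C c * counit D d"
  unfolding counit_T by (rule lift_pure[OF vspace_ground bilinear_counit])

lemma scal_pure:
  assumes "c \<in> carr C" "d \<in> carr D"
  shows "scal T a (pure_tensor C D c d) = pure_tensor C D (scal C a c) d"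
    "scal T a (pure_tensor C D c d) = pure_tensor C D c (scal D a d)"
  by (simp_all add: linear_mapD(3)[OF bilinear_mapD(2)[OF bilinear_pure assms(2)] assms(1)]
    linear_mapD(3)[OF bilinear_mapD(1)[OF bilinear_pure assms(1)] assms(2)])

lemma linear_sweedler2_nested:
  assumes W: "vspace W" and F: "trilinear_map T T T W F"
  shows "linear_map T W (sweedler2 T (\<lambda>x z. sweedler2 T (\<lambda>x y. F x y z) x))"
    "linear_map T W (sweedler2 T (\<lambda>x y. sweedler2 T (\<lambda>y z. F x y z) y))"
  by (intro T.linear_map_sweedler2 bilinear_mapI T.linear_map_sweedler2_param W T.vspace
      trilinear_mapD[OF F]; assumption)+

text \<open>On a pure tensor the legs in \<open>C\<close> and in \<open>D\<close> separate.
  Interchanging finite sums brings both sums over \<open>D\<close> inside, where coassociativity of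
  \<open>D\<close> applies; then that of \<open>C\<close> is used and the sums are interchanged
  back.\<close>

lemma sweedler2_coassoc_T:
  assumes W: "vspace W" and F: "trilinear_map T T T W F" and h: "h \<in> carr T"
  shows "sweedler2 T (\<lambda>x z. sweedler2 T (\<lambda>x y. F x y z) x) h =
    sweedler2 T (\<lambda>x y. sweedler2 T (\<lambda>y z. F x y z) y) h"
proof (rule ext[OF linear_sweedler2_nested[OF W F] _ h])
  fix c d assume c: "c \<in> carr C" and d: "d \<in> carr D"
  let ?p = "pure_tensor C D"
  note p = bilinear_mapD[OF bilinear_pure]
  have B1: "bilinear_map T T W (\<lambda>x z. sweedler2 T (\<lambda>x y. F x y z) x)"
    by (intro bilinear_mapI T.linear_map_sweedler2_param T.linear_map_sweedler2 W T.vspace trilinear_mapD[OF F])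
  have B2: "bilinear_map T T W (\<lambda>x y. sweedler2 T (\<lambda>y z. F x y z) y)"
    by (intro bilinear_mapI T.linear_map_sweedler2_param T.linear_map_sweedler2 W T.vspace trilinear_mapD[OF F])
  note F1 = linear_map_comp[OF trilinear_mapD(1)[OF F]] linear_map_comp[OF trilinear_mapD(2)[OF F]]
    linear_map_comp[OF trilinear_mapD(3)[OF F]]
  have TD: "trilinear_map D D D W (\<lambda>u v w. F (?p x u) (?p y v) (?p z w))"
    if "x \<in> carr C" "y \<in> carr C" "z \<in> carr C" for x y z
    by (intro trilinear_mapI F1 p that)
  have TC: "trilinear_map C C C W (\<lambda>x y z. sweedler2 D (\<lambda>u e. sweedler2 D (\<lambda>v w. F (?p x u) (?p y v) (?p z w)) e) d)"
    by (intro trilinear_mapI D.linear_map_sweedler2_param F1 p W C.vspace d)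
  have "sweedler2 T (\<lambda>x z. sweedler2 T (\<lambda>x y. F x y z) x) (?p c d) =
     sweedler2 C (\<lambda>a z. sweedler2 D (\<lambda>b w. sweedler2 C (\<lambda>x y. sweedler2 D (\<lambda>u v.
       F (?p x u) (?p y v) (?p z w)) b) a) d) c"
    by (simp add: sweedler2_pure[OF W B1 c d] sweedler2_pure[OF W trilinear_mapD(6)[OF F]] p c d
        C.comultiplication_axioms D.comultiplication_axioms cong: comultiplication.sweedler2_cong)
  also have "\<dots> = sweedler2 C (\<lambda>a z. sweedler2 C (\<lambda>x y. sweedler2 D (\<lambda>b w. sweedler2 D (\<lambda>u v.
       F (?p x u) (?p y v) (?p z w)) b) d) a) c"
    by (subst sweedler2_swap) (rule refl)
  also have "\<dots> = sweedler2 C (\<lambda>a z. sweedler2 C (\<lambda>x y. sweedler2 D (\<lambda>u e. sweedler2 D (\<lambda>v w.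
       F (?p x u) (?p y v) (?p z w)) e) d) a) c"
    by (simp add: D.sweedler2_coassoc[OF W TD] c d C.comultiplication_axioms cong: comultiplication.sweedler2_cong)
  also have "\<dots> = sweedler2 C (\<lambda>x a. sweedler2 C (\<lambda>y z. sweedler2 D (\<lambda>u e. sweedler2 D (\<lambda>v w.
       F (?p x u) (?p y v) (?p z w)) e) d) a) c"
    by (rule C.sweedler2_coassoc[OF W TC c])
  also have "\<dots> = sweedler2 C (\<lambda>x a. sweedler2 D (\<lambda>u e. sweedler2 C (\<lambda>y z. sweedler2 D (\<lambda>v w.
       F (?p x u) (?p y v) (?p z w)) e) a) d) c"
    by (subst sweedler2_swap) (rule refl)
  also have "\<dots> = sweedler2 T (\<lambda>x y. sweedler2 T (\<lambda>y z. F x y z) y) (?p c d)"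
    by (simp add: sweedler2_pure[OF W B2 c d] sweedler2_pure[OF W trilinear_mapD(4)[OF F]] p c d
        C.comultiplication_axioms D.comultiplication_axioms cong: comultiplication.sweedler2_cong)
  finally show "sweedler2 T (\<lambda>x z. sweedler2 T (\<lambda>x y. F x y z) x) (?p c d) = \<dots>" .
qed

end

lemma sweedler2_separate:
  assumes "comultiplication C" "comultiplication D" "vspace U" "vspace V" "vspace W"
    and K: "bilinear_map U V W K" and c: "c \<in> carr C" and d: "d \<in> carr D"
    and f: "\<And>x y. x \<in> carr C \<Longrightarrow> y \<in> carr C \<Longrightarrow> f x y \<in> carr U"
    and g: "\<And>x y. x \<in> carr D \<Longrightarrow> y \<in> carr D \<Longrightarrow> g x y \<in> carr V"
  shows "sweedler2 C (\<lambda>x y. sweedler2 D (\<lambda>z w. K (f x y) (g z w)) d) c = K (sweedler2 C f c) (sweedler2 D g d)"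
proof -
  interpret C: comultiplication C by fact
  interpret D: comultiplication D by fact
  have "sweedler2 C (\<lambda>x y. sweedler2 D (\<lambda>z w. K (f x y) (g z w)) d) c = sweedler2 C (\<lambda>x y. K (f x y) (sweedler2 D g d)) c"
    by (rule C.sweedler2_cong[OF c], rule D.linear_map_of_sweedler2[OF bilinear_mapD(1)[OF K f] assms(4) d g, symmetric])
  also have "\<dots> = K (sweedler2 C f c) (sweedler2 D g d)"
    by (rule C.linear_map_of_sweedler2[OF bilinear_mapD(2)[OF K] assms(3) c f, symmetric])
      (rule D.sweedler2_closed[OF d assms(4) g])
  finally show ?thesis .
qed

context coalgebra_pair
begin

lemma scal_mult_pure:
  assumes "c \<in> carr C" "d \<in> carr D"
  shows "scal T (a * b) (pure_tensor C D c d) = pure_tensor C D (scal C a c) (scal D b d)"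
  unfolding vspaceD(4)[OF T.vspace] scal_pure(2)[OF assms, of b]
  by (rule scal_pure(1)[OF assms(1) vspaceD(3)[OF D.vspace assms(2)]])

text \<open>The counit of a pure tensor is a product of two scalars, which distribute over the
  tensor factors; so each counit law splits into those of \<open>C\<close> and
  \<open>D\<close>.\<close>

lemma coalgebra_T: "coalgebra T"
proof (rule coalgebraI[OF T.comultiplication_axioms linear_counit_T sweedler2_coassoc_T])
  fix h assume h: "h \<in> carr T"
  let ?p = "pure_tensor C D"
  have L: "bilinear_map T T T (\<lambda>x y. scal T (counit T x) y)"
    by (intro bilinear_mapI linear_map_scale linear_map_id linear_map_scale_left linear_counit_T T.vspace)
  note R = bilinear_map_flip[OF L]
  show "sweedler2 T (\<lambda>x y. scal T (counit T x) y) h = h"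
  proof (rule ext[OF T.linear_map_sweedler2[OF T.vspace L] linear_map_id _ h])
    fix c d assume cd: "c \<in> carr C" "d \<in> carr D"
    have "scal T (counit T (?p x z)) (?p y w) = ?p (scal C (counit C x) y) (scal D (counit D z) w)"
      if "x \<in> carr C" "y \<in> carr C" "z \<in> carr D" "w \<in> carr D" for x y z w
      using that by (simp add: counit_pure scal_mult_pure)
    then have "sweedler2 T (\<lambda>x y. scal T (counit T x) y) (?p c d) =
      sweedler2 C (\<lambda>x y. sweedler2 D (\<lambda>z w. ?p (scal C (counit C x) y) (scal D (counit D z) w)) d) c"
      by (simp add: sweedler2_pure[OF T.vspace L] cd C.comultiplication_axioms D.comultiplication_axioms
          cong: comultiplication.sweedler2_cong)
    also have "\<dots> = ?p c d"
      by (subst sweedler2_separate[OF C.comultiplication_axioms D.comultiplication_axioms C.vspace D.vspace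
          T.vspace bilinear_pure cd])
        (simp_all add: C.counit_left D.counit_left cd vspaceD[OF C.vspace] vspaceD[OF D.vspace])
    finally show "sweedler2 T (\<lambda>x y. scal T (counit T x) y) (?p c d) = ?p c d" .
  qed
  show "sweedler2 T (\<lambda>x y. scal T (counit T y) x) h = h"
  proof (rule ext[OF T.linear_map_sweedler2[OF T.vspace R] linear_map_id _ h])
    fix c d assume cd: "c \<in> carr C" "d \<in> carr D"
    have "scal T (counit T (?p y w)) (?p x z) = ?p (scal C (counit C y) x) (scal D (counit D w) z)"
      if "x \<in> carr C" "y \<in> carr C" "z \<in> carr D" "w \<in> carr D" for x y z w
      using that by (simp add: counit_pure scal_mult_pure)
    then have "sweedler2 T (\<lambda>x y. scal T (counit T y) x) (?p c d) =
      sweedler2 C (\<lambda>x y. sweedler2 D (\<lambda>z w. ?p (scal C (counit C y) x) (scal D (counit D w) z)) d) c"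
      by (simp add: sweedler2_pure[OF T.vspace R] cd C.comultiplication_axioms D.comultiplication_axioms
          cong: comultiplication.sweedler2_cong)
    also have "\<dots> = ?p c d"
      by (subst sweedler2_separate[OF C.comultiplication_axioms D.comultiplication_axioms C.vspace D.vspace
          T.vspace bilinear_pure cd])
        (simp_all add: C.counit_right D.counit_right cd vspaceD[OF C.vspace] vspaceD[OF D.vspace])
    finally show "sweedler2 T (\<lambda>x y. scal T (counit T y) x) (?p c d) = ?p c d" .
  qed
qed

lemma cocommutative_T:
  assumes cC: "cocommutative C" and cD: "cocommutative D"
  shows "cocommutative T"
  unfolding cocommutative_def
proof
  fix h assume h: "h \<in> carr T"
  let ?p = "pure_tensor C D" and ?q = "pure_tensor T T"
  note q = bilinear_pure_T
  note b = bilinear_mapD[OF bilinear_pure]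
  have "sweedler2 T (\<lambda>x y. ?q y x) h = sweedler2 T ?q h"
  proof (rule ext[OF T.linear_map_sweedler2[OF vspace_tensor_space bilinear_map_flip[OF q]]
      T.linear_map_sweedler2[OF vspace_tensor_space q] _ h])
    fix c d assume cd: "c \<in> carr C" "d \<in> carr D"
    have "sweedler2 T ?q (?p c d) =
        sweedler2 C (\<lambda>x y. sweedler2 D (\<lambda>z w. ?q (?p x z) (?p y w)) d) c"
      by (rule sweedler2_pure[OF vspace_tensor_space q cd])
    \<comment> \<open>The legs of \<open>d\<close> are exchanged first, with those of
      \<open>c\<close> fixed; the next equation exchanges the legs of \<open>c\<close>.\<close>
    also have "\<dots> = sweedler2 C (\<lambda>x y. sweedler2 D (\<lambda>z w. ?q (?p x w) (?p y z)) d) c"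
      by (rule C.sweedler2_cong[OF cd(1)], rule D.sweedler2_commute[OF cD vspace_tensor_space bilinear_map_comp[OF q] cd(2)])
        (rule b, assumption)+
    also have "\<dots> = sweedler2 C (\<lambda>x y. sweedler2 D (\<lambda>z w. ?q (?p y w) (?p x z)) d) c"
      by (rule C.sweedler2_commute[OF cC vspace_tensor_space[of T T] _ cd(1)])
       (intro bilinear_mapI D.linear_map_sweedler2_param C.vspace vspace_tensor_space cd
         linear_map_comp[OF bilinear_mapD(1)[OF q]] linear_map_comp[OF bilinear_mapD(2)[OF q]] b)
    also have "\<dots> = sweedler2 T (\<lambda>x y. ?q y x) (?p c d)"
      by (rule sweedler2_pure[OF vspace_tensor_space bilinear_map_flip[OF q] cd, symmetric])
    finally show "sweedler2 T (\<lambda>x y. ?q y x) (?p c d) = sweedler2 T ?q (?p c d)" by simp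
  qed
  then show "sweedler2 T (\<lambda>x y. ?q y x) h = comult T h"
    by (simp add: T.comult_eq_sweedler2 h)
qed

section \<open>The projections of a tensor product of coalgebras\<close>

definition proj1 where "proj1 = lift C D (\<lambda>c d. scal C (counit D d) c)"
definition proj2 where "proj2 = lift C D (\<lambda>c d. scal D (counit C c) d)"

lemma bilinear_proj1: "bilinear_map C D C (\<lambda>c d. scal C (counit D d) c)"
  by (intro bilinear_mapI linear_map_scale linear_map_id linear_map_scale_left D.linear_counit C.vspace)

lemma bilinear_proj2: "bilinear_map C D D (\<lambda>c d. scal D (counit C c) d)"
  by (intro bilinear_mapI linear_map_scale linear_map_id linear_map_scale_left C.linear_counit D.vspace)

lemma linear_proj1: "linear_map T C proj1" and linear_proj2: "linear_map T D proj2"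
  unfolding proj1_def proj2_def by (intro linear_lift C.vspace D.vspace bilinear_proj1 bilinear_proj2)+

lemma proj1_pure: "c \<in> carr C \<Longrightarrow> d \<in> carr D \<Longrightarrow> proj1 (pure_tensor C D c d) = scal C (counit D d) c"
  unfolding proj1_def by (rule lift_pure[OF C.vspace bilinear_proj1])

lemma proj2_pure: "c \<in> carr C \<Longrightarrow> d \<in> carr D \<Longrightarrow> proj2 (pure_tensor C D c d) = scal D (counit C c) d"
  unfolding proj2_def by (rule lift_pure[OF D.vspace bilinear_proj2])

text \<open>The conditions on a coalgebra map out of \<open>T\<close> compare linear maps on
  \<open>T\<close>, so pure tensors suffice.\<close>

lemma coalgebra_hom_TI:
  assumes E: "comultiplication E" "linear_map E ground (counit E)" and f: "linear_map T E f"
    and "\<And>c d. c \<in> carr C \<Longrightarrow> d \<in> carr D \<Longrightarrow> comult E (f (pure_tensor C D c d)) =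
      sweedler2 C (\<lambda>x y. sweedler2 D (\<lambda>z w.
        pure_tensor E E (f (pure_tensor C D x z)) (f (pure_tensor C D y w))) d) c"
    and "\<And>c d. c \<in> carr C \<Longrightarrow> d \<in> carr D \<Longrightarrow>
      counit E (f (pure_tensor C D c d)) = counit C c * counit D d"
  shows "coalgebra_hom T E f"
proof -
  interpret E: comultiplication E by fact
  have F: "bilinear_map T T (tensor_space E E) (\<lambda>x y. pure_tensor E E (f x) (f y))"
    by (rule bilinear_map_comp[OF bilinear_map_pure_tensor[OF E.vspace E.vspace] f f])
  show ?thesis
    unfolding coalgebra_hom_def
  proof (intro conjI ballI f)
    fix h assume h: "h \<in> carr T"
    show "comult E (f h) = sweedler2 T (\<lambda>x y. pure_tensor E E (f x) (f y)) h"
      by (rule ext[OF linear_map_comp[OF E.linear_comult f]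
        T.linear_map_sweedler2[OF vspace_tensor_space F] _ h])
        (simp add: assms(4) sweedler2_pure[OF vspace_tensor_space F])
    show "counit E (f h) = counit T h"
      by (rule ext[OF linear_map_comp[OF E(2) f] linear_counit_T _ h])
        (simp add: assms(5) counit_pure)
  qed
qed

lemma counit_scal: "c \<in> carr C \<Longrightarrow> counit C (scal C a c) = a * counit C c"
  "d \<in> carr D \<Longrightarrow> counit D (scal D a d) = a * counit D d"
  using linear_mapD(3)[OF C.linear_counit] linear_mapD(3)[OF D.linear_counit] by (simp_all add: ground_def)

lemma coalgebra_hom_proj1: "coalgebra_hom T C proj1"
proof (rule coalgebra_hom_TI[OF C.comultiplication_axioms C.linear_counit linear_proj1])
  fix c d assume cd: "c \<in> carr C" "d \<in> carr D"
  let ?q = "pure_tensor C C"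
  note q = bilinear_map_pure_tensor[OF C.vspace C.vspace]
  \<comment> \<open>The scalars \<open>\<epsilon>(z)\<close> and \<open>\<epsilon>(w)\<close> are
    combined into the counit of \<open>\<epsilon>(z) w\<close>, so that the sum over the legs of
    \<open>d\<close> collapses by the counit law of \<open>D\<close>.\<close>
  have 1: "?q (proj1 (pure_tensor C D x z)) (proj1 (pure_tensor C D y w)) =
      scal (tensor_space C C) (counit D (scal D (counit D z) w)) (?q x y)"
    if "x \<in> carr C" "y \<in> carr C" "z \<in> carr D" "w \<in> carr D" for x y z w
    using that by (simp add: proj1_pure counit_scal vspaceD(3)[OF C.vspace] vspaceD(4)[OF vspace_tensor_space]
        vspace_scale_commute[OF vspace_tensor_space]
        linear_mapD(3)[OF bilinear_mapD(1)[OF q]] linear_mapD(3)[OF bilinear_mapD(2)[OF q]])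
  have "sweedler2 C (\<lambda>x y. sweedler2 D (\<lambda>z w.
        ?q (proj1 (pure_tensor C D x z)) (proj1 (pure_tensor C D y w))) d) c =
     sweedler2 C (\<lambda>x y. sweedler2 D (\<lambda>z w.
        scal (tensor_space C C) (counit D (scal D (counit D z) w)) (?q x y)) d) c"
    by (simp add: 1 cd C.comultiplication_axioms D.comultiplication_axioms cong: comultiplication.sweedler2_cong)
  also have "\<dots> = scal (tensor_space C C) (counit D (sweedler2 D (\<lambda>z w. scal D (counit D z) w) d)) (sweedler2 C ?q c)"
    by (rule sweedler2_separate[OF C.comultiplication_axioms D.comultiplication_axioms vspace_tensor_space[of C C] D.vspace
          vspace_tensor_space[of C C] _ cd, where K="\<lambda>u v. scal (tensor_space C C) (counit D v) u"])
      (intro bilinear_mapI linear_map_scale linear_map_id linear_map_scale_left D.linear_counit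
        vspace_tensor_space bilinear_mapD(3)[OF q] vspaceD(3)[OF D.vspace]; assumption)+
  also have "\<dots> = comult C (proj1 (pure_tensor C D c d))"
    by (simp add: proj1_pure cd D.counit_left linear_mapD(3)[OF C.linear_comult] C.comult_eq_sweedler2)
  finally show "comult C (proj1 (pure_tensor C D c d)) = sweedler2 C (\<lambda>x y. sweedler2 D (\<lambda>z w.
        ?q (proj1 (pure_tensor C D x z)) (proj1 (pure_tensor C D y w))) d) c" ..
qed (simp add: proj1_pure counit_scal)

lemma coalgebra_hom_proj2: "coalgebra_hom T D proj2"
proof (rule coalgebra_hom_TI[OF D.comultiplication_axioms D.linear_counit linear_proj2])
  fix c d assume cd: "c \<in> carr C" "d \<in> carr D"
  let ?q = "pure_tensor D D"
  note q = bilinear_map_pure_tensor[OF D.vspace D.vspace]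
  have 1: "?q (proj2 (pure_tensor C D x z)) (proj2 (pure_tensor C D y w)) =
      scal (tensor_space D D) (counit C (scal C (counit C x) y)) (?q z w)"
    if "x \<in> carr C" "y \<in> carr C" "z \<in> carr D" "w \<in> carr D" for x y z w
    using that by (simp add: proj2_pure counit_scal vspaceD(3)[OF D.vspace] mult.commute
        linear_mapD(3)[OF bilinear_mapD(1)[OF q]] linear_mapD(3)[OF bilinear_mapD(2)[OF q]]
        flip: vspaceD(4)[OF vspace_tensor_space])
  have "sweedler2 C (\<lambda>x y. sweedler2 D (\<lambda>z w.
        ?q (proj2 (pure_tensor C D x z)) (proj2 (pure_tensor C D y w))) d) c =
     sweedler2 C (\<lambda>x y. sweedler2 D (\<lambda>z w.
        scal (tensor_space D D) (counit C (scal C (counit C x) y)) (?q z w)) d) c"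
    by (simp add: 1 cd C.comultiplication_axioms D.comultiplication_axioms cong: comultiplication.sweedler2_cong)
  also have "\<dots> = scal (tensor_space D D) (counit C (sweedler2 C (\<lambda>z w. scal C (counit C z) w) c)) (sweedler2 D ?q d)"
    by (rule sweedler2_separate[OF C.comultiplication_axioms D.comultiplication_axioms C.vspace vspace_tensor_space[of D D]
          vspace_tensor_space[of D D] _ cd, where K="\<lambda>v u. scal (tensor_space D D) (counit C v) u"])
      (intro bilinear_mapI linear_map_scale linear_map_id linear_map_scale_left C.linear_counit
        vspace_tensor_space bilinear_mapD(3)[OF q] vspaceD(3)[OF C.vspace]; assumption)+
  also have "\<dots> = comult D (proj2 (pure_tensor C D c d))"
    by (simp add: proj2_pure cd C.counit_left linear_mapD(3)[OF D.linear_comult] D.comult_eq_sweedler2)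
  finally show "comult D (proj2 (pure_tensor C D c d)) = sweedler2 C (\<lambda>x y. sweedler2 D (\<lambda>z w.
        ?q (proj2 (pure_tensor C D x z)) (proj2 (pure_tensor C D y w))) d) c" ..
qed (simp add: proj2_pure counit_scal)

text \<open>The projections recover the tensor:
  \<open>\<epsilon>(d_1) c_1 \<otimes> \<epsilon>(c_2) d_2\<close> equals
  \<open>c \<otimes> d\<close>. Convolving along them therefore evaluates \<open>F\<close> at
  independent elements.\<close>

lemma sweedler2_proj1_proj2:
  assumes W: "vspace W" and F: "bilinear_map C D W F" and t: "t \<in> carr T"
  shows "sweedler2 T (\<lambda>x y. F (proj1 x) (proj2 y)) t = lift C D F t"
proof -
  have B: "bilinear_map T T W (\<lambda>x y. F (proj1 x) (proj2 y))"
    by (rule bilinear_map_comp[OF F linear_proj1 linear_proj2])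
  show ?thesis
  proof (rule ext[OF T.linear_map_sweedler2[OF W B] linear_lift[OF W F] _ t])
    fix c d assume cd: "c \<in> carr C" "d \<in> carr D"
    \<comment> \<open>Bilinearity moves each scalar to the opposite argument. There it meets the
      other leg of the element from which it comes, and the counit laws apply.\<close>
    have "F (proj1 (pure_tensor C D x z)) (proj2 (pure_tensor C D y w)) = F (scal C (counit C y) x) (scal D (counit D z) w)"
      if "x \<in> carr C" "y \<in> carr C" "z \<in> carr D" "w \<in> carr D" for x y z w
      using that linear_mapD(3)[OF bilinear_mapD(1)[OF F]] linear_mapD(3)[OF bilinear_mapD(2)[OF F]]
      by (simp add: proj1_pure proj2_pure vspaceD(3)[OF C.vspace] vspaceD(3)[OF D.vspace] mult.commute
          flip: vspaceD(4)[OF W])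
    then have "sweedler2 T (\<lambda>x y. F (proj1 x) (proj2 y)) (pure_tensor C D c d) =
      sweedler2 C (\<lambda>x y. sweedler2 D (\<lambda>z w. F (scal C (counit C y) x) (scal D (counit D z) w)) d) c"
      by (simp add: sweedler2_pure[OF W B] cd C.comultiplication_axioms D.comultiplication_axioms
          cong: comultiplication.sweedler2_cong)
    also have "\<dots> = F c d"
      by (subst sweedler2_separate[OF C.comultiplication_axioms D.comultiplication_axioms C.vspace D.vspace
          W F cd])
        (simp_all add: C.counit_right D.counit_left cd vspaceD[OF C.vspace] vspaceD[OF D.vspace])
    also have "\<dots> = lift C D F (pure_tensor C D c d)"
      by (rule lift_pure[OF W F cd, symmetric])
    finally show "sweedler2 T (\<lambda>x y. F (proj1 x) (proj2 y)) (pure_tensor C D c d) = \<dots>" .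
  qed
qed

end

section \<open>Tensor products of three coalgebras\<close>

locale coalgebra_triple = CD: coalgebra_pair C D + TE: coalgebra_pair "tensor_coalgebra C D" E
  for C :: "('k::field, 'v::ab_group_add) coalgebra" and D :: "('k, 'w::ab_group_add) coalgebra"
    and E :: "('k, 'u::ab_group_add) coalgebra"
begin

text \<open>Two applications of \<open>sweedler2_proj1_proj2\<close>. In the inner sum
  \<open>TE.proj1\<close> is a coalgebra map, so the legs of \<open>x\<close> give the legs of
  \<open>TE.proj1 x\<close> in the tensor product of \<open>C\<close> and \<open>D\<close>.\<close>

lemma sweedler2_triple:
  assumes W: "vspace W" and F: "trilinear_map C D E W F"
    and c: "c \<in> carr C" and d: "d \<in> carr D" and e: "e \<in> carr E"
  shows "sweedler2 TE.T (\<lambda>x z. sweedler2 TE.T (\<lambda>x y. F (CD.proj1 (TE.proj1 x)) (CD.proj2 (TE.proj1 y)) (TE.proj2 z)) x)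
      (pure_tensor CD.T E (pure_tensor C D c d) e) = F c d e"
proof -
  let ?t = "pure_tensor CD.T E (pure_tensor C D c d) e"
  let ?G = "\<lambda>u z. lift C D (\<lambda>x y. F x y z) u"
  have G: "bilinear_map CD.T E W ?G"
    using bilinear_map_lift[OF CD.C.vspace CD.D.vspace TE.D.vspace W F]
    unfolding bilinear_map_def linear_map_def tensor_coalgebra_simps .
  have t: "?t \<in> carr TE.T" by (intro TE.pure_closed CD.pure_closed c d e)
  have 1: "sweedler2 TE.T (\<lambda>x y. F (CD.proj1 (TE.proj1 x)) (CD.proj2 (TE.proj1 y)) (TE.proj2 z)) x = ?G (TE.proj1 x) (TE.proj2 z)"
    if x: "x \<in> carr TE.T" and z: "z \<in> carr TE.T" for x z
  proof -
    note proj2 = linear_mapD(1)[OF TE.linear_proj2 z]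
    have "sweedler2 TE.T (\<lambda>x y. F (CD.proj1 (TE.proj1 x)) (CD.proj2 (TE.proj1 y)) (TE.proj2 z)) x =
        sweedler2 CD.T (\<lambda>x y. F (CD.proj1 x) (CD.proj2 y) (TE.proj2 z)) (TE.proj1 x)"
      by (rule TE.T.sweedler2_hom[OF CD.T.vspace W TE.coalgebra_hom_proj1 _ x, symmetric])
        (rule bilinear_map_comp[OF trilinear_mapD(6)[OF F proj2] CD.linear_proj1 CD.linear_proj2])
    also have "\<dots> = ?G (TE.proj1 x) (TE.proj2 z)"
      by (rule CD.sweedler2_proj1_proj2[OF W trilinear_mapD(6)[OF F proj2] linear_mapD(1)[OF TE.linear_proj1 x]])
    finally show ?thesis .
  qed
  have "sweedler2 TE.T (\<lambda>x z. sweedler2 TE.T (\<lambda>x y. F (CD.proj1 (TE.proj1 x)) (CD.proj2 (TE.proj1 y)) (TE.proj2 z)) x) ?t =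
      sweedler2 TE.T (\<lambda>x z. ?G (TE.proj1 x) (TE.proj2 z)) ?t"
    by (rule TE.T.sweedler2_cong[OF t]) (rule 1)
  also have "\<dots> = F c d e"
    by (simp add: TE.sweedler2_proj1_proj2[OF W G t] TE.lift_pure[OF W G] CD.pure_closed c d e
        CD.lift_pure[OF W trilinear_mapD(6)[OF F]])
  finally show ?thesis .
qed

end

section \<open>Rota-Baxter groups\<close>

locale rota_baxter_group = group G for G (structure) +
  fixes B
  assumes B_closed: "a \<in> carrier G \<Longrightarrow> B a \<in> carrier G"
    and rota_baxter: "a \<in> carrier G \<Longrightarrow> b \<in> carrier G \<Longrightarrow>
      B a \<otimes> B b = B (a \<otimes> B a \<otimes> b \<otimes> inv (B a))"
begin

definition circ where "circ a b = a \<otimes> B a \<otimes> b \<otimes> inv (B a)"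

lemma circ_closed: "a \<in> carrier G \<Longrightarrow> b \<in> carrier G \<Longrightarrow> circ a b \<in> carrier G"
  by (simp add: circ_def B_closed)

lemma B_circ: "a \<in> carrier G \<Longrightarrow> b \<in> carrier G \<Longrightarrow> B (circ a b) = B a \<otimes> B b"
  by (simp add: circ_def rota_baxter)

lemma inv_cancel: "a \<in> carrier G \<Longrightarrow> b \<in> carrier G \<Longrightarrow> inv a \<otimes> (a \<otimes> b) = b"
  "a \<in> carrier G \<Longrightarrow> b \<in> carrier G \<Longrightarrow> a \<otimes> (inv a \<otimes> b) = b"
  by (simp_all flip: m_assoc)

text \<open>Since \<open>B\<close> takes \<open>circ\<close> to the product, both sides equal
  \<open>a B(a) b B(b) c B(b)^-1 B(a)^-1\<close>.\<close>

lemma circ_assoc: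
  assumes "a \<in> carrier G" "b \<in> carrier G" "c \<in> carrier G"
  shows "circ (circ a b) c = circ a (circ b c)"
  unfolding circ_def[of "circ a b"] B_circ[OF assms(1,2)]
  using assms by (simp add: circ_def B_closed m_assoc inv_mult_group inv_cancel)

text \<open>\<open>circ \<one> \<one>\<close> is \<one>, so \<open>B \<one>\<close> is an idempotent
  of the group.\<close>

lemma B_one: "B \<one> = \<one>"
  using B_circ[of \<one> \<one>] by (simp add: circ_def B_closed)

lemma circ_one: "a \<in> carrier G \<Longrightarrow> circ \<one> a = a" "a \<in> carrier G \<Longrightarrow> circ a \<one> = a"
  by (simp_all add: circ_def B_one B_closed m_assoc)

text \<open>The right inverse law is plain cancellation. Applying \<open>B\<close> to it yields
  \<open>B t = inv (B a)\<close>, and with this value the left inverse law cancels too.\<close>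

lemma circ_inverse:
  assumes a: "a \<in> carrier G" and t: "t = inv (B a) \<otimes> inv a \<otimes> B a"
  shows "circ a t = \<one>" "circ t a = \<one>"
proof -
  have t': "t \<in> carrier G" using a by (simp add: t B_closed)
  show 1: "circ a t = \<one>" using a by (simp add: circ_def t B_closed m_assoc inv_cancel)
  have "B a \<otimes> B t = \<one>" using B_circ[OF a t'] 1 B_one by simp
  then have "B t = inv (B a)" using a t' B_closed by (metis inv_equality inv_inv inv_closed)
  then show "circ t a = \<one>" using a by (simp add: circ_def t B_closed m_assoc inv_cancel)
qed

end

section \<open>Convolution\<close>

text \<open>The products are graded, which is why the spaces and the four bilinear maps are kept
  apart. The lemma serves both \<open>H\<close> and its tensor square.\<close>

lemma (in coalgebra) convolution_assoc:
  assumes V: "vspace V1" "vspace V2" "vspace V3" "vspace V12" "vspace V23" "vspace W"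
    and m: "bilinear_map V1 V2 V12 m1" "bilinear_map V12 V3 W m2"
      "bilinear_map V2 V3 V23 m3" "bilinear_map V1 V23 W m4"
    and assoc: "\<And>a b c. a \<in> carr V1 \<Longrightarrow> b \<in> carr V2 \<Longrightarrow> c \<in> carr V3 \<Longrightarrow>
      m2 (m1 a b) c = m4 a (m3 b c)"
    and f: "linear_map C V1 u" "linear_map C V2 v" "linear_map C V3 w" and h: "h \<in> carr C"
  shows "sweedler2 C (\<lambda>x z. m2 (sweedler2 C (\<lambda>x y. m1 (u x) (v y)) x) (w z)) h =
    sweedler2 C (\<lambda>x y. m4 (u x) (sweedler2 C (\<lambda>y z. m3 (v y) (w z)) y)) h"
proof -
  note uvw = linear_mapD(1)[OF f(1)] linear_mapD(1)[OF f(2)] linear_mapD(1)[OF f(3)]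
  have F: "trilinear_map C C C W (\<lambda>x y z. m2 (m1 (u x) (v y)) (w z))"
    by (intro trilinear_mapI linear_map_comp[OF bilinear_mapD(1)[OF m(2)]]
        linear_map_comp[OF bilinear_mapD(2)[OF m(2)]] linear_map_comp[OF bilinear_mapD(1)[OF m(1)]]
        linear_map_comp[OF bilinear_mapD(2)[OF m(1)]] f uvw bilinear_mapD(3)[OF m(1)])
  have "sweedler2 C (\<lambda>x z. m2 (sweedler2 C (\<lambda>x y. m1 (u x) (v y)) x) (w z)) h =
    sweedler2 C (\<lambda>x z. sweedler2 C (\<lambda>x y. m2 (m1 (u x) (v y)) (w z)) x) h"
    by (rule sweedler2_cong[OF h], rule linear_map_of_sweedler2[OF bilinear_mapD(2)[OF m(2)] V(4)])
      (assumption | rule uvw bilinear_mapD(3)[OF m(1)])+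
  also have "\<dots> = sweedler2 C (\<lambda>x y. sweedler2 C (\<lambda>y z. m2 (m1 (u x) (v y)) (w z)) y) h"
    by (rule sweedler2_coassoc[OF V(6) F h])
  also have "\<dots> = sweedler2 C (\<lambda>x y. sweedler2 C (\<lambda>y z. m4 (u x) (m3 (v y) (w z))) y) h"
    by (rule sweedler2_cong[OF h], rule sweedler2_cong, assumption, rule assoc) (assumption | rule uvw)+
  also have "\<dots> = sweedler2 C (\<lambda>x y. m4 (u x) (sweedler2 C (\<lambda>y z. m3 (v y) (w z)) y)) h"
    by (rule sweedler2_cong[OF h], rule linear_map_of_sweedler2[OF bilinear_mapD(1)[OF m(4)] V(5), symmetric])
      (assumption | rule uvw bilinear_mapD(3)[OF m(3)])+
  finally show ?thesis .
qed

context coalgebra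
begin

lemma counit_scale: "h \<in> carr C \<Longrightarrow> counit C (scal C a h) = a * counit C h"
  using linear_mapD(3)[OF linear_counit] by (simp add: ground_def)

lemma sweedler2_counit:
  assumes "linear_map C W f" "h \<in> carr C"
  shows "sweedler2 C (\<lambda>x y. scal W (counit C x) (f y)) h = f h"
    "sweedler2 C (\<lambda>x y. scal W (counit C y) (f x)) h = f h"
proof -
  have "sweedler2 C (\<lambda>x y. f (scal C (counit C x) y)) h = f h"
    using linear_map_of_sweedler2[OF assms(1) vspace assms(2), of "\<lambda>x y. scal C (counit C x) y"]
    by (simp add: counit_left assms(2) vspaceD(3)[OF vspace])
  then show "sweedler2 C (\<lambda>x y. scal W (counit C x) (f y)) h = f h"
    by (simp add: linear_mapD(3)[OF assms(1)] assms(2) cong: sweedler2_cong)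
  have "sweedler2 C (\<lambda>x y. f (scal C (counit C y) x)) h = f h"
    using linear_map_of_sweedler2[OF assms(1) vspace assms(2), of "\<lambda>x y. scal C (counit C y) x"]
    by (simp add: counit_right assms(2) vspaceD(3)[OF vspace])
  then show "sweedler2 C (\<lambda>x y. scal W (counit C y) (f x)) h = f h"
    by (simp add: linear_mapD(3)[OF assms(1)] assms(2) cong: sweedler2_cong)
qed

lemma sweedler2_counit_counit: "h \<in> carr C \<Longrightarrow> sweedler2 C (\<lambda>x y. counit C x * counit C y) h = counit C h"
  using sweedler2_counit(1)[OF linear_counit] by (simp add: ground_def)

end

lemma coalgebra_comultiplication: "coalgebra C \<Longrightarrow> comultiplication C"
  by (simp add: comultiplication_def coalgebra.vspace coalgebra.linear_comult)

lemma ground_coalgebra_one: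
  "(1 :: 'k::field) \<in> carr ground_coalgebra"
  "comult ground_coalgebra (1 :: 'k::field) = pure_tensor ground_coalgebra ground_coalgebra 1 1"
proof -
  have "pure_tensor ground_coalgebra ground_coalgebra = pure_tensor (ground :: ('k, 'k) vspace) ground"
    by (rule pure_tensor_cong) (simp_all add: ground_def ground_coalgebra_def)
  then show "comult ground_coalgebra (1 :: 'k) = pure_tensor ground_coalgebra ground_coalgebra 1 1"
    by (simp add: ground_coalgebra_def)
qed (simp add: ground_coalgebra_def)

section \<open>Convolution with values in a graded Hopf algebra\<close>

context hopf_pi_algebra
begin

lemma vspace_H: "vspace (H \<alpha>)"
  using coalgebra coalgebra.vspace by blast

lemma comultiplication_H: "comultiplication (H \<alpha>)"
  by (rule coalgebra_comultiplication[OF coalgebra])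

lemma coalgebra_pair_H: "coalgebra_pair (H \<alpha>) (H \<beta>)"
  by (intro coalgebra_pair.intro coalgebra)

lemma mult_closed:
  "a \<in> carr (H \<alpha>) \<Longrightarrow> b \<in> carr (H \<beta>) \<Longrightarrow> \<gamma> = \<alpha> + \<beta> \<Longrightarrow> m \<alpha> \<beta> a b \<in> carr (H \<gamma>)"
  using bilinear_mapD(3)[OF bilinear_mult] by simp

lemma linear_mult:
  "linear_map X (H \<alpha>) f \<Longrightarrow> b \<in> carr (H \<beta>) \<Longrightarrow> \<gamma> = \<alpha> + \<beta> \<Longrightarrow> linear_map X (H \<gamma>) (\<lambda>x. m \<alpha> \<beta> (f x) b)"
  "linear_map X (H \<beta>) g \<Longrightarrow> a \<in> carr (H \<alpha>) \<Longrightarrow> \<gamma> = \<alpha> + \<beta> \<Longrightarrow> linear_map X (H \<gamma>) (\<lambda>x. m \<alpha> \<beta> a (g x))"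
  using linear_map_comp[OF bilinear_mapD(1)[OF bilinear_mult]]
    linear_map_comp[OF bilinear_mapD(2)[OF bilinear_mult]] by blast+

text \<open>The axiom \<open>coalgebra_hom_mult\<close> read at the pure tensor of \<open>a\<close>
  and \<open>b\<close>.\<close>

lemma comult_mult:
  assumes a: "a \<in> carr (H \<alpha>)" and b: "b \<in> carr (H \<beta>)"
  shows "comult (H (\<alpha> + \<beta>)) (m \<alpha> \<beta> a b) = sweedler2 (H \<alpha>) (\<lambda>x y. sweedler2 (H \<beta>) (\<lambda>z w.
    pure_tensor (H (\<alpha> + \<beta>)) (H (\<alpha> + \<beta>)) (m \<alpha> \<beta> x z) (m \<alpha> \<beta> y w)) b) a"
    and "counit (H (\<alpha> + \<beta>)) (m \<alpha> \<beta> a b) = counit (H \<alpha>) a * counit (H \<beta>) b"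
proof -
  interpret coalgebra_pair "H \<alpha>" "H \<beta>" by (rule coalgebra_pair_H)
  let ?t = "pure_tensor (H \<alpha>) (H \<beta>) a b"
  note hom = coalgebra_hom_mult[of \<alpha> \<beta>]
  have t: "?t \<in> carr T" by (rule pure_closed[OF a b])
  have l: "lift (H \<alpha>) (H \<beta>) (m \<alpha> \<beta>) (pure_tensor (H \<alpha>) (H \<beta>) x y) = m \<alpha> \<beta> x y"
    if "x \<in> carr (H \<alpha>)" "y \<in> carr (H \<beta>)" for x y
    by (rule lift_pure[OF vspace_H bilinear_mult that])
  have "comult (H (\<alpha> + \<beta>)) (m \<alpha> \<beta> a b) = sweedler2 T (\<lambda>x y. pure_tensor (H (\<alpha> + \<beta>)) (H (\<alpha> + \<beta>))
     (lift (H \<alpha>) (H \<beta>) (m \<alpha> \<beta>) x) (lift (H \<alpha>) (H \<beta>) (m \<alpha> \<beta>) y)) ?t"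
    using coalgebra_homD(4)[OF hom t] l[OF a b] by simp
  also have "\<dots> = sweedler2 (H \<alpha>) (\<lambda>x y. sweedler2 (H \<beta>) (\<lambda>z w.
     pure_tensor (H (\<alpha> + \<beta>)) (H (\<alpha> + \<beta>)) (lift (H \<alpha>) (H \<beta>) (m \<alpha> \<beta>) (pure_tensor (H \<alpha>) (H \<beta>) x z))
     (lift (H \<alpha>) (H \<beta>) (m \<alpha> \<beta>) (pure_tensor (H \<alpha>) (H \<beta>) y w))) b) a"
    by (rule sweedler2_pure[OF vspace_tensor_space bilinear_map_comp[OF bilinear_map_pure_tensor[OF vspace_H vspace_H]] a b])
      (rule coalgebra_homD(1)[OF hom])+
  finally show "comult (H (\<alpha> + \<beta>)) (m \<alpha> \<beta> a b) = sweedler2 (H \<alpha>) (\<lambda>x y. sweedler2 (H \<beta>) (\<lambda>z w.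
    pure_tensor (H (\<alpha> + \<beta>)) (H (\<alpha> + \<beta>)) (m \<alpha> \<beta> x z) (m \<alpha> \<beta> y w)) b) a"
    by (simp add: l a b comultiplication_H cong: comultiplication.sweedler2_cong)
  show "counit (H (\<alpha> + \<beta>)) (m \<alpha> \<beta> a b) = counit (H \<alpha>) a * counit (H \<beta>) b"
    using coalgebra_homD(3)[OF hom t] l[OF a b] counit_pure[OF a b] by simp
qed

text \<open>Both facts are \<open>coalgebra_hom_unit\<close> read at the scalar 1, which is
  grouplike in the ground coalgebra.\<close>

lemma one_grouplike: "comult (H 0) one = pure_tensor (H 0) (H 0) one one" "counit (H 0) one = 1"
proof -
  have v: "vspace ground_coalgebra"
    using vspace_ground by (simp add: vspace_def ground_def ground_coalgebra_def)
  note s = vspaceD(5)[OF vspace_H]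
  note 1 = ground_coalgebra_one(1) and c = ground_coalgebra_one(2)
  have l: "linear_map ground_coalgebra (H 0) (\<lambda>c. scal (H 0) c one)"
    by (rule coalgebra_homD(1)[OF coalgebra_hom_unit])
  have "comult (H 0) (scal (H 0) 1 one) =
      sweedler2 ground_coalgebra (\<lambda>x y. pure_tensor (H 0) (H 0) (scal (H 0) x one) (scal (H 0) y one)) 1"
    by (rule coalgebra_homD(4)[OF coalgebra_hom_unit 1])
  also have "\<dots> = pure_tensor (H 0) (H 0) (scal (H 0) 1 one) (scal (H 0) 1 one)"
    unfolding sweedler2_def c
    by (rule lift_pure_tensor[OF v v vspace_tensor_space
        bilinear_map_comp[OF bilinear_map_pure_tensor[OF vspace_H vspace_H] l l] 1 1])
  finally show "comult (H 0) one = pure_tensor (H 0) (H 0) one one" by (simp add: s)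
  show "counit (H 0) one = 1"
    using coalgebra_homD(3)[OF coalgebra_hom_unit 1] by (simp add: s ground_coalgebra_def)
qed

text \<open>The degrees are explicit arguments because all members of \<open>H\<close> lie in one
  type, so a function does not reveal its degree.\<close>

definition conv where "conv X \<alpha> \<beta> f g = sweedler2 X (\<lambda>x y. m \<alpha> \<beta> (f x) (g y))"

lemma bilinear_conv:
  "linear_map X (H \<alpha>) f \<Longrightarrow> linear_map X (H \<beta>) g \<Longrightarrow> bilinear_map X X (H (\<alpha> + \<beta>)) (\<lambda>x y. m \<alpha> \<beta> (f x) (g y))"
  by (rule bilinear_map_comp[OF bilinear_mult])

lemma linear_conv:
  assumes "coalgebra X" "linear_map X (H \<alpha>) f" "linear_map X (H \<beta>) g"
  shows "linear_map X (H (\<alpha> + \<beta>)) (conv X \<alpha> \<beta> f g)"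
  unfolding conv_def
  by (rule comultiplication.linear_map_sweedler2[OF _ vspace_H bilinear_conv])
    (rule assms coalgebra_comultiplication)+

lemma conv_assoc:
  assumes X: "coalgebra X" and f: "linear_map X (H \<alpha>) f" "linear_map X (H \<beta>) g" "linear_map X (H \<gamma>) k"
    and x: "x \<in> carr X"
  shows "conv X (\<alpha> + \<beta>) \<gamma> (conv X \<alpha> \<beta> f g) k x = conv X \<alpha> (\<beta> + \<gamma>) f (conv X \<beta> \<gamma> g k) x"
  unfolding conv_def
  by (rule coalgebra.convolution_assoc[OF X vspace_H vspace_H vspace_H vspace_H vspace_H vspace_H
        bilinear_mult bilinear_mult bilinear_mult _ assoc f x])
    (use bilinear_mult[of \<alpha> "\<beta> + \<gamma>"] in \<open>simp_all add: add.assoc\<close>)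

text \<open>An element \<open>h\<close> is represented by the map
  \<open>x \<mapsto> \<epsilon>(x) h\<close>. The counit removes one leg, which leaves
  multiplication by \<open>h\<close>; the case of \<open>one\<close> gives the unit of
  convolution.\<close>

lemma conv_const:
  assumes X: "coalgebra X" and f: "linear_map X (H \<alpha>) f" and x: "x \<in> carr X" and h: "h \<in> carr (H \<beta>)"
  shows "conv X \<alpha> \<beta> f (\<lambda>x. scal (H \<beta>) (counit X x) h) x = m \<alpha> \<beta> (f x) h"
    "conv X \<beta> \<alpha> (\<lambda>x. scal (H \<beta>) (counit X x) h) f x = m \<beta> \<alpha> h (f x)"
proof -
  interpret coalgebra X by fact
  note fx = linear_mapD(1)[OF f]
  show "conv X \<alpha> \<beta> f (\<lambda>x. scal (H \<beta>) (counit X x) h) x = m \<alpha> \<beta> (f x) h"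
    unfolding conv_def sweedler2_counit(2)[OF linear_mult(1)[OF f h refl] x, symmetric]
    by (rule comultiplication.sweedler2_cong[OF comultiplication_axioms x],
        rule linear_mapD(3)[OF bilinear_mapD(1)[OF bilinear_mult]]) (assumption | rule fx h)+
  show "conv X \<beta> \<alpha> (\<lambda>x. scal (H \<beta>) (counit X x) h) f x = m \<beta> \<alpha> h (f x)"
    unfolding conv_def sweedler2_counit(1)[OF linear_mult(2)[OF f h refl] x, symmetric]
    by (rule comultiplication.sweedler2_cong[OF comultiplication_axioms x],
        rule linear_mapD(3)[OF bilinear_mapD(2)[OF bilinear_mult]]) (assumption | rule fx h)+
qed

end

section \<open>The graded algebra of tensor squares, and the antipode as a coalgebra map\<close>

context cocommutative_hopf_pi_algebra
begin

text \<open>The componentwise product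
  \<open>(a \<otimes> b) (c \<otimes> d) = a c \<otimes> b d\<close>, extended to all tensors by one
  lift for each argument.\<close>

definition tensor_mult where
  "tensor_mult \<alpha> \<beta> s t = lift (H \<alpha>) (H \<alpha>) (\<lambda>a b. lift (H \<beta>) (H \<beta>) (\<lambda>c d.
     pure_tensor (H (\<alpha> + \<beta>)) (H (\<alpha> + \<beta>)) (m \<alpha> \<beta> a c) (m \<alpha> \<beta> b d)) t) s"

abbreviation "HH \<alpha> \<equiv> tensor_space (H \<alpha>) (H \<alpha>)"
abbreviation "pure \<alpha> \<equiv> pure_tensor (H \<alpha>) (H \<alpha>)"

lemma bilinear_pure: "bilinear_map (H \<alpha>) (H \<alpha>) (HH \<alpha>) (pure \<alpha>)"
  by (rule bilinear_map_pure_tensor[OF vspace_H vspace_H])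

lemma tensor_mult:
  shows "bilinear_map (HH \<alpha>) (HH \<beta>) (HH (\<alpha> + \<beta>)) (tensor_mult \<alpha> \<beta>)"
    and "\<lbrakk>a \<in> carr (H \<alpha>); b \<in> carr (H \<alpha>); c \<in> carr (H \<beta>); d \<in> carr (H \<beta>)\<rbrakk> \<Longrightarrow>
      tensor_mult \<alpha> \<beta> (pure \<alpha> a b) (pure \<beta> c d) = pure (\<alpha> + \<beta>) (m \<alpha> \<beta> a c) (m \<alpha> \<beta> b d)"
proof -
  let ?G = "\<lambda>a b c d. pure (\<alpha> + \<beta>) (m \<alpha> \<beta> a c) (m \<alpha> \<beta> b d)"
  note v = vspace_H and t = vspace_tensor_space
  have G1: "bilinear_map (H \<beta>) (H \<beta>) (HH (\<alpha> + \<beta>)) (?G a b)" if "a \<in> carr (H \<alpha>)" "b \<in> carr (H \<alpha>)" for a b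
    by (rule bilinear_map_comp[OF bilinear_pure]) (intro bilinear_mapD(1)[OF bilinear_mult] that)+
  have G2: "bilinear_map (H \<alpha>) (H \<alpha>) (HH (\<alpha> + \<beta>)) (\<lambda>a b. ?G a b c d)" if "c \<in> carr (H \<beta>)" "d \<in> carr (H \<beta>)" for c d
    by (rule bilinear_map_comp[OF bilinear_pure]) (intro bilinear_mapD(2)[OF bilinear_mult] that)+
  have F: "trilinear_map (H \<alpha>) (H \<alpha>) (HH \<beta>) (HH (\<alpha> + \<beta>)) (\<lambda>a b t. lift (H \<beta>) (H \<beta>) (?G a b) t)"
  proof (rule trilinear_mapI)
    fix a b assume "a \<in> carr (H \<alpha>)" "b \<in> carr (H \<alpha>)"
    then show "linear_map (HH \<beta>) (HH (\<alpha> + \<beta>)) (lift (H \<beta>) (H \<beta>) (?G a b))"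
      by (intro linear_map_lift v t G1)
  next
    fix b s assume b: "b \<in> carr (H \<alpha>)" and s: "s \<in> carr (HH \<beta>)"
    \<comment> \<open>With \<open>s\<close> fixed, the variable \<open>a\<close> is a parameter of a
      lift; \<open>bilinear_map_lift\<close> applies once it stands in the last place.\<close>
    have "trilinear_map (H \<beta>) (H \<beta>) (H \<alpha>) (HH (\<alpha> + \<beta>)) (\<lambda>c d a. ?G a b c d)"
      using b by (intro trilinear_mapI bilinear_mapD(1)[OF G1] bilinear_mapD(2)[OF G1] bilinear_mapD(2)[OF G2])
    from bilinear_mapD(1)[OF bilinear_map_lift[OF v v v t this] s]
    show "linear_map (H \<alpha>) (HH (\<alpha> + \<beta>)) (\<lambda>a. lift (H \<beta>) (H \<beta>) (?G a b) s)" .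
  next
    fix a s assume a: "a \<in> carr (H \<alpha>)" and s: "s \<in> carr (HH \<beta>)"
    have "trilinear_map (H \<beta>) (H \<beta>) (H \<alpha>) (HH (\<alpha> + \<beta>)) (\<lambda>c d b. ?G a b c d)"
      using a by (intro trilinear_mapI bilinear_mapD(1)[OF G1] bilinear_mapD(2)[OF G1] bilinear_mapD(1)[OF G2])
    from bilinear_mapD(1)[OF bilinear_map_lift[OF v v v t this] s]
    show "linear_map (H \<alpha>) (HH (\<alpha> + \<beta>)) (\<lambda>b. lift (H \<beta>) (H \<beta>) (?G a b) s)" .
  qed
  show "bilinear_map (HH \<alpha>) (HH \<beta>) (HH (\<alpha> + \<beta>)) (tensor_mult \<alpha> \<beta>)"
    using bilinear_map_lift[OF v v t t F] unfolding tensor_mult_def .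
  assume abcd: "a \<in> carr (H \<alpha>)" "b \<in> carr (H \<alpha>)" "c \<in> carr (H \<beta>)" "d \<in> carr (H \<beta>)"
  show "tensor_mult \<alpha> \<beta> (pure \<alpha> a b) (pure \<beta> c d) = ?G a b c d"
    unfolding tensor_mult_def
    by (subst lift_pure_tensor[OF v v t trilinear_mapD(6)[OF F bilinear_mapD(3)[OF bilinear_pure abcd(3,4)]] abcd(1,2)])
      (rule lift_pure_tensor[OF v v t G1[OF abcd(1,2)] abcd(3,4)])
qed

text \<open>Both sides are linear in each argument (\<open>L\<close>, \<open>M\<close>,
  \<open>N\<close>), so the tensors are replaced by pure ones one after the other, where
  associativity of \<open>m\<close> decides.\<close>

lemma tensor_mult_assoc:
  assumes r: "r \<in> carr (HH \<alpha>)" and s: "s \<in> carr (HH \<beta>)" and t: "t \<in> carr (HH \<gamma>)"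
  shows "tensor_mult (\<alpha> + \<beta>) \<gamma> (tensor_mult \<alpha> \<beta> r s) t = tensor_mult \<alpha> (\<beta> + \<gamma>) r (tensor_mult \<beta> \<gamma> s t)"
proof -
  note b1 = bilinear_mapD(1)[OF tensor_mult(1)] and b2 = bilinear_mapD(2)[OF tensor_mult(1)]
    and c = bilinear_mapD(3)[OF tensor_mult(1)] bilinear_mapD(3)[OF bilinear_pure]
  have L: "linear_map (HH \<alpha>) (HH (\<alpha> + \<beta> + \<gamma>)) (\<lambda>r. tensor_mult (\<alpha> + \<beta>) \<gamma> (tensor_mult \<alpha> \<beta> r s) t)"
     "linear_map (HH \<alpha>) (HH (\<alpha> + \<beta> + \<gamma>)) (\<lambda>r. tensor_mult \<alpha> (\<beta> + \<gamma>) r (tensor_mult \<beta> \<gamma> s t))"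
    if "s \<in> carr (HH \<beta>)" "t \<in> carr (HH \<gamma>)" for s t
    subgoal by (rule linear_map_comp[OF b2 b2]) (rule that c)+
    subgoal unfolding add.assoc by (rule b2) (rule that c)+
    done
  have M: "linear_map (HH \<beta>) (HH (\<alpha> + \<beta> + \<gamma>)) (\<lambda>s. tensor_mult (\<alpha> + \<beta>) \<gamma> (tensor_mult \<alpha> \<beta> r s) t)"
     "linear_map (HH \<beta>) (HH (\<alpha> + \<beta> + \<gamma>)) (\<lambda>s. tensor_mult \<alpha> (\<beta> + \<gamma>) r (tensor_mult \<beta> \<gamma> s t))"
    if "r \<in> carr (HH \<alpha>)" "t \<in> carr (HH \<gamma>)" for r t
    subgoal by (rule linear_map_comp[OF b2 b1]) (rule that c)+
    subgoal unfolding add.assoc by (rule linear_map_comp[OF b1 b2]) (rule that c)+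
    done
  have N: "linear_map (HH \<gamma>) (HH (\<alpha> + \<beta> + \<gamma>)) (\<lambda>t. tensor_mult (\<alpha> + \<beta>) \<gamma> (tensor_mult \<alpha> \<beta> r s) t)"
     "linear_map (HH \<gamma>) (HH (\<alpha> + \<beta> + \<gamma>)) (\<lambda>t. tensor_mult \<alpha> (\<beta> + \<gamma>) r (tensor_mult \<beta> \<gamma> s t))"
    if "r \<in> carr (HH \<alpha>)" "s \<in> carr (HH \<beta>)" for r s
    subgoal by (rule b1) (rule that c)+
    subgoal unfolding add.assoc by (rule linear_map_comp[OF b1 b1]) (rule that c)+
    done
  note ext = tensor_ext[OF vspace_H vspace_H]
  show ?thesis
  proof (rule ext[OF L[OF s t] _ r])
    fix a a' assume a: "a \<in> carr (H \<alpha>)" "a' \<in> carr (H \<alpha>)"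
    note a' = bilinear_mapD(3)[OF bilinear_pure a]
    show "tensor_mult (\<alpha> + \<beta>) \<gamma> (tensor_mult \<alpha> \<beta> (pure \<alpha> a a') s) t =
      tensor_mult \<alpha> (\<beta> + \<gamma>) (pure \<alpha> a a') (tensor_mult \<beta> \<gamma> s t)"
    proof (rule ext[OF M[OF a' t] _ s])
      fix b b' assume b: "b \<in> carr (H \<beta>)" "b' \<in> carr (H \<beta>)"
      note b' = bilinear_mapD(3)[OF bilinear_pure b]
      show "tensor_mult (\<alpha> + \<beta>) \<gamma> (tensor_mult \<alpha> \<beta> (pure \<alpha> a a') (pure \<beta> b b')) t =
        tensor_mult \<alpha> (\<beta> + \<gamma>) (pure \<alpha> a a') (tensor_mult \<beta> \<gamma> (pure \<beta> b b') t)"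
        by (rule ext[OF N[OF a' b'] _ t]) (simp add: tensor_mult(2) a b mult_closed assoc add.assoc)
    qed
  qed
qed

lemma tensor_mult_one: "t \<in> carr (HH \<alpha>) \<Longrightarrow> tensor_mult 0 \<alpha> (pure 0 one one) t = t"
  "t \<in> carr (HH \<alpha>) \<Longrightarrow> tensor_mult \<alpha> 0 t (pure 0 one one) = t"
proof -
  note o = bilinear_mapD(3)[OF bilinear_pure one_closed one_closed]
  note b1 = bilinear_mapD(1)[OF tensor_mult(1) o] and b2 = bilinear_mapD(2)[OF tensor_mult(1) o]
  assume t: "t \<in> carr (HH \<alpha>)"
  show "tensor_mult 0 \<alpha> (pure 0 one one) t = t"
    by (rule tensor_ext[OF vspace_H vspace_H b1[unfolded add_0] linear_map_id _ t])
      (simp add: tensor_mult(2) one_closed unit_left)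
  show "tensor_mult \<alpha> 0 t (pure 0 one one) = t"
    by (rule tensor_ext[OF vspace_H vspace_H b2[unfolded add_0_right] linear_map_id _ t])
      (simp add: tensor_mult(2) one_closed unit_right)
qed

lemma tensor_mult_sweedler2:
  assumes "comultiplication C" "comultiplication D" "c \<in> carr C" "d \<in> carr D"
    and f: "\<And>x y. x \<in> carr C \<Longrightarrow> y \<in> carr C \<Longrightarrow> f x y \<in> carr (HH \<alpha>)"
    and g: "\<And>x y. x \<in> carr D \<Longrightarrow> y \<in> carr D \<Longrightarrow> g x y \<in> carr (HH \<beta>)"
  shows "tensor_mult \<alpha> \<beta> (sweedler2 C f c) (sweedler2 D g d) =
    sweedler2 C (\<lambda>x y. sweedler2 D (\<lambda>z w. tensor_mult \<alpha> \<beta> (f x y) (g z w)) d) c"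
  by (rule sweedler2_separate[OF assms(1,2) vspace_tensor_space vspace_tensor_space
        vspace_tensor_space tensor_mult(1) assms(3,4) f g, symmetric])

lemma comult_mult_tensor:
  assumes a: "a \<in> carr (H \<alpha>)" and b: "b \<in> carr (H \<beta>)"
  shows "comult (H (\<alpha> + \<beta>)) (m \<alpha> \<beta> a b) = tensor_mult \<alpha> \<beta> (comult (H \<alpha>) a) (comult (H \<beta>) b)"
  unfolding comult_mult(1)[OF a b] comultiplication.comult_eq_sweedler2[OF comultiplication_H a]
    comultiplication.comult_eq_sweedler2[OF comultiplication_H b]
  by (simp add: tensor_mult_sweedler2 comultiplication_H a b bilinear_mapD(3)[OF bilinear_pure] tensor_mult(2)
      cong: comultiplication.sweedler2_cong)

text \<open>The algebra \<open>H \<otimes> H\<close> serves to see that \<open>\<Delta> S\<close> and \<open>(S \<otimes> S) \<Delta>\<close> are a left and a right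
  convolution inverse of \<open>\<Delta>\<close>, hence equal.\<close>

lemma coalgebra_hom_antipode: "coalgebra_hom (H \<alpha>) (H (- \<alpha>)) (S \<alpha>)"
  unfolding coalgebra_hom_def
proof (intro conjI ballI linear_antipode)
  interpret X: coalgebra "H \<alpha>" by (rule coalgebra)
  interpret X': coalgebra "H (- \<alpha>)" by (rule coalgebra)
  note Sc = linear_mapD(1)[OF linear_antipode]
  fix h assume h: "h \<in> carr (H \<alpha>)"
  \<comment> \<open>The counit of \<open>h_2\<close> is inserted and combined with that of
    \<open>S h_1\<close> into the counit of a product, which the antipode law evaluates.\<close>
  have "counit (H (- \<alpha>)) (S \<alpha> h) =
      counit (H (- \<alpha>)) (sweedler2 (H \<alpha>) (\<lambda>x y. scal (H (- \<alpha>)) (counit (H \<alpha>) y) (S \<alpha> x)) h)"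
    by (simp add: X.sweedler2_counit(2)[OF linear_antipode h])
  also have "\<dots> = sweedler2 (H \<alpha>) (\<lambda>x y. counit (H (- \<alpha>)) (scal (H (- \<alpha>)) (counit (H \<alpha>) y) (S \<alpha> x))) h"
    by (rule X.linear_map_of_sweedler2[OF X'.linear_counit vspace_H h]) (intro vspaceD(3)[OF vspace_H] Sc)
  also have "\<dots> = sweedler2 (H \<alpha>) (\<lambda>x y. counit (H 0) (m (- \<alpha>) \<alpha> (S \<alpha> x) y)) h"
    using comult_mult(2)[where \<alpha>="- \<alpha>" and \<beta>=\<alpha>]
    by (simp add: X'.counit_scale Sc h mult.commute comultiplication_H cong: comultiplication.sweedler2_cong)
  also have "\<dots> = counit (H 0) (sweedler2 (H \<alpha>) (\<lambda>x y. m (- \<alpha>) \<alpha> (S \<alpha> x) y) h)"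
    by (rule X.linear_map_of_sweedler2[OF coalgebra.linear_counit[OF coalgebra] vspace_H h, symmetric])
      (simp add: mult_closed Sc)
  also have "\<dots> = counit (H \<alpha>) h"
    by (simp add: antipode_left h coalgebra.counit_scale[OF coalgebra] one_closed one_grouplike)
  finally show "counit (H (- \<alpha>)) (S \<alpha> h) = counit (H \<alpha>) h" .

  let ?u = "\<lambda>h. comult (H (- \<alpha>)) (S \<alpha> h)" and ?v = "comult (H \<alpha>)"
    and ?w = "sweedler2 (H \<alpha>) (\<lambda>x y. pure (- \<alpha>) (S \<alpha> x) (S \<alpha> y))"
  have u: "linear_map (H \<alpha>) (HH (- \<alpha>)) ?u"
    by (rule linear_map_comp[OF X'.linear_comult linear_antipode])
  have w: "linear_map (H \<alpha>) (HH (- \<alpha>)) ?w"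
    by (rule X.linear_map_sweedler2[OF vspace_tensor_space
        bilinear_map_comp[OF bilinear_pure linear_antipode linear_antipode]])
  note o = bilinear_mapD(3)[OF bilinear_pure one_closed one_closed]
  have uv: "sweedler2 (H \<alpha>) (\<lambda>x y. tensor_mult (- \<alpha>) \<alpha> (?u x) (?v y)) x =
      scal (HH 0) (counit (H \<alpha>) x) (pure 0 one one)" if x: "x \<in> carr (H \<alpha>)" for x
  proof -
    have "sweedler2 (H \<alpha>) (\<lambda>x y. tensor_mult (- \<alpha>) \<alpha> (?u x) (?v y)) x =
        sweedler2 (H \<alpha>) (\<lambda>x y. comult (H 0) (m (- \<alpha>) \<alpha> (S \<alpha> x) y)) x"
      using comult_mult_tensor[where \<alpha>="- \<alpha>" and \<beta>=\<alpha>]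
      by (simp add: Sc x comultiplication_H cong: comultiplication.sweedler2_cong)
    also have "\<dots> = comult (H 0) (sweedler2 (H \<alpha>) (\<lambda>x y. m (- \<alpha>) \<alpha> (S \<alpha> x) y) x)"
      by (rule X.linear_map_of_sweedler2[OF coalgebra.linear_comult[OF coalgebra] vspace_H x, symmetric])
        (simp add: mult_closed Sc)
    also have "\<dots> = scal (HH 0) (counit (H \<alpha>) x) (pure 0 one one)"
      by (simp add: antipode_left x linear_mapD(3)[OF coalgebra.linear_comult[OF coalgebra]] one_closed one_grouplike)
    finally show ?thesis .
  qed
  have vw: "sweedler2 (H \<alpha>) (\<lambda>x y. tensor_mult \<alpha> (- \<alpha>) (?v x) (?w y)) x =
      scal (HH 0) (counit (H \<alpha>) x) (pure 0 one one)" if x: "x \<in> carr (H \<alpha>)" for x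
  proof -
    let ?F = "\<lambda>x y z w. pure 0 (m \<alpha> (- \<alpha>) x (S \<alpha> z)) (m \<alpha> (- \<alpha>) y (S \<alpha> w))"
    note p1 = linear_map_comp[OF bilinear_mapD(1)[OF bilinear_pure]]
      and p2 = linear_map_comp[OF bilinear_mapD(2)[OF bilinear_pure]]
    have mc: "m \<alpha> (- \<alpha>) a (S \<alpha> b) \<in> carr (H 0)" if "a \<in> carr (H \<alpha>)" "b \<in> carr (H \<alpha>)" for a b
      using that by (simp add: mult_closed Sc)
    have "sweedler2 (H \<alpha>) (\<lambda>x y. tensor_mult \<alpha> (- \<alpha>) (?v x) (?w y)) x =
       sweedler2 (H \<alpha>) (\<lambda>a b. sweedler2 (H \<alpha>) (\<lambda>x y. sweedler2 (H \<alpha>) (\<lambda>z w. ?F x y z w) b) a) x"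
      by (simp add: X.comult_eq_sweedler2 tensor_mult_sweedler2 comultiplication_H x Sc
          bilinear_mapD(3)[OF bilinear_pure] tensor_mult(2) cong: comultiplication.sweedler2_cong)
    \<comment> \<open>So far leg 1 is multiplied with leg 3 and leg 2 with leg 4. Exchanging the
      middle legs makes the factors of each product adjacent, and the antipode law applies in both
      components.\<close>
    also have "\<dots> = sweedler2 (H \<alpha>) (\<lambda>a b. sweedler2 (H \<alpha>) (\<lambda>x y. sweedler2 (H \<alpha>) (\<lambda>z w. ?F x z y w) b) a) x"
      by (rule X.sweedler2_middle_swap[OF cocommutative vspace_tensor_space[of "H 0" "H 0"] _ _ _ _ x])
        (assumption | rule p1 p2 linear_mult linear_map_id linear_antipode mc Sc right_minus[symmetric])+
    also have "\<dots> = sweedler2 (H \<alpha>) (\<lambda>a b. pure 0 (sweedler2 (H \<alpha>) (\<lambda>x y. m \<alpha> (- \<alpha>) x (S \<alpha> y)) a)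
        (sweedler2 (H \<alpha>) (\<lambda>x y. m \<alpha> (- \<alpha>) x (S \<alpha> y)) b)) x"
      by (rule X.sweedler2_cong[OF x], rule sweedler2_separate[OF comultiplication_H comultiplication_H
          vspace_H vspace_H vspace_tensor_space bilinear_pure]) (assumption | rule mc)+
    also have "\<dots> = sweedler2 (H \<alpha>) (\<lambda>a b. scal (HH 0) (counit (H \<alpha>) a) (scal (HH 0) (counit (H \<alpha>) b) (pure 0 one one))) x"
      by (simp add: antipode_right x comultiplication_H one_closed vspaceD(3)[OF vspace_H]
          linear_mapD(3)[OF bilinear_mapD(1)[OF bilinear_pure]] linear_mapD(3)[OF bilinear_mapD(2)[OF bilinear_pure]]
          vspace_scale_commute[OF vspace_tensor_space]
          cong: comultiplication.sweedler2_cong)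
    also have "\<dots> = scal (HH 0) (counit (H \<alpha>) x) (pure 0 one one)"
      by (rule X.sweedler2_counit(1)[OF linear_map_scale_left[OF vspace_tensor_space X.linear_counit o] x])
    finally show ?thesis .
  qed
  note s1 = linear_mapD(3)[OF bilinear_mapD(1)[OF tensor_mult(1)]]
    and s2 = linear_mapD(3)[OF bilinear_mapD(2)[OF tensor_mult(1)]]
  \<comment> \<open>The instances of \<open>tensor_mult\<close> carry degrees such as
    \<open>- \<alpha> + \<alpha>\<close>; normalising them to \<open>0\<close> makes the maps
    composable.\<close>
  have bm: "bilinear_map (HH (- \<alpha>)) (HH \<alpha>) (HH 0) (tensor_mult (- \<alpha>) \<alpha>)"
    "bilinear_map (HH \<alpha>) (HH (- \<alpha>)) (HH 0) (tensor_mult \<alpha> (- \<alpha>))"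
    "bilinear_map (HH 0) (HH (- \<alpha>)) (HH (- \<alpha>)) (tensor_mult 0 (- \<alpha>))"
    "bilinear_map (HH (- \<alpha>)) (HH 0) (HH (- \<alpha>)) (tensor_mult (- \<alpha>) 0)"
    using tensor_mult(1)[of "- \<alpha>" \<alpha>] tensor_mult(1)[of \<alpha> "- \<alpha>"] tensor_mult(1)[of 0 "- \<alpha>"]
      tensor_mult(1)[of "- \<alpha>" 0] by simp_all
  have as: "tensor_mult 0 (- \<alpha>) (tensor_mult (- \<alpha>) \<alpha> r s) t = tensor_mult (- \<alpha>) 0 r (tensor_mult \<alpha> (- \<alpha>) s t)"
    if "r \<in> carr (HH (- \<alpha>))" "s \<in> carr (HH \<alpha>)" "t \<in> carr (HH (- \<alpha>))" for r s t
    using tensor_mult_assoc[OF that] by simp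
  note V = vspace_tensor_space
  have "?w h = sweedler2 (H \<alpha>) (\<lambda>x z. tensor_mult 0 (- \<alpha>)
      (sweedler2 (H \<alpha>) (\<lambda>x y. tensor_mult (- \<alpha>) \<alpha> (?u x) (?v y)) x) (?w z)) h"
    using X.sweedler2_counit(1)[OF w h]
    by (simp add: uv h comultiplication_H s2 o linear_mapD(1)[OF w] tensor_mult_one cong: comultiplication.sweedler2_cong)
  also have "\<dots> = sweedler2 (H \<alpha>) (\<lambda>x y. tensor_mult (- \<alpha>) 0 (?u x)
      (sweedler2 (H \<alpha>) (\<lambda>y z. tensor_mult \<alpha> (- \<alpha>) (?v y) (?w z)) y)) h"
    by (rule X.convolution_assoc[of "HH (- \<alpha>)" "HH \<alpha>" "HH (- \<alpha>)" "HH 0" "HH 0" "HH (- \<alpha>)"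
          "tensor_mult (- \<alpha>) \<alpha>" "tensor_mult 0 (- \<alpha>)" "tensor_mult \<alpha> (- \<alpha>)" "tensor_mult (- \<alpha>) 0"])
      (rule V bm u w h X.linear_comult, (rule as; assumption)?)+
  also have "\<dots> = ?u h"
    using X.sweedler2_counit(2)[OF u h]
    by (simp add: vw h comultiplication_H s1 o linear_mapD(1)[OF u] tensor_mult_one cong: comultiplication.sweedler2_cong)
  finally show "?u h = ?w h" ..
qed

text \<open>The coproduct of \<open>f(x_1) g(x_2)\<close> is
  \<open>f(x_1) g(x_3) \<otimes> f(x_2) g(x_4)\<close>. Cocommutativity of \<open>X\<close>
  exchanges the middle legs, which turns both components into convolution products.\<close>

lemma coalgebra_hom_conv:
  assumes X: "coalgebra X" and cc: "Defs.cocommutative X"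
    and f: "coalgebra_hom X (H \<alpha>) f" and g: "coalgebra_hom X (H \<beta>) g"
  shows "coalgebra_hom X (H (\<alpha> + \<beta>)) (conv X \<alpha> \<beta> f g)"
  unfolding coalgebra_hom_def
proof (intro conjI ballI)
  interpret coalgebra X by fact
  note fl = coalgebra_homD(1)[OF f] and gl = coalgebra_homD(1)[OF g]
  note fc = linear_mapD(1)[OF fl] and gc = linear_mapD(1)[OF gl]
  interpret Hc: coalgebra "H (\<alpha> + \<beta>)" by (rule coalgebra)
  show "linear_map X (H (\<alpha> + \<beta>)) (conv X \<alpha> \<beta> f g)"
    by (rule linear_conv[OF X fl gl])
  fix h assume h: "h \<in> carr X"
  have "counit (H (\<alpha> + \<beta>)) (conv X \<alpha> \<beta> f g h) = sweedler2 X (\<lambda>x y. counit (H (\<alpha> + \<beta>)) (m \<alpha> \<beta> (f x) (g y))) h"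
    unfolding conv_def by (rule linear_map_of_sweedler2[OF Hc.linear_counit vspace_H h]) (simp add: mult_closed fc gc)
  then show "counit (H (\<alpha> + \<beta>)) (conv X \<alpha> \<beta> f g h) = counit X h"
    by (simp add: comult_mult(2) fc gc h coalgebra_homD(3)[OF f] coalgebra_homD(3)[OF g]
        sweedler2_counit_counit comultiplication_axioms cong: comultiplication.sweedler2_cong)
  let ?F = "\<lambda>x y z w. pure (\<alpha> + \<beta>) (m \<alpha> \<beta> (f x) (g z)) (m \<alpha> \<beta> (f y) (g w))"
  note p1 = linear_map_comp[OF bilinear_mapD(1)[OF bilinear_pure]]
    and p2 = linear_map_comp[OF bilinear_mapD(2)[OF bilinear_pure]]
  note mc = bilinear_mapD(3)[OF bilinear_mult]
  have comult_fg: "comult (H (\<alpha> + \<beta>)) (m \<alpha> \<beta> (f a) (g b)) =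
      sweedler2 X (\<lambda>x y. sweedler2 X (\<lambda>z w. ?F x y z w) b) a"
    if a: "a \<in> carr X" and b: "b \<in> carr X" for a b
  proof -
    have "comult (H (\<alpha> + \<beta>)) (m \<alpha> \<beta> (f a) (g b)) =
        tensor_mult \<alpha> \<beta> (comult (H \<alpha>) (f a)) (comult (H \<beta>) (g b))"
      by (rule comult_mult_tensor[OF fc[OF a] gc[OF b]])
    then show ?thesis
      by (simp add: coalgebra_homD(4)[OF f] coalgebra_homD(4)[OF g] a b tensor_mult_sweedler2
          comultiplication_axioms bilinear_mapD(3)[OF bilinear_pure] tensor_mult(2) fc gc cong: comultiplication.sweedler2_cong)
  qed
  have "comult (H (\<alpha> + \<beta>)) (conv X \<alpha> \<beta> f g h) =
      sweedler2 X (\<lambda>x y. comult (H (\<alpha> + \<beta>)) (m \<alpha> \<beta> (f x) (g y))) h"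
    unfolding conv_def by (rule linear_map_of_sweedler2[OF Hc.linear_comult vspace_H h]) (simp add: mult_closed fc gc)
  also have "\<dots> = sweedler2 X (\<lambda>a b. sweedler2 X (\<lambda>x y. sweedler2 X (\<lambda>z w. ?F x y z w) b) a) h"
    by (simp add: comult_fg h comultiplication_axioms cong: comultiplication.sweedler2_cong)
  also have "\<dots> = sweedler2 X (\<lambda>a b. sweedler2 X (\<lambda>x y. sweedler2 X (\<lambda>z w. ?F x z y w) b) a) h"
    by (rule sweedler2_middle_swap[OF cc vspace_tensor_space[of "H (\<alpha> + \<beta>)" "H (\<alpha> + \<beta>)"] _ _ _ _ h])
      (assumption | rule p1 p2 linear_mult fl gl mc fc gc refl)+
  also have "\<dots> = sweedler2 X (\<lambda>x y. pure (\<alpha> + \<beta>) (conv X \<alpha> \<beta> f g x) (conv X \<alpha> \<beta> f g y)) h"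
    unfolding conv_def
    by (rule comultiplication.sweedler2_cong[OF comultiplication_axioms h], rule sweedler2_separate[OF comultiplication_axioms comultiplication_axioms
          vspace_H vspace_H vspace_tensor_space bilinear_pure]) (assumption | rule mc fc gc)+
  finally show "comult (H (\<alpha> + \<beta>)) (conv X \<alpha> \<beta> f g h) = \<dots>" .
qed

end

section \<open>The convolution monoid of graded linear maps\<close>

context hopf_pi_algebra
begin

lemma conv_cong:
  assumes X: "coalgebra X" and x: "x \<in> carr X"
    and "\<And>x. x \<in> carr X \<Longrightarrow> f x = f' x" "\<And>x. x \<in> carr X \<Longrightarrow> g x = g' x"
  shows "conv X \<alpha> \<beta> f g x = conv X \<alpha> \<beta> f' g' x"
  unfolding conv_def
  by (rule comultiplication.sweedler2_cong[OF coalgebra_comultiplication[OF X] x]) (simp add: assms)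

text \<open>An element of degree \<open>\<alpha>\<close> of the convolution monoid is a pair of \<open>\<alpha>\<close> and a map, restricted
  to the carrier so that equality of pairs is equality on the carrier.\<close>

definition graded where "graded X \<alpha> f = (\<alpha>, restrict f (carr X))"

lemma graded_eq_iff: "graded X \<alpha> f = graded X \<beta> g \<longleftrightarrow> \<alpha> = \<beta> \<and> (\<forall>x\<in>carr X. f x = g x)"
  by (auto simp: graded_def restrict_def fun_eq_iff)

definition unit_map where "unit_map X x = scal (H 0) (counit X x) one"

text \<open>Maps of all degrees are collected in one structure, with degrees adding, so that the
  abstract theory of monoids and groups applies.\<close>

definition conv_monoid where
  "conv_monoid X = \<lparr>carrier = {graded X \<alpha> f | \<alpha> f. linear_map X (H \<alpha>) f},
     mult = (\<lambda>a b. graded X (fst a + fst b) (conv X (fst a) (fst b) (snd a) (snd b))),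
     one = graded X 0 (unit_map X)\<rparr>"

lemma conv_monoid_simps:
  "carrier (conv_monoid X) = {graded X \<alpha> f | \<alpha> f. linear_map X (H \<alpha>) f}"
  "\<one>\<^bsub>conv_monoid X\<^esub> = graded X 0 (unit_map X)"
  by (simp_all add: conv_monoid_def)

text \<open>\<open>conv\<close> evaluates its arguments on the carrier only, so the restrictions
  inside the pairs may be dropped.\<close>

lemma graded_mult:
  assumes "coalgebra X"
  shows "graded X \<alpha> f \<otimes>\<^bsub>conv_monoid X\<^esub> graded X \<beta> g = graded X (\<alpha> + \<beta>) (conv X \<alpha> \<beta> f g)"
proof -
  have "graded X \<alpha> f \<otimes>\<^bsub>conv_monoid X\<^esub> graded X \<beta> g =
      graded X (\<alpha> + \<beta>) (conv X \<alpha> \<beta> (restrict f (carr X)) (restrict g (carr X)))"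
    by (simp add: conv_monoid_def graded_def)
  also have "\<dots> = graded X (\<alpha> + \<beta>) (conv X \<alpha> \<beta> f g)"
    unfolding graded_eq_iff by (auto intro!: conv_cong[OF assms])
  finally show ?thesis .
qed

lemma graded_closed: "linear_map X (H \<alpha>) f \<Longrightarrow> graded X \<alpha> f \<in> carrier (conv_monoid X)"
  by (auto simp: conv_monoid_simps)

lemma linear_const: "coalgebra X \<Longrightarrow> h \<in> carr (H \<alpha>) \<Longrightarrow> linear_map X (H \<alpha>) (\<lambda>x. scal (H \<alpha>) (counit X x) h)"
  by (rule linear_map_scale_left[OF vspace_H coalgebra.linear_counit])

lemma linear_unit_map: "coalgebra X \<Longrightarrow> linear_map X (H 0) (unit_map X)"
  unfolding unit_map_def by (rule linear_const[OF _ one_closed])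

lemma conv_unit:
  assumes "coalgebra X" "linear_map X (H \<alpha>) f" "x \<in> carr X"
  shows "conv X \<alpha> 0 f (unit_map X) x = f x" "conv X 0 \<alpha> (unit_map X) f x = f x"
  unfolding unit_map_def conv_const[OF assms one_closed]
  by (auto intro: unit_left unit_right linear_mapD(1)[OF assms(2,3)])

lemma monoid_conv: "coalgebra X \<Longrightarrow> monoid (conv_monoid X)"
proof (rule monoidI)
  assume X: "coalgebra X"
  show "\<one>\<^bsub>conv_monoid X\<^esub> \<in> carrier (conv_monoid X)"
    unfolding conv_monoid_simps(2) by (rule graded_closed[OF linear_unit_map[OF X]])
  fix a b c assume "a \<in> carrier (conv_monoid X)"
  then obtain \<alpha> f where a: "a = graded X \<alpha> f" "linear_map X (H \<alpha>) f" by (auto simp: conv_monoid_simps)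
  show "\<one>\<^bsub>conv_monoid X\<^esub> \<otimes>\<^bsub>conv_monoid X\<^esub> a = a"
    by (simp add: a conv_monoid_simps(2) graded_mult[OF X] graded_eq_iff conv_unit[OF X a(2)])
  show "a \<otimes>\<^bsub>conv_monoid X\<^esub> \<one>\<^bsub>conv_monoid X\<^esub> = a"
    by (simp add: a conv_monoid_simps(2) graded_mult[OF X] graded_eq_iff conv_unit[OF X a(2)])
  assume "b \<in> carrier (conv_monoid X)"
  then obtain \<beta> g where b: "b = graded X \<beta> g" "linear_map X (H \<beta>) g" by (auto simp: conv_monoid_simps)
  show "a \<otimes>\<^bsub>conv_monoid X\<^esub> b \<in> carrier (conv_monoid X)"
    unfolding a(1) b(1) graded_mult[OF X] by (rule graded_closed[OF linear_conv[OF X a(2) b(2)]])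
  assume "c \<in> carrier (conv_monoid X)"
  then obtain \<gamma> k where c: "c = graded X \<gamma> k" "linear_map X (H \<gamma>) k" by (auto simp: conv_monoid_simps)
  show "a \<otimes>\<^bsub>conv_monoid X\<^esub> b \<otimes>\<^bsub>conv_monoid X\<^esub> c = a \<otimes>\<^bsub>conv_monoid X\<^esub> (b \<otimes>\<^bsub>conv_monoid X\<^esub> c)"
    by (simp add: a b c graded_mult[OF X] graded_eq_iff add.assoc conv_assoc[OF X a(2) b(2) c(2)])
qed

end

section \<open>The group of coalgebra maps\<close>

context cocommutative_hopf_pi_algebra
begin

definition hom_group where
  "hom_group X = (conv_monoid X)\<lparr>carrier := {graded X \<alpha> f | \<alpha> f. coalgebra_hom X (H \<alpha>) f}\<rparr>"

lemma hom_group_simps: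
  "carrier (hom_group X) = {graded X \<alpha> f | \<alpha> f. coalgebra_hom X (H \<alpha>) f}"
  "\<one>\<^bsub>hom_group X\<^esub> = graded X 0 (unit_map X)"
  "a \<otimes>\<^bsub>hom_group X\<^esub> b = a \<otimes>\<^bsub>conv_monoid X\<^esub> b"
  by (simp_all add: hom_group_def conv_monoid_simps)

text \<open>Membership only says that some representative is a coalgebra map;
  \<open>coalgebra_hom_cong\<close> passes this to every map with the same values on the
  carrier.\<close>

lemma graded_in_hom_group:
  assumes "coalgebra X"
  shows "graded X \<alpha> f \<in> carrier (hom_group X) \<longleftrightarrow> coalgebra_hom X (H \<alpha>) f"
proof
  assume "graded X \<alpha> f \<in> carrier (hom_group X)"
  then obtain g where "coalgebra_hom X (H \<alpha>) g" "\<forall>x\<in>carr X. f x = g x"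
    by (auto simp: hom_group_simps graded_eq_iff)
  then show "coalgebra_hom X (H \<alpha>) f" using coalgebra_hom_cong[OF assms] by metis
qed (auto simp: hom_group_simps)

lemma coalgebra_hom_unit_map:
  assumes "coalgebra X"
  shows "coalgebra_hom X (H 0) (unit_map X)"
  unfolding coalgebra_hom_def
proof (intro conjI ballI)
  interpret coalgebra X by fact
  note o = bilinear_mapD(3)[OF bilinear_pure one_closed one_closed]
  note p1 = linear_mapD(3)[OF bilinear_mapD(1)[OF bilinear_pure]]
    and p2 = linear_mapD(3)[OF bilinear_mapD(2)[OF bilinear_pure]]
  show "linear_map X (H 0) (unit_map X)" by (rule linear_unit_map[OF assms])
  fix h assume h: "h \<in> carr X"
  show "counit (H 0) (unit_map X h) = counit X h"
    by (simp add: unit_map_def coalgebra.counit_scale[OF coalgebra] one_closed one_grouplike)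
  have "comult (H 0) (unit_map X h) = scal (HH 0) (counit X h) (pure 0 one one)"
    by (simp add: unit_map_def linear_mapD(3)[OF coalgebra.linear_comult[OF coalgebra]] one_closed one_grouplike)
  also have "\<dots> = sweedler2 X (\<lambda>x y. scal (HH 0) (counit X x) (scal (HH 0) (counit X y) (pure 0 one one))) h"
    by (rule sweedler2_counit(1)[OF linear_map_scale_left[OF vspace_tensor_space linear_counit o] h, symmetric])
  also have "\<dots> = sweedler2 X (\<lambda>x y. pure 0 (unit_map X x) (unit_map X y)) h"
    by (rule comultiplication.sweedler2_cong[OF comultiplication_axioms h])
      (simp add: unit_map_def p1 p2 one_closed vspaceD(3)[OF vspace_H] vspace_scale_commute[OF vspace_tensor_space])
  finally show "comult (H 0) (unit_map X h) = \<dots>" .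
qed

text \<open>The legs of \<open>f x\<close> are the images of those of \<open>x\<close> and the
  counit of \<open>f x\<close> is that of \<open>x\<close>, so the antipode law at
  \<open>f x\<close> says that \<open>S f\<close> is the convolution inverse of
  \<open>f\<close>.\<close>

lemma antipode_comp:
  assumes X: "coalgebra X" and f: "coalgebra_hom X (H \<alpha>) f"
  shows "coalgebra_hom X (H (- \<alpha>)) (\<lambda>x. S \<alpha> (f x))"
    and "graded X (- \<alpha>) (\<lambda>x. S \<alpha> (f x)) \<otimes>\<^bsub>conv_monoid X\<^esub> graded X \<alpha> f = \<one>\<^bsub>conv_monoid X\<^esub>"
    and "graded X \<alpha> f \<otimes>\<^bsub>conv_monoid X\<^esub> graded X (- \<alpha>) (\<lambda>x. S \<alpha> (f x)) = \<one>\<^bsub>conv_monoid X\<^esub>"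
proof -
  interpret coalgebra X by fact
  note fc = coalgebra_homD[OF f] and bl = bilinear_map_comp[OF bilinear_mult]
  show "coalgebra_hom X (H (- \<alpha>)) (\<lambda>x. S \<alpha> (f x))"
    by (rule coalgebra_hom_comp[OF X vspace_H vspace_H f coalgebra_hom_antipode])
  have "conv X (- \<alpha>) \<alpha> (\<lambda>x. S \<alpha> (f x)) f x = unit_map X x"
    "conv X \<alpha> (- \<alpha>) f (\<lambda>x. S \<alpha> (f x)) x = unit_map X x" if x: "x \<in> carr X" for x
    using sweedler2_hom[OF vspace_H vspace_H f bl[OF linear_antipode linear_map_id] x]
      sweedler2_hom[OF vspace_H vspace_H f bl[OF linear_map_id linear_antipode] x]
    by (simp_all add: conv_def unit_map_def antipode_left antipode_right fc x)
  then show "graded X (- \<alpha>) (\<lambda>x. S \<alpha> (f x)) \<otimes>\<^bsub>conv_monoid X\<^esub> graded X \<alpha> f = \<one>\<^bsub>conv_monoid X\<^esub>"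
    "graded X \<alpha> f \<otimes>\<^bsub>conv_monoid X\<^esub> graded X (- \<alpha>) (\<lambda>x. S \<alpha> (f x)) = \<one>\<^bsub>conv_monoid X\<^esub>"
    by (simp_all add: graded_mult[OF X] conv_monoid_simps(2) graded_eq_iff)
qed

lemma group_hom_group:
  assumes X: "coalgebra X" and cc: "Defs.cocommutative X"
  shows "group (hom_group X)"
proof (rule groupI)
  interpret M: monoid "conv_monoid X" by (rule monoid_conv[OF X])
  note l = graded_closed[OF coalgebra_homD(1)]
  show "\<one>\<^bsub>hom_group X\<^esub> \<in> carrier (hom_group X)"
    by (simp add: hom_group_simps(2) graded_in_hom_group[OF X] coalgebra_hom_unit_map[OF X])
  fix a b c assume "a \<in> carrier (hom_group X)"
  then obtain \<alpha> f where a: "a = graded X \<alpha> f" "coalgebra_hom X (H \<alpha>) f" by (auto simp: hom_group_simps)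
  show "\<one>\<^bsub>hom_group X\<^esub> \<otimes>\<^bsub>hom_group X\<^esub> a = a"
    using M.l_one[OF l[OF a(2)]] by (simp add: a hom_group_simps conv_monoid_simps)
  show "\<exists>y\<in>carrier (hom_group X). y \<otimes>\<^bsub>hom_group X\<^esub> a = \<one>\<^bsub>hom_group X\<^esub>"
    using antipode_comp[OF X a(2)]
    by (intro bexI[of _ "graded X (- \<alpha>) (\<lambda>x. S \<alpha> (f x))"])
      (simp_all add: a graded_in_hom_group[OF X] hom_group_simps(2,3) conv_monoid_simps(2))
  assume "b \<in> carrier (hom_group X)"
  then obtain \<beta> g where b: "b = graded X \<beta> g" "coalgebra_hom X (H \<beta>) g" by (auto simp: hom_group_simps)
  show "a \<otimes>\<^bsub>hom_group X\<^esub> b \<in> carrier (hom_group X)"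
    unfolding a(1) b(1) hom_group_simps(3) graded_mult[OF X] graded_in_hom_group[OF X]
    by (rule coalgebra_hom_conv[OF X cc a(2) b(2)])
  assume "c \<in> carrier (hom_group X)"
  then obtain \<gamma> k where c: "c = graded X \<gamma> k" "coalgebra_hom X (H \<gamma>) k" by (auto simp: hom_group_simps)
  show "a \<otimes>\<^bsub>hom_group X\<^esub> b \<otimes>\<^bsub>hom_group X\<^esub> c = a \<otimes>\<^bsub>hom_group X\<^esub> (b \<otimes>\<^bsub>hom_group X\<^esub> c)"
    unfolding a(1) b(1) c(1) hom_group_simps(3) by (rule M.m_assoc[OF l[OF a(2)] l[OF b(2)] l[OF c(2)]])
qed

lemma inv_graded:
  assumes X: "coalgebra X" and cc: "Defs.cocommutative X" and f: "coalgebra_hom X (H \<alpha>) f"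
  shows "inv\<^bsub>hom_group X\<^esub> (graded X \<alpha> f) = graded X (- \<alpha>) (\<lambda>x. S \<alpha> (f x))"
  by (rule group.inv_equality[OF group_hom_group[OF X cc]])
    (use antipode_comp[OF X f] f in \<open>simp_all add: graded_in_hom_group[OF X] hom_group_simps(2,3) conv_monoid_simps(2)\<close>)

end

section \<open>The brace of a Rota-Baxter Hopf algebra\<close>

context rota_baxter_hopf_pi_algebra
begin

section \<open>The circle product as a convolution product\<close>

abbreviation "circ \<equiv> rb_circ H m S B"

text \<open>Grouping the first two legs leaves an expression in two legs: \<open>g \<circ> h\<close>
  is \<open>A(g_1) h R(g_2)\<close>, where \<open>A\<close> is \<open>left_factor \<alpha>\<close>,
  with values in degree \<open>0\<close>, and \<open>R\<close> is
  \<open>right_factor \<alpha>\<close>, with values in degree \<open>\<alpha>\<close>.\<close>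

definition left_factor where "left_factor \<alpha> = conv (H \<alpha>) \<alpha> (- \<alpha>) (\<lambda>x. x) (B \<alpha>)"
definition right_factor where "right_factor \<alpha> x = S (- \<alpha>) (B \<alpha> x)"

lemma linear_rb: "linear_map (H \<alpha>) (H (- \<alpha>)) (B \<alpha>)"
  by (rule coalgebra_homD(1)[OF coalgebra_hom_rb])

lemma linear_left_factor: "linear_map (H \<alpha>) (H 0) (left_factor \<alpha>)"
  using linear_conv[OF coalgebra linear_map_id linear_rb] unfolding left_factor_def by simp

lemma linear_right_factor: "linear_map (H \<alpha>) (H \<alpha>) (right_factor \<alpha>)"
  using linear_map_comp[OF linear_antipode linear_rb, of \<alpha>] unfolding right_factor_def by simp

text \<open>The product lands in degree \<open>\<beta> + \<alpha>\<close>, while a multiplication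
  must have degree \<open>\<alpha> + \<beta>\<close>; commutativity of the group of degrees
  reconciles the two.\<close>

lemma linear_circ_integrand:
  "linear_map X (H \<alpha>) f \<Longrightarrow> h \<in> carr (H \<beta>) \<Longrightarrow> z \<in> carr (H \<alpha>) \<Longrightarrow>
    linear_map X (H (\<alpha> + \<beta>)) (\<lambda>x. m \<beta> \<alpha> (m 0 \<beta> (left_factor \<alpha> (f x)) h) (right_factor \<alpha> z))"
  "linear_map X (H \<beta>) g \<Longrightarrow> x \<in> carr (H \<alpha>) \<Longrightarrow> z \<in> carr (H \<alpha>) \<Longrightarrow>
    linear_map X (H (\<alpha> + \<beta>)) (\<lambda>h. m \<beta> \<alpha> (m 0 \<beta> (left_factor \<alpha> x) (g h)) (right_factor \<alpha> z))"
  "linear_map X (H \<alpha>) f \<Longrightarrow> x \<in> carr (H \<alpha>) \<Longrightarrow> h \<in> carr (H \<beta>) \<Longrightarrow>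
    linear_map X (H (\<alpha> + \<beta>)) (\<lambda>z. m \<beta> \<alpha> (m 0 \<beta> (left_factor \<alpha> x) h) (right_factor \<alpha> (f z)))"
  using linear_mapD(1)[OF linear_left_factor] linear_mapD(1)[OF linear_right_factor]
  by (auto intro!: linear_mult linear_map_comp[OF linear_left_factor]
      linear_map_comp[OF linear_right_factor] mult_closed simp: add.commute)

lemma circ_eq:
  assumes g: "g \<in> carr (H \<alpha>)" and h: "h \<in> carr (H \<beta>)"
  shows "circ \<alpha> \<beta> g h = sweedler2 (H \<alpha>) (\<lambda>x z. m \<beta> \<alpha> (m 0 \<beta> (left_factor \<alpha> x) h) (right_factor \<alpha> z)) g"
  unfolding rb_circ_def sweedler3_def
proof (rule comultiplication.sweedler2_cong[OF comultiplication_H g])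
  interpret coalgebra "H \<alpha>" by (rule coalgebra)
  fix x z assume x: "x \<in> carr (H \<alpha>)" and z: "z \<in> carr (H \<alpha>)"
  have z': "right_factor \<alpha> z \<in> carr (H \<alpha>)" by (rule linear_mapD(1)[OF linear_right_factor z])
  have L: "linear_map (H 0) (H (\<beta> + \<alpha>)) (\<lambda>y. m \<beta> \<alpha> (m 0 \<beta> y h) (right_factor \<alpha> z))"
    by (rule linear_mult linear_map_id z' h refl | simp)+
  have "m \<alpha> (- \<alpha>) a (B \<alpha> b) \<in> carr (H 0)" if "a \<in> carr (H \<alpha>)" "b \<in> carr (H \<alpha>)" for a b
    by (rule mult_closed[OF that(1) linear_mapD(1)[OF linear_rb that(2)]]) simp
  from linear_map_of_sweedler2[OF L vspace_H x this]
  show "sweedler2 (H \<alpha>) (\<lambda>x y. m \<beta> \<alpha> (m 0 \<beta> (m \<alpha> (- \<alpha>) x (B \<alpha> y)) h) (S (- \<alpha>) (B \<alpha> z))) x =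
      m \<beta> \<alpha> (m 0 \<beta> (left_factor \<alpha> x) h) (right_factor \<alpha> z)"
    by (simp add: left_factor_def conv_def right_factor_def)
qed

lemma bilinear_circ: "bilinear_map (H \<alpha>) (H \<beta>) (H (\<alpha> + \<beta>)) (circ \<alpha> \<beta>)"
proof (rule bilinear_mapI)
  interpret coalgebra "H \<alpha>" by (rule coalgebra)
  note ci = linear_circ_integrand[OF linear_map_id]
  fix g assume g: "g \<in> carr (H \<alpha>)"
  show "linear_map (H \<beta>) (H (\<alpha> + \<beta>)) (circ \<alpha> \<beta> g)"
    by (rule linear_map_cong[OF vspace_H _ circ_eq[OF g]])
      (intro linear_map_sweedler2_param vspace_H g ci)
next
  interpret coalgebra "H \<alpha>" by (rule coalgebra)
  note ci = linear_circ_integrand[OF linear_map_id]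
  fix h assume h: "h \<in> carr (H \<beta>)"
  show "linear_map (H \<alpha>) (H (\<alpha> + \<beta>)) (\<lambda>g. circ \<alpha> \<beta> g h)"
    by (rule linear_map_cong[OF vspace_H _ circ_eq[OF _ h]])
      (intro linear_map_sweedler2 bilinear_mapI vspace_H h ci)
qed

text \<open>The generic case of the formula for \<open>g \<circ> h\<close>: the coproduct of \<open>f x\<close> is spread over
  that of \<open>x\<close>, and cocommutativity restores the order of the factors.\<close>

lemma graded_circ:
  assumes X: "coalgebra X" and cc: "Defs.cocommutative X"
    and f: "coalgebra_hom X (H \<alpha>) f" and g: "linear_map X (H \<beta>) g"
  shows "graded X \<alpha> f \<otimes>\<^bsub>conv_monoid X\<^esub> graded X (- \<alpha>) (\<lambda>x. B \<alpha> (f x)) \<otimes>\<^bsub>conv_monoid X\<^esub>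
      graded X \<beta> g \<otimes>\<^bsub>conv_monoid X\<^esub> graded X \<alpha> (\<lambda>x. S (- \<alpha>) (B \<alpha> (f x))) =
    graded X (\<alpha> + \<beta>) (sweedler2 X (\<lambda>x y. circ \<alpha> \<beta> (f x) (g y)))"
proof -
  interpret coalgebra X by fact
  note fl = coalgebra_homD(1)[OF f]
  note fc = linear_mapD(1)[OF fl] and gc = linear_mapD(1)[OF g]
  let ?F = "\<lambda>x y z. m \<beta> \<alpha> (m 0 \<beta> (left_factor \<alpha> (f x)) (g y)) (right_factor \<alpha> (f z))"
  let ?A = "conv X \<alpha> (- \<alpha>) f (\<lambda>x. B \<alpha> (f x))"
  have A: "?A x = left_factor \<alpha> (f x)" if "x \<in> carr X" for x
    using sweedler2_hom[OF vspace_H vspace_H f bilinear_conv[OF linear_map_id linear_rb] that]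
    by (simp add: conv_def left_factor_def)
  have F: "trilinear_map X X X (H (\<alpha> + \<beta>)) ?F"
    by (intro trilinear_mapI linear_circ_integrand fl g fc gc)
  have "conv X \<beta> \<alpha> (conv X 0 \<beta> ?A g) (\<lambda>x. S (- \<alpha>) (B \<alpha> (f x))) h =
      sweedler2 X (\<lambda>x y. circ \<alpha> \<beta> (f x) (g y)) h" if h: "h \<in> carr X" for h
  proof -
    have "conv X \<beta> \<alpha> (conv X 0 \<beta> ?A g) (\<lambda>x. S (- \<alpha>) (B \<alpha> (f x))) h =
        sweedler2 X (\<lambda>x z. sweedler2 X (\<lambda>x y. ?F x y z) x) h"
      unfolding conv_def[of X \<beta> \<alpha>]
    proof (rule comultiplication.sweedler2_cong[OF comultiplication_axioms h])
      fix x z assume x: "x \<in> carr X" and z: "z \<in> carr X"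
      have z': "right_factor \<alpha> (f z) \<in> carr (H \<alpha>)" by (rule linear_mapD(1)[OF linear_right_factor fc[OF z]])
      have L: "linear_map (H \<beta>) (H (\<beta> + \<alpha>)) (\<lambda>y. m \<beta> \<alpha> y (right_factor \<alpha> (f z)))"
        by (rule linear_mult(1)[OF linear_map_id z' refl])
      have "conv X 0 \<beta> ?A g x = sweedler2 X (\<lambda>x y. m 0 \<beta> (left_factor \<alpha> (f x)) (g y)) x"
        unfolding conv_def[of X 0 \<beta>]
        by (rule comultiplication.sweedler2_cong[OF comultiplication_axioms x]) (simp only: A)
      moreover have "m \<beta> \<alpha> (sweedler2 X (\<lambda>x y. m 0 \<beta> (left_factor \<alpha> (f x)) (g y)) x) (right_factor \<alpha> (f z)) =
          sweedler2 X (\<lambda>x y. ?F x y z) x"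
        by (rule linear_map_of_sweedler2[OF L vspace_H x])
          (simp add: mult_closed linear_mapD(1)[OF linear_left_factor] fc gc)
      ultimately show "m \<beta> \<alpha> (conv X 0 \<beta> ?A g x) (S (- \<alpha>) (B \<alpha> (f z))) = sweedler2 X (\<lambda>x y. ?F x y z) x"
        by (simp add: right_factor_def)
    qed
    also have "\<dots> = sweedler2 X (\<lambda>x z. sweedler2 X (\<lambda>x y. ?F x z y) x) h"
      by (rule sweedler2_cyclic[OF cc vspace_H F h])
    also have "\<dots> = sweedler2 X (\<lambda>x y. circ \<alpha> \<beta> (f x) (g y)) h"
    proof (rule comultiplication.sweedler2_cong[OF comultiplication_axioms h])
      fix x y assume x: "x \<in> carr X" and y: "y \<in> carr X"
      have "bilinear_map (H \<alpha>) (H \<alpha>) (H (\<alpha> + \<beta>))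
          (\<lambda>x z. m \<beta> \<alpha> (m 0 \<beta> (left_factor \<alpha> x) (g y)) (right_factor \<alpha> z))"
        by (intro bilinear_mapI linear_circ_integrand[OF linear_map_id] gc y)
      from sweedler2_hom[OF vspace_H vspace_H f this x]
      show "sweedler2 X (\<lambda>x z. ?F x y z) x = circ \<alpha> \<beta> (f x) (g y)"
        by (simp add: circ_eq fc gc x y)
    qed
    finally show ?thesis .
  qed
  then show ?thesis
    by (simp add: graded_mult[OF X] graded_eq_iff add.commute)
qed

section \<open>The Rota-Baxter operator on the group of coalgebra maps\<close>

definition rb_map where "rb_map X a = graded X (- fst a) (\<lambda>x. B (fst a) (snd a x))"

lemma rb_map_graded: "rb_map X (graded X \<alpha> f) = graded X (- \<alpha>) (\<lambda>x. B \<alpha> (f x))"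
  by (simp add: rb_map_def graded_def restrict_def fun_eq_iff)

lemma coalgebra_hom_rb_comp:
  "coalgebra X \<Longrightarrow> coalgebra_hom X (H \<alpha>) f \<Longrightarrow> coalgebra_hom X (H (- \<alpha>)) (\<lambda>x. B \<alpha> (f x))"
  by (rule coalgebra_hom_comp[OF _ vspace_H vspace_H _ coalgebra_hom_rb])

lemma hom_group_circ:
  assumes X: "coalgebra X" and cc: "Defs.cocommutative X"
    and f: "coalgebra_hom X (H \<alpha>) f" and g: "coalgebra_hom X (H \<beta>) g"
  shows "graded X \<alpha> f \<otimes>\<^bsub>hom_group X\<^esub> rb_map X (graded X \<alpha> f) \<otimes>\<^bsub>hom_group X\<^esub>
      graded X \<beta> g \<otimes>\<^bsub>hom_group X\<^esub> inv\<^bsub>hom_group X\<^esub> (rb_map X (graded X \<alpha> f)) =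
    graded X (\<alpha> + \<beta>) (sweedler2 X (\<lambda>x y. circ \<alpha> \<beta> (f x) (g y)))"
  using graded_circ[OF X cc f coalgebra_homD(1)[OF g]]
  by (simp add: rb_map_graded inv_graded[OF X cc coalgebra_hom_rb_comp[OF X f]] hom_group_simps(3))

text \<open>The Rota-Baxter identity at \<open>f x\<close> and \<open>g y\<close>, summed over the
  legs \<open>x\<close>, \<open>y\<close> of \<open>h\<close>. One side becomes a product in the
  group; on the other, linearity pulls \<open>B\<close> out of the sum, which
  \<open>hom_group_circ\<close> identifies with the group expression.\<close>

lemma rota_baxter_hom_group:
  assumes X: "coalgebra X" and cc: "Defs.cocommutative X"
  shows "rota_baxter_group (hom_group X) (rb_map X)"
proof (intro rota_baxter_group.intro rota_baxter_group_axioms.intro group_hom_group[OF X cc])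
  interpret coalgebra X by fact
  fix a b assume "a \<in> carrier (hom_group X)"
  then obtain \<alpha> f where a: "a = graded X \<alpha> f" "coalgebra_hom X (H \<alpha>) f" by (auto simp: hom_group_simps)
  note fc = coalgebra_homD(2)[OF a(2)]
  show "rb_map X a \<in> carrier (hom_group X)"
    by (simp add: a rb_map_graded graded_in_hom_group[OF X] coalgebra_hom_rb_comp[OF X])
  assume "b \<in> carrier (hom_group X)"
  then obtain \<beta> g where b: "b = graded X \<beta> g" "coalgebra_hom X (H \<beta>) g" by (auto simp: hom_group_simps)
  note gc = coalgebra_homD(2)[OF b(2)]
  have "conv X (- \<alpha>) (- \<beta>) (\<lambda>x. B \<alpha> (f x)) (\<lambda>x. B \<beta> (g x)) h =
      B (\<alpha> + \<beta>) (sweedler2 X (\<lambda>x y. circ \<alpha> \<beta> (f x) (g y)) h)" if h: "h \<in> carr X" for h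
  proof -
    have "conv X (- \<alpha>) (- \<beta>) (\<lambda>x. B \<alpha> (f x)) (\<lambda>x. B \<beta> (g x)) h =
        sweedler2 X (\<lambda>x y. B (\<alpha> + \<beta>) (circ \<alpha> \<beta> (f x) (g y))) h"
      unfolding conv_def
      by (rule comultiplication.sweedler2_cong[OF comultiplication_axioms h])
        (simp add: rota_baxter fc gc add.commute)
    also have "\<dots> = B (\<alpha> + \<beta>) (sweedler2 X (\<lambda>x y. circ \<alpha> \<beta> (f x) (g y)) h)"
      by (rule linear_map_of_sweedler2[OF linear_rb vspace_H h, symmetric])
        (intro bilinear_mapD(3)[OF bilinear_circ] fc gc)
    finally show ?thesis .
  qed
  then show "rb_map X a \<otimes>\<^bsub>hom_group X\<^esub> rb_map X b = rb_map X (a \<otimes>\<^bsub>hom_group X\<^esub> rb_map X a \<otimes>\<^bsub>hom_group X\<^esub> b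
      \<otimes>\<^bsub>hom_group X\<^esub> inv\<^bsub>hom_group X\<^esub> (rb_map X a))"
    unfolding a(1) b(1) hom_group_circ[OF X cc a(2) b(2)]
    unfolding rb_map_graded hom_group_simps(3) graded_mult[OF X]
    by (simp add: graded_eq_iff)
qed

abbreviation "group_circ X \<equiv> rota_baxter_group.circ (hom_group X) (rb_map X)"

text \<open>The second claim takes no computation of coproducts: the group is closed under its
  circle operation, and its elements are coalgebra maps.\<close>

lemma group_circ_graded:
  assumes X: "coalgebra X" and cc: "Defs.cocommutative X"
    and f: "coalgebra_hom X (H \<alpha>) f" and g: "coalgebra_hom X (H \<beta>) g"
  shows "group_circ X (graded X \<alpha> f) (graded X \<beta> g) =
      graded X (\<alpha> + \<beta>) (sweedler2 X (\<lambda>x y. circ \<alpha> \<beta> (f x) (g y)))"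
    and "coalgebra_hom X (H (\<alpha> + \<beta>)) (sweedler2 X (\<lambda>x y. circ \<alpha> \<beta> (f x) (g y)))"
proof -
  interpret G: rota_baxter_group "hom_group X" "rb_map X" by (rule rota_baxter_hom_group[OF X cc])
  show 1: "group_circ X (graded X \<alpha> f) (graded X \<beta> g) =
      graded X (\<alpha> + \<beta>) (sweedler2 X (\<lambda>x y. circ \<alpha> \<beta> (f x) (g y)))"
    unfolding G.circ_def by (rule hom_group_circ[OF assms])
  show "coalgebra_hom X (H (\<alpha> + \<beta>)) (sweedler2 X (\<lambda>x y. circ \<alpha> \<beta> (f x) (g y)))"
    using G.circ_closed[of "graded X \<alpha> f" "graded X \<beta> g"] unfolding 1
    by (simp add: graded_in_hom_group[OF X] f g)
qed

section \<open>The Hopf axioms for the circle product\<close>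

lemma coalgebra_hom_circ:
  "coalgebra_hom (tensor_coalgebra (H \<alpha>) (H \<beta>)) (H (\<alpha> + \<beta>)) (lift (H \<alpha>) (H \<beta>) (circ \<alpha> \<beta>))"
proof -
  interpret T: coalgebra_pair "H \<alpha>" "H \<beta>" by (rule coalgebra_pair_H)
  \<comment> \<open>The circle product of the two projections is the lift of \<open>circ\<close>,
    and as an element of the group it is a coalgebra map.\<close>
  show ?thesis
    by (rule coalgebra_hom_cong[OF T.coalgebra_T group_circ_graded(2)[OF T.coalgebra_T
          T.cocommutative_T[OF cocommutative cocommutative] T.coalgebra_hom_proj1 T.coalgebra_hom_proj2]])
      (rule T.sweedler2_proj1_proj2[OF vspace_H bilinear_circ, symmetric])
qed

text \<open>Associativity in the Rota-Baxter group of coalgebra maps from the triple tensor product,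
  taken at the three projections and evaluated at \<open>a \<otimes> b \<otimes> c\<close>.\<close>

lemma circ_assoc:
  assumes a: "a \<in> carr (H \<alpha>)" and b: "b \<in> carr (H \<beta>)" and c: "c \<in> carr (H \<gamma>)"
  shows "circ (\<alpha> + \<beta>) \<gamma> (circ \<alpha> \<beta> a b) c = circ \<alpha> (\<beta> + \<gamma>) a (circ \<beta> \<gamma> b c)"
proof -
  interpret CD: coalgebra_pair "H \<alpha>" "H \<beta>" by (rule coalgebra_pair_H)
  interpret TE: coalgebra_pair "tensor_coalgebra (H \<alpha>) (H \<beta>)" "H \<gamma>"
    by (intro coalgebra_pair.intro CD.coalgebra_T coalgebra)
  interpret coalgebra_triple "H \<alpha>" "H \<beta>" "H \<gamma>" ..
  let ?X = "TE.T" and ?p = "\<lambda>x. CD.proj1 (TE.proj1 x)" and ?q = "\<lambda>x. CD.proj2 (TE.proj1 x)" and ?r = "TE.proj2"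
  have X: "coalgebra ?X" and cc: "Defs.cocommutative ?X"
    by (intro TE.coalgebra_T TE.cocommutative_T CD.cocommutative_T cocommutative)+
  interpret X: coalgebra ?X by (rule X)
  interpret G: rota_baxter_group "hom_group ?X" "rb_map ?X" by (rule rota_baxter_hom_group[OF X cc])
  have p: "coalgebra_hom ?X (H \<alpha>) ?p" and q: "coalgebra_hom ?X (H \<beta>) ?q" and r: "coalgebra_hom ?X (H \<gamma>) ?r"
    by (rule coalgebra_hom_comp[OF X CD.T.vspace vspace_H TE.coalgebra_hom_proj1 CD.coalgebra_hom_proj1]
        coalgebra_hom_comp[OF X CD.T.vspace vspace_H TE.coalgebra_hom_proj1 CD.coalgebra_hom_proj2]
        TE.coalgebra_hom_proj2)+
  note pc = coalgebra_homD(2)[OF p] and qc = coalgebra_homD(2)[OF q] and rc = coalgebra_homD(2)[OF r]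
  note pl = coalgebra_homD(1)[OF p] and ql = coalgebra_homD(1)[OF q] and rl = coalgebra_homD(1)[OF r]
  note k = bilinear_circ
  let ?t = "pure_tensor CD.T (H \<gamma>) (pure_tensor (H \<alpha>) (H \<beta>) a b) c"
  have t: "?t \<in> carr ?X" by (intro TE.pure_closed CD.pure_closed a b c)
  have L: "trilinear_map (H \<alpha>) (H \<beta>) (H \<gamma>) (H (\<alpha> + \<beta> + \<gamma>)) (\<lambda>a b c. circ (\<alpha> + \<beta>) \<gamma> (circ \<alpha> \<beta> a b) c)"
    by (intro trilinear_mapI bilinear_mapD(1)[OF k] linear_map_comp[OF bilinear_mapD(2)[OF k]]
        bilinear_mapD(2)[OF k] bilinear_mapD(3)[OF k])
  have R: "trilinear_map (H \<alpha>) (H \<beta>) (H \<gamma>) (H (\<alpha> + (\<beta> + \<gamma>))) (\<lambda>a b c. circ \<alpha> (\<beta> + \<gamma>) a (circ \<beta> \<gamma> b c))"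
    by (intro trilinear_mapI bilinear_mapD(2)[OF k] linear_map_comp[OF bilinear_mapD(1)[OF k]]
        bilinear_mapD(1)[OF k] bilinear_mapD(3)[OF k])
  have R': "trilinear_map ?X ?X ?X (H (\<alpha> + (\<beta> + \<gamma>))) (\<lambda>x y z. circ \<alpha> (\<beta> + \<gamma>) (?p x) (circ \<beta> \<gamma> (?q y) (?r z)))"
    by (intro trilinear_mapI linear_map_comp[OF trilinear_mapD(1)[OF R] pl]
        linear_map_comp[OF trilinear_mapD(2)[OF R] ql] linear_map_comp[OF trilinear_mapD(3)[OF R] rl] pc qc rc)
  have "graded ?X \<alpha> ?p \<in> carrier (hom_group ?X)" "graded ?X \<beta> ?q \<in> carrier (hom_group ?X)"
    "graded ?X \<gamma> ?r \<in> carrier (hom_group ?X)"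
    by (simp_all only: graded_in_hom_group[OF X] p q r)
  \<comment> \<open>Equal pairs have maps that agree on the carrier, in particular at
    \<open>?t\<close>. The nested circle products unfold because the inner ones are coalgebra
    maps.\<close>
  from G.circ_assoc[OF this]
  have eq: "sweedler2 ?X (\<lambda>x z. circ (\<alpha> + \<beta>) \<gamma> (sweedler2 ?X (\<lambda>x y. circ \<alpha> \<beta> (?p x) (?q y)) x) (?r z)) ?t =
    sweedler2 ?X (\<lambda>x y. circ \<alpha> (\<beta> + \<gamma>) (?p x) (sweedler2 ?X (\<lambda>y z. circ \<beta> \<gamma> (?q y) (?r z)) y)) ?t"
    unfolding group_circ_graded(1)[OF X cc p q] group_circ_graded(1)[OF X cc q r]
      group_circ_graded(1)[OF X cc group_circ_graded(2)[OF X cc p q] r]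
      group_circ_graded(1)[OF X cc p group_circ_graded(2)[OF X cc q r]] graded_eq_iff
    using t by blast
  have "circ (\<alpha> + \<beta>) \<gamma> (circ \<alpha> \<beta> a b) c =
      sweedler2 ?X (\<lambda>x z. sweedler2 ?X (\<lambda>x y. circ (\<alpha> + \<beta>) \<gamma> (circ \<alpha> \<beta> (?p x) (?q y)) (?r z)) x) ?t"
    by (rule sweedler2_triple[OF vspace_H L a b c, symmetric])
  also have "\<dots> = sweedler2 ?X (\<lambda>x z. circ (\<alpha> + \<beta>) \<gamma> (sweedler2 ?X (\<lambda>x y. circ \<alpha> \<beta> (?p x) (?q y)) x) (?r z)) ?t"
    by (rule comultiplication.sweedler2_cong[OF TE.T.comultiplication_axioms t],
        rule TE.T.linear_map_of_sweedler2[OF bilinear_mapD(2)[OF k] vspace_H, symmetric])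
      (assumption | rule rc bilinear_mapD(3)[OF k] pc qc)+
  also have "\<dots> = sweedler2 ?X (\<lambda>x y. circ \<alpha> (\<beta> + \<gamma>) (?p x) (sweedler2 ?X (\<lambda>y z. circ \<beta> \<gamma> (?q y) (?r z)) y)) ?t"
    by (rule eq)
  also have "\<dots> = sweedler2 ?X (\<lambda>x y. sweedler2 ?X (\<lambda>y z. circ \<alpha> (\<beta> + \<gamma>) (?p x) (circ \<beta> \<gamma> (?q y) (?r z))) y) ?t"
    by (rule comultiplication.sweedler2_cong[OF TE.T.comultiplication_axioms t],
        rule TE.T.linear_map_of_sweedler2[OF bilinear_mapD(1)[OF k] vspace_H])
      (assumption | rule pc bilinear_mapD(3)[OF k] qc rc)+
  \<comment> \<open>The group identity splits the second leg here, whereas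
    \<open>sweedler2_triple\<close> expects the first leg to be split.\<close>
  also have "\<dots> = sweedler2 ?X (\<lambda>x z. sweedler2 ?X (\<lambda>x y. circ \<alpha> (\<beta> + \<gamma>) (?p x) (circ \<beta> \<gamma> (?q y) (?r z))) x) ?t"
    by (rule X.sweedler2_coassoc[OF vspace_H R' t, symmetric])
  also have "\<dots> = circ \<alpha> (\<beta> + \<gamma>) a (circ \<beta> \<gamma> b c)"
    by (rule sweedler2_triple[OF vspace_H R a b c])
  finally show ?thesis .
qed

lemma coalgebra_hom_id: "coalgebra_hom (H \<alpha>) (H \<alpha>) (\<lambda>x. x)"
  by (simp add: coalgebra_hom_def linear_map_id comultiplication.comult_eq_sweedler2[OF comultiplication_H])

text \<open>The unit laws of the group, taken at the identity map. The scalars in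
  \<open>unit_map\<close> come out of \<open>circ\<close> by bilinearity, and the counit law absorbs
  them.\<close>

lemma circ_unit:
  assumes a: "a \<in> carr (H \<alpha>)"
  shows "circ 0 \<alpha> one a = a" "circ \<alpha> 0 a one = a"
proof -
  interpret coalgebra "H \<alpha>" by (rule coalgebra)
  interpret G: rota_baxter_group "hom_group (H \<alpha>)" "rb_map (H \<alpha>)"
    by (rule rota_baxter_hom_group[OF coalgebra cocommutative])
  note u = coalgebra_hom_unit_map[OF coalgebra, of \<alpha>]
  have i: "graded (H \<alpha>) \<alpha> (\<lambda>x. x) \<in> carrier (hom_group (H \<alpha>))"
    by (simp add: graded_in_hom_group[OF coalgebra] coalgebra_hom_id)
  have "sweedler2 (H \<alpha>) (\<lambda>x y. circ 0 \<alpha> (unit_map (H \<alpha>) x) y) a = a"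
    using G.circ_one(1)[OF i] a
    by (simp add: hom_group_simps(2) group_circ_graded(1)[OF coalgebra cocommutative u coalgebra_hom_id] graded_eq_iff)
  moreover have "sweedler2 (H \<alpha>) (\<lambda>x y. circ 0 \<alpha> (unit_map (H \<alpha>) x) y) a =
      sweedler2 (H \<alpha>) (\<lambda>x y. scal (H (0 + \<alpha>)) (counit (H \<alpha>) x) (circ 0 \<alpha> one y)) a"
    unfolding unit_map_def
    by (rule comultiplication.sweedler2_cong[OF comultiplication_H a],
        rule linear_mapD(3)[OF bilinear_mapD(2)[OF bilinear_circ] one_closed])
  ultimately show "circ 0 \<alpha> one a = a"
    using sweedler2_counit(1)[OF bilinear_mapD(1)[OF bilinear_circ one_closed] a] by simp
  have "sweedler2 (H \<alpha>) (\<lambda>x y. circ \<alpha> 0 x (unit_map (H \<alpha>) y)) a = a"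
    using G.circ_one(2)[OF i] a
    by (simp add: hom_group_simps(2) group_circ_graded(1)[OF coalgebra cocommutative coalgebra_hom_id u] graded_eq_iff)
  moreover have "sweedler2 (H \<alpha>) (\<lambda>x y. circ \<alpha> 0 x (unit_map (H \<alpha>) y)) a =
      sweedler2 (H \<alpha>) (\<lambda>x y. scal (H (\<alpha> + 0)) (counit (H \<alpha>) y) (circ \<alpha> 0 x one)) a"
    unfolding unit_map_def
    by (rule comultiplication.sweedler2_cong[OF comultiplication_H a],
        rule linear_mapD(3)[OF bilinear_mapD(1)[OF bilinear_circ] one_closed])
  ultimately show "circ \<alpha> 0 a one = a"
    using sweedler2_counit(2)[OF bilinear_mapD(2)[OF bilinear_circ one_closed] a] by simp
qed

text \<open>Bracketed from the left, the antipode is the convolution product of \<open>S B\<close>,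
  \<open>S\<close> and \<open>B\<close>: the inverse \<open>B(f)^-1 f^-1 B(f)\<close> of the group
  at the identity map \<open>f\<close>.\<close>

lemma rb_antipode_eq:
  assumes g: "g \<in> carr (H \<alpha>)"
  shows "rb_antipode H m S B \<alpha> g =
    conv (H \<alpha>) 0 (- \<alpha>) (conv (H \<alpha>) \<alpha> (- \<alpha>) (right_factor \<alpha>) (S \<alpha>)) (B \<alpha>) g"
  unfolding rb_antipode_def sweedler3_def conv_def[of _ 0]
proof (rule comultiplication.sweedler2_cong[OF comultiplication_H g])
  interpret coalgebra "H \<alpha>" by (rule coalgebra)
  fix x z assume x: "x \<in> carr (H \<alpha>)" and z: "z \<in> carr (H \<alpha>)"
  have "m \<alpha> (- \<alpha>) (right_factor \<alpha> a) (S \<alpha> b) \<in> carr (H 0)" if "a \<in> carr (H \<alpha>)" "b \<in> carr (H \<alpha>)" for a b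
    by (rule mult_closed[OF linear_mapD(1)[OF linear_right_factor that(1)] linear_mapD(1)[OF linear_antipode that(2)]]) simp
  from linear_map_of_sweedler2[OF bilinear_mapD(2)[OF bilinear_mult linear_mapD(1)[OF linear_rb z]] vspace_H x this]
  show "sweedler2 (H \<alpha>) (\<lambda>x y. m 0 (- \<alpha>) (m \<alpha> (- \<alpha>) (S (- \<alpha>) (B \<alpha> x)) (S \<alpha> y)) (B \<alpha> z)) x =
      m 0 (- \<alpha>) (conv (H \<alpha>) \<alpha> (- \<alpha>) (right_factor \<alpha>) (S \<alpha>) x) (B \<alpha> z)"
    by (simp add: conv_def right_factor_def)
qed

lemma circ_antipode:
  shows "linear_map (H \<alpha>) (H (- \<alpha>)) (rb_antipode H m S B \<alpha>)"
    and "h \<in> carr (H \<alpha>) \<Longrightarrow> sweedler2 (H \<alpha>) (\<lambda>x y. circ (- \<alpha>) \<alpha> (rb_antipode H m S B \<alpha> x) y) h =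
      scal (H 0) (counit (H \<alpha>) h) one"
    and "h \<in> carr (H \<alpha>) \<Longrightarrow> sweedler2 (H \<alpha>) (\<lambda>x y. circ \<alpha> (- \<alpha>) x (rb_antipode H m S B \<alpha> y)) h =
      scal (H 0) (counit (H \<alpha>) h) one"
proof -
  let ?X = "H \<alpha>" and ?T = "rb_antipode H m S B \<alpha>" and ?a = "graded (H \<alpha>) \<alpha> (\<lambda>x. x)"
  note C = coalgebra[of \<alpha>] cocommutative[of \<alpha>]
  interpret G: rota_baxter_group "hom_group ?X" "rb_map ?X"
    by (rule rota_baxter_hom_group[OF C])
  have a: "?a \<in> carrier (hom_group ?X)"
    by (simp add: graded_in_hom_group[OF C(1)] coalgebra_hom_id)
  let ?t = "inv\<^bsub>hom_group ?X\<^esub> (rb_map ?X ?a) \<otimes>\<^bsub>hom_group ?X\<^esub> inv\<^bsub>hom_group ?X\<^esub> ?a \<otimes>\<^bsub>hom_group ?X\<^esub> rb_map ?X ?a"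
  have t: "?t = graded ?X (- \<alpha>) ?T"
    by (simp add: rb_map_graded inv_graded[OF C coalgebra_hom_id] inv_graded[OF C coalgebra_hom_rb]
        hom_group_simps(3) graded_mult[OF C(1)] graded_eq_iff rb_antipode_eq flip: right_factor_def)
  \<comment> \<open>As \<open>?t\<close> lies in the group, \<open>?T\<close> is a coalgebra map; so
    it is linear and may enter \<open>group_circ_graded\<close>.\<close>
  have T: "coalgebra_hom ?X (H (- \<alpha>)) ?T"
    using a G.B_closed[OF a] unfolding graded_in_hom_group[OF C(1), symmetric] t[symmetric] by simp
  then show "linear_map ?X (H (- \<alpha>)) ?T" by (rule coalgebra_homD)
  assume h: "h \<in> carr ?X"
  show "sweedler2 ?X (\<lambda>x y. circ (- \<alpha>) \<alpha> (?T x) y) h = scal (H 0) (counit ?X h) one"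
    using G.circ_inverse(2)[OF a refl] h unfolding t
    by (simp add: group_circ_graded(1)[OF C T coalgebra_hom_id] hom_group_simps(2) graded_eq_iff unit_map_def)
  show "sweedler2 ?X (\<lambda>x y. circ \<alpha> (- \<alpha>) x (?T y)) h = scal (H 0) (counit ?X h) one"
    using G.circ_inverse(1)[OF a refl] h unfolding t
    by (simp add: group_circ_graded(1)[OF C coalgebra_hom_id T] hom_group_simps(2) graded_eq_iff unit_map_def)
qed

text \<open>In the convolution monoid of linear maps on \<open>H\<^sub>\<alpha>\<close>, elements of \<open>H\<close> act as constants, and
  with \<open>A = id * B\<close> one has \<open>A h l (S B) = (A h (S B)) S (A l (S B))\<close> because \<open>(S B) S A = 1\<close>.\<close>

lemma circ_mult:
  assumes g: "g \<in> carr (H \<alpha>)" and h: "h \<in> carr (H \<beta>)" and l: "l \<in> carr (H \<gamma>)"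
  shows "circ \<alpha> (\<beta> + \<gamma>) g (m \<beta> \<gamma> h l) =
      sweedler3 (H \<alpha>) (\<lambda>x y z.
        m \<beta> (\<alpha> + \<gamma>) (m (\<alpha> + \<beta>) (- \<alpha>) (circ \<alpha> \<beta> x h) (S \<alpha> y)) (circ \<alpha> \<gamma> z l)) g"
proof -
  let ?X = "H \<alpha>"
  note X = coalgebra[of \<alpha>] and cc = cocommutative[of \<alpha>]
  interpret X: coalgebra ?X by (rule X)
  interpret M: monoid "conv_monoid ?X" by (rule monoid_conv[OF X])
  let ?M = "conv_monoid ?X"
  let ?i = "graded ?X \<alpha> (\<lambda>x. x)" and ?S = "graded ?X (- \<alpha>) (S \<alpha>)"
    and ?B = "graded ?X (- \<alpha>) (B \<alpha>)" and ?R = "graded ?X \<alpha> (right_factor \<alpha>)"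
  let ?c = "\<lambda>\<beta> h. graded ?X \<beta> (\<lambda>x. scal (H \<beta>) (counit ?X x) h)"
  have carr: "?i \<in> carrier ?M" "?S \<in> carrier ?M" "?B \<in> carrier ?M" "?R \<in> carrier ?M"
    by (intro graded_closed linear_map_id linear_antipode linear_rb linear_right_factor)+
  have carr_c: "?c \<beta> h \<in> carrier ?M" if "h \<in> carr (H \<beta>)" for h \<beta>
    by (rule graded_closed[OF linear_const[OF X that]])
  \<comment> \<open>\<open>graded_circ\<close> asks only for linearity of its second map, so the
    constant map of \<open>h\<close> may take that place for every \<open>h\<close>, grouplike or
    not.\<close>
  have circ_c: "?i \<otimes>\<^bsub>?M\<^esub> ?B \<otimes>\<^bsub>?M\<^esub> ?c \<beta> h \<otimes>\<^bsub>?M\<^esub> ?R = graded ?X (\<alpha> + \<beta>) (\<lambda>g. circ \<alpha> \<beta> g h)"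
    if h: "h \<in> carr (H \<beta>)" for \<beta> h
  proof -
    have "?i \<otimes>\<^bsub>?M\<^esub> ?B \<otimes>\<^bsub>?M\<^esub> ?c \<beta> h \<otimes>\<^bsub>?M\<^esub> ?R =
        graded ?X (\<alpha> + \<beta>) (sweedler2 ?X (\<lambda>x y. circ \<alpha> \<beta> x (scal (H \<beta>) (counit ?X y) h)))"
      using graded_circ[OF X cc coalgebra_hom_id linear_const[OF X h]]
      by (simp add: right_factor_def[abs_def])
    also have "\<dots> = graded ?X (\<alpha> + \<beta>) (\<lambda>g. circ \<alpha> \<beta> g h)"
      unfolding graded_eq_iff
    proof (intro conjI ballI refl)
      fix x assume x: "x \<in> carr ?X"
      show "sweedler2 ?X (\<lambda>x y. circ \<alpha> \<beta> x (scal (H \<beta>) (counit ?X y) h)) x = circ \<alpha> \<beta> x h"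
        unfolding X.sweedler2_counit(2)[OF bilinear_mapD(2)[OF bilinear_circ h] x, symmetric]
        by (rule comultiplication.sweedler2_cong[OF comultiplication_H x],
            rule linear_mapD(3)[OF bilinear_mapD(1)[OF bilinear_circ] h])
    qed
    finally show ?thesis .
  qed
  have c_mult: "?c \<beta> h \<otimes>\<^bsub>?M\<^esub> ?c \<gamma> l = ?c (\<beta> + \<gamma>) (m \<beta> \<gamma> h l)"
    by (simp add: graded_mult[OF X] graded_eq_iff conv_const(1)[OF X linear_const[OF X h] _ l]
        linear_mapD(3)[OF bilinear_mapD(2)[OF bilinear_mult l] h])
  have Si: "?S \<otimes>\<^bsub>?M\<^esub> ?i = \<one>\<^bsub>?M\<^esub>"
    using antipode_comp(2)[OF X coalgebra_hom_id] .
  have RB: "?R \<otimes>\<^bsub>?M\<^esub> ?B = \<one>\<^bsub>?M\<^esub>"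
    using antipode_comp(2)[OF X coalgebra_hom_rb] by (simp add: right_factor_def[abs_def])
  have Si': "?S \<otimes>\<^bsub>?M\<^esub> (?i \<otimes>\<^bsub>?M\<^esub> y) = y" if "y \<in> carrier ?M" for y
    using Si carr that by (metis M.m_assoc M.l_one)
  have RB': "?R \<otimes>\<^bsub>?M\<^esub> (?B \<otimes>\<^bsub>?M\<^esub> y) = y" if "y \<in> carrier ?M" for y
    using RB carr that by (metis M.m_assoc M.l_one)
  note ch = carr_c[OF h] and cl = carr_c[OF l]
  have "graded ?X (\<alpha> + (\<beta> + \<gamma>)) (\<lambda>g. circ \<alpha> (\<beta> + \<gamma>) g (m \<beta> \<gamma> h l)) =
      ?i \<otimes>\<^bsub>?M\<^esub> ?B \<otimes>\<^bsub>?M\<^esub> (?c \<beta> h \<otimes>\<^bsub>?M\<^esub> ?c \<gamma> l) \<otimes>\<^bsub>?M\<^esub> ?R"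
    unfolding c_mult by (rule circ_c[symmetric, OF mult_closed[OF h l refl]])
  also have "\<dots> = (?i \<otimes>\<^bsub>?M\<^esub> ?B \<otimes>\<^bsub>?M\<^esub> ?c \<beta> h \<otimes>\<^bsub>?M\<^esub> ?R) \<otimes>\<^bsub>?M\<^esub> ?S \<otimes>\<^bsub>?M\<^esub> (?i \<otimes>\<^bsub>?M\<^esub> ?B \<otimes>\<^bsub>?M\<^esub> ?c \<gamma> l \<otimes>\<^bsub>?M\<^esub> ?R)"
    by (simp add: M.m_assoc carr ch cl Si' RB')
  \<comment> \<open>The degree \<open>\<alpha> + \<beta> + - \<alpha>\<close> of the left factor is
    normalised to \<open>\<beta>\<close>, as in the brace identity.\<close>
  also have "\<dots> = graded ?X (\<alpha> + (\<beta> + \<gamma>)) (conv ?X \<beta> (\<alpha> + \<gamma>)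
      (conv ?X (\<alpha> + \<beta>) (- \<alpha>) (\<lambda>g. circ \<alpha> \<beta> g h) (S \<alpha>)) (\<lambda>g. circ \<alpha> \<gamma> g l))"
    unfolding circ_c[OF h] circ_c[OF l] unfolding graded_mult[OF X] by (simp add: graded_eq_iff algebra_simps)
  finally have "circ \<alpha> (\<beta> + \<gamma>) g (m \<beta> \<gamma> h l) = conv ?X \<beta> (\<alpha> + \<gamma>)
      (conv ?X (\<alpha> + \<beta>) (- \<alpha>) (\<lambda>g. circ \<alpha> \<beta> g h) (S \<alpha>)) (\<lambda>g. circ \<alpha> \<gamma> g l) g"
    using g by (simp add: graded_eq_iff)
  also have "\<dots> = sweedler3 ?X (\<lambda>x y z.
        m \<beta> (\<alpha> + \<gamma>) (m (\<alpha> + \<beta>) (- \<alpha>) (circ \<alpha> \<beta> x h) (S \<alpha> y)) (circ \<alpha> \<gamma> z l)) g"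
    unfolding sweedler3_def conv_def
  proof (rule comultiplication.sweedler2_cong[OF comultiplication_H g])
    fix x z assume x: "x \<in> carr ?X" and z: "z \<in> carr ?X"
    have "m (\<alpha> + \<beta>) (- \<alpha>) (circ \<alpha> \<beta> a h) (S \<alpha> b) \<in> carr (H \<beta>)" if "a \<in> carr ?X" "b \<in> carr ?X" for a b
      by (rule mult_closed[OF bilinear_mapD(3)[OF bilinear_circ that(1) h] linear_mapD(1)[OF linear_antipode that(2)]]) simp
    from X.linear_map_of_sweedler2[OF bilinear_mapD(2)[OF bilinear_mult bilinear_mapD(3)[OF bilinear_circ z l]] vspace_H x this]
    show "m \<beta> (\<alpha> + \<gamma>) (sweedler2 ?X (\<lambda>x y. m (\<alpha> + \<beta>) (- \<alpha>) (circ \<alpha> \<beta> x h) (S \<alpha> y)) x) (circ \<alpha> \<gamma> z l) =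
      sweedler2 ?X (\<lambda>x y. m \<beta> (\<alpha> + \<gamma>) (m (\<alpha> + \<beta>) (- \<alpha>) (circ \<alpha> \<beta> x h) (S \<alpha> y)) (circ \<alpha> \<gamma> z l)) x" .
  qed
  finally show ?thesis .
qed

lemma hopf_pi_algebra_circ: "hopf_pi_algebra H circ one (rb_antipode H m S B)"
  by (rule hopf_pi_algebra.intro)
    (assumption | rule coalgebra bilinear_circ coalgebra_hom_circ one_closed coalgebra_hom_unit
      circ_assoc circ_unit circ_antipode)+

lemma cocommutative_brace: "cocommutative_hopf_pi_brace H m one S circ one (rb_antipode H m S B)"
  by (intro cocommutative_hopf_pi_brace.intro hopf_pi_brace.intro hopf_pi_brace_axioms.intro
      cocommutative_hopf_pi_brace_axioms.intro hopf_pi_algebra_axioms hopf_pi_algebra_circ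
      circ_mult cocommutative)

end

theorem theorem4p6:
  fixes H :: "'p::ab_group_add \<Rightarrow> ('k::field, 'v::ab_group_add) coalgebra"
    and m :: "'p \<Rightarrow> 'p \<Rightarrow> 'v \<Rightarrow> 'v \<Rightarrow> 'v"
    and one :: 'v
    and S B :: "'p \<Rightarrow> 'v \<Rightarrow> 'v"
  assumes "rota_baxter_hopf_pi_algebra H m one S B"
  shows "cocommutative_hopf_pi_brace H m one S (rb_circ H m S B) one (rb_antipode H m S B)"
  by (rule rota_baxter_hopf_pi_algebra.cocommutative_brace[OF assms])

end
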